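(* Let $G$ be a finite simple graph, let $\pi=\{W_1,\ldots,W_r\}$ be a clique partition of $G$ with $r$ elements, let $G^\pi$ be the clique-whiskered graph of $G$ with respect to $\pi$, and let $S=\Bbbk[V(G^\pi)]$. Then the Hilbert series of the local cohomology module $H^r_{\mathfrak{m}}(S/I(G^\pi))$ is $$F(H^r_{\mathfrak{m}}(S/I(G^\pi)),t)=\sum_{\ell}\dim_\Bbbk[H^r_{\mathfrak{m}}(S/I(G^\pi))]_\ell\,t^\ell=\sum_i\ \sum_{C\in\mathrm{Min}(G^\pi)}\binom{|V(G)\setminus C|}{i}\left(\frac{t^{-1}}{1-t^{-1}}\right)^{r-i}.$$
   Context: Graphs are finite simple graphs; $\Bbbk$ is an arbitrary field. A clique partition $\pi=\{W_1,\ldots,W_r\}$ of $G$ is a family of cliques (vertex sets inducing complete subgraphs) whose disjoint union is $V(G)$. The clique-whiskered graph $G^\pi$ has vertex set $V(G)\cup\{w_1,\ldots,w_r\}$ (new vertices $w_a$) and edge set $E(G)\cup\bigcup_{a=1}^r\{\{x,w_a\}: x\in W_a\}$. The edge ideal $I(\Gamma)\subseteq\Bbbk[V(\Gamma)]$ is generated by the products $uv$ with $\{u,v\}\in E(\Gamma)$. $\mathrm{Min}(\Gamma)$ is the set of inclusion-minimal vertex covers of $\Gamma$. $\mathfrak{m}$ is the homogeneous maximal ideal of $S$ (standard grading); the right-hand side is read as a power series in $t^{-1}$. *)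

theory Defs
  imports
    "HOL-Algebra.QuotRing"
    "HOL-Algebra.Algebraic_Closure_Type"
    "HOL-Library.Poly_Mapping"
    "HOL-Library.Disjoint_Sets"
    "HOL-Computational_Algebra.Formal_Laurent_Series"
    "Jordan_Normal_Form.Missing_VectorSpace"
begin

section \<open>Graphs and clique-whiskering\<close>

definition simple_graph :: "'v set \<Rightarrow> 'v set set \<Rightarrow> bool" where
  "simple_graph V E \<longleftrightarrow> finite V \<and> (\<forall>e\<in>E. e \<subseteq> V \<and> card e = 2)"

definition clique :: "'v set \<Rightarrow> 'v set set \<Rightarrow> 'v set \<Rightarrow> bool" where
  "clique V E K \<longleftrightarrow> K \<subseteq> V \<and> (\<forall>x\<in>K. \<forall>y\<in>K. x \<noteq> y \<longrightarrow> {x, y} \<in> E)"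

text \<open>The cliques \<open>W a\<close> form a family indexed by \<open>{1..r}\<close>; a member may be empty.\<close>

definition clique_partition ::
  "'v set \<Rightarrow> 'v set set \<Rightarrow> nat \<Rightarrow> (nat \<Rightarrow> 'v set) \<Rightarrow> bool" where
  "clique_partition V E r W \<longleftrightarrow>
     (\<forall>a\<in>{1..r}. clique V E (W a)) \<and> disjoint_family_on W {1..r} \<and> (\<Union>a\<in>{1..r}. W a) = V"

text \<open>The vertex \<open>Inl x\<close> of the whiskered graph is the old vertex \<open>x\<close>, and \<open>Inr a\<close> is the
  new vertex attached to all of \<open>W a\<close>.\<close>

definition whisker_verts :: "'v set \<Rightarrow> nat \<Rightarrow> ('v + nat) set" where
  "whisker_verts V r = Inl ` V \<union> Inr ` {1..r}"

definition whisker_edges ::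
  "'v set set \<Rightarrow> nat \<Rightarrow> (nat \<Rightarrow> 'v set) \<Rightarrow> ('v + nat) set set" where
  "whisker_edges E r W =
     (\<lambda>e. Inl ` e) ` E \<union> (\<Union>a\<in>{1..r}. {{Inl x, Inr a} | x. x \<in> W a})"

definition vertex_cover :: "'x set \<Rightarrow> 'x set set \<Rightarrow> 'x set \<Rightarrow> bool" where
  "vertex_cover U E C \<longleftrightarrow> C \<subseteq> U \<and> (\<forall>e\<in>E. e \<inter> C \<noteq> {})"

definition min_vertex_covers :: "'x set \<Rightarrow> 'x set set \<Rightarrow> 'x set set" where
  "min_vertex_covers U E =
     {C. vertex_cover U E C \<and> (\<forall>D. vertex_cover U E D \<and> D \<subseteq> C \<longrightarrow> D = C)}"


section \<open>Polynomial rings and edge ideals\<close>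

text \<open>A monomial is an exponent vector of type \<open>'x \<Rightarrow>\<^sub>0 nat\<close>. The type
  \<open>('x \<Rightarrow>\<^sub>0 nat) \<Rightarrow>\<^sub>0 'k\<close> contains the polynomials in all variables of type \<open>'x\<close>;
  the carrier below cuts out those in the variables from \<open>U\<close>.\<close>

type_synonym ('x, 'k) mpoly = "('x \<Rightarrow>\<^sub>0 nat) \<Rightarrow>\<^sub>0 'k"

definition mpoly_ring :: "'x set \<Rightarrow> ('x, 'k::field) mpoly ring" where
  "mpoly_ring U =
     ring_of_type_algebra\<lparr>carrier := {p. \<forall>m\<in>Poly_Mapping.keys p. Poly_Mapping.keys m \<subseteq> U}\<rparr>"

definition pvar :: "'x \<Rightarrow> ('x, 'k::field) mpoly" where
  "pvar x = Poly_Mapping.single (Poly_Mapping.single x 1) 1"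

definition pconst :: "'k \<Rightarrow> ('x, 'k::field) mpoly" where
  "pconst c = Poly_Mapping.single 0 c"

definition total_degree :: "('x \<Rightarrow>\<^sub>0 nat) \<Rightarrow> nat" where
  "total_degree m = (\<Sum>x\<in>Poly_Mapping.keys m. Poly_Mapping.lookup m x)"

text \<open>The homogeneous polynomials of degree \<open>l\<close>; only \<open>0\<close> if \<open>l\<close> is negative.\<close>

definition homogeneous :: "'x set \<Rightarrow> int \<Rightarrow> ('x, 'k::field) mpoly set" where
  "homogeneous U l =
     {p \<in> carrier (mpoly_ring U). \<forall>m\<in>Poly_Mapping.keys p. int (total_degree m) = l}"

definition edge_ideal :: "'x set \<Rightarrow> 'x set set \<Rightarrow> ('x, 'k::field) mpoly set" where
  "edge_ideal U E = genideal (mpoly_ring U) {pvar u * pvar v | u v. {u, v} \<in> E}"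

definition quot_module :: "('a, 'm) ring_scheme \<Rightarrow> 'a set \<Rightarrow> ('a, 'a set) module" where
  "quot_module R I =
     \<lparr>carrier = carrier (R Quot I), monoid.mult = monoid.mult (R Quot I), one = one (R Quot I),
      zero = zero (R Quot I), add = add (R Quot I),
      module.smult = (\<lambda>a P. (I +>\<^bsub>R\<^esub> a) \<otimes>\<^bsub>R Quot I\<^esub> P)\<rparr>"

definition quot_component :: "'x set \<Rightarrow> ('x, 'k::field) mpoly set \<Rightarrow> int \<Rightarrow> ('x, 'k) mpoly set set"
  where "quot_component U I l = (\<lambda>p. I +>\<^bsub>mpoly_ring U\<^esub> p) ` homogeneous U l"


section \<open>Localization of a module at the powers of a ring element\<close>

text \<open>The pair \<open>(m, i)\<close> represents the fraction \<open>m / f ^ i\<close>. The ring multiplication and unit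
  of a module record carry no meaning for a module and are left undefined.\<close>

definition loc_rel ::
  "('a, 'r) ring_scheme \<Rightarrow> ('a, 'b, 's) module_scheme \<Rightarrow> 'a \<Rightarrow> (('b \<times> nat) \<times> ('b \<times> nat)) set"
  where
  "loc_rel R M f = {((m, i), (n, j)) | m i n j. m \<in> carrier M \<and> n \<in> carrier M \<and>
     (\<exists>k::nat. (f [^]\<^bsub>R\<^esub> (k + j)) \<odot>\<^bsub>M\<^esub> m = (f [^]\<^bsub>R\<^esub> (k + i)) \<odot>\<^bsub>M\<^esub> n)}"

definition fraction ::
  "('a, 'r) ring_scheme \<Rightarrow> ('a, 'b, 's) module_scheme \<Rightarrow> 'a \<Rightarrow> 'b \<Rightarrow> nat \<Rightarrow> ('b \<times> nat) set"
  where
  "fraction R M f m i = loc_rel R M f `` {(m, i)}"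

definition loc_module ::
  "('a, 'r) ring_scheme \<Rightarrow> ('a, 'b, 's) module_scheme \<Rightarrow> 'a \<Rightarrow> ('a, ('b \<times> nat) set) module"
  where
  "loc_module R M f =
     \<lparr>carrier = (carrier M \<times> UNIV) // loc_rel R M f,
      monoid.mult = undefined, one = undefined,
      zero = fraction R M f \<zero>\<^bsub>M\<^esub> 0,
      add = (\<lambda>P Q. \<Union>(m, i)\<in>P. \<Union>(n, j)\<in>Q.
        fraction R M f (((f [^]\<^bsub>R\<^esub> j) \<odot>\<^bsub>M\<^esub> m) \<oplus>\<^bsub>M\<^esub> ((f [^]\<^bsub>R\<^esub> i) \<odot>\<^bsub>M\<^esub> n)) (i + j)),
      module.smult = (\<lambda>a P. \<Union>(m, i)\<in>P. fraction R M f (a \<odot>\<^bsub>M\<^esub> m) i)\<rparr>"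

text \<open>The canonical map \<open>M\<^sub>f \<rightarrow> M\<^sub>h\<close> for \<open>h = f g\<close>, which sends \<open>m / f ^ i\<close> to
  \<open>(g ^ i m) / h ^ i\<close>.\<close>

definition loc_map ::
  "('a, 'r) ring_scheme \<Rightarrow> ('a, 'b, 's) module_scheme \<Rightarrow> 'a \<Rightarrow> 'a \<Rightarrow> ('b \<times> nat) set \<Rightarrow> ('b \<times> nat) set"
  where
  "loc_map R M h g P = (\<Union>(m, i)\<in>P. fraction R M h ((g [^]\<^bsub>R\<^esub> i) \<odot>\<^bsub>M\<^esub> m) i)"


section \<open>Local cohomology\<close>

text \<open>The (extended) Cech complex of \<open>M\<close> on a sequence \<open>fs = [f\<^sub>0, \<dots>, f\<^sub>n\<^sub>-\<^sub>1]\<close> of ring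
  elements is
  \<open>0 \<rightarrow> M \<rightarrow> \<Oplus>\<^sub>i M\<^bsub>f\<^sub>i\<^esub> \<rightarrow> \<Oplus>\<^sub>i\<^sub><\<^sub>j M\<^bsub>f\<^sub>i f\<^sub>j\<^esub> \<rightarrow> \<dots>\<close>.
  Its cohomology is the local cohomology of \<open>M\<close> with support in the ideal generated by \<open>fs\<close>.
  An element of the \<open>j\<close>-th term is a family indexed by the \<open>j\<close>-subsets \<open>F\<close> of \<open>{..<n}\<close>
  with values in the localization of \<open>M\<close> at \<open>cech_elem R fs F\<close>.\<close>

definition cech_faces :: "'a list \<Rightarrow> nat \<Rightarrow> nat set set" where
  "cech_faces fs j = {F. F \<subseteq> {..<length fs} \<and> card F = j}"

definition cech_elem :: "('a, 'r) ring_scheme \<Rightarrow> 'a list \<Rightarrow> nat set \<Rightarrow> 'a" where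
  "cech_elem R fs F = finprod R (\<lambda>i. fs ! i) F"

type_synonym 'b cochain = "nat set \<Rightarrow> ('b \<times> nat) set"

definition cech_module ::
  "('a, 'r) ring_scheme \<Rightarrow> ('a, 'b, 's) module_scheme \<Rightarrow> 'a list \<Rightarrow> nat \<Rightarrow> ('a, 'b cochain) module"
  where
  "cech_module R M fs j =
     \<lparr>carrier = (\<Pi>\<^sub>E F\<in>cech_faces fs j. carrier (loc_module R M (cech_elem R fs F))),
      monoid.mult = undefined, one = undefined,
      zero = (\<lambda>F\<in>cech_faces fs j. \<zero>\<^bsub>loc_module R M (cech_elem R fs F)\<^esub>),
      add = (\<lambda>c d. \<lambda>F\<in>cech_faces fs j. c F \<oplus>\<^bsub>loc_module R M (cech_elem R fs F)\<^esub> d F),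
      module.smult = (\<lambda>a c. \<lambda>F\<in>cech_faces fs j. a \<odot>\<^bsub>loc_module R M (cech_elem R fs F)\<^esub> c F)\<rparr>"

definition cech_diff ::
  "('a, 'r) ring_scheme \<Rightarrow> ('a, 'b, 's) module_scheme \<Rightarrow> 'a list \<Rightarrow> nat \<Rightarrow> 'b cochain \<Rightarrow> 'b cochain"
  where
  "cech_diff R M fs j c =
     (\<lambda>F\<in>cech_faces fs (Suc j).
        finsum (loc_module R M (cech_elem R fs F))
          (\<lambda>i. let y = loc_map R M (cech_elem R fs F) (fs ! i) (c (F - {i}))
                in if even (card {k\<in>F. k < i}) then y
                   else \<ominus>\<^bsub>loc_module R M (cech_elem R fs F)\<^esub> y)
          F)"

definition cech_cocycles ::
  "('a, 'r) ring_scheme \<Rightarrow> ('a, 'b, 's) module_scheme \<Rightarrow> 'a list \<Rightarrow> nat \<Rightarrow> 'b cochain set"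
  where
  "cech_cocycles R M fs j =
     {c \<in> carrier (cech_module R M fs j).
        cech_diff R M fs j c = \<zero>\<^bsub>cech_module R M fs (Suc j)\<^esub>}"

definition cech_coboundaries ::
  "('a, 'r) ring_scheme \<Rightarrow> ('a, 'b, 's) module_scheme \<Rightarrow> 'a list \<Rightarrow> nat \<Rightarrow> 'b cochain set"
  where
  "cech_coboundaries R M fs j =
     (case j of
        0 \<Rightarrow> {\<zero>\<^bsub>cech_module R M fs 0\<^esub>}
      | Suc i \<Rightarrow> cech_diff R M fs i ` carrier (cech_module R M fs i))"

definition subquotient ::
  "('a, 'c, 's) module_scheme \<Rightarrow> 'c set \<Rightarrow> 'c set \<Rightarrow> ('a, 'c set) module"
  where
  "subquotient C Z B =
     \<lparr>carrier = (\<lambda>z. B +>\<^bsub>C\<^esub> z) ` Z,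
      monoid.mult = undefined, one = undefined,
      zero = B,
      add = (\<lambda>P Q. P <+>\<^bsub>C\<^esub> Q),
      module.smult = (\<lambda>a P. \<Union>x\<in>P. B +>\<^bsub>C\<^esub> (a \<odot>\<^bsub>C\<^esub> x))\<rparr>"

definition local_cohomology ::
  "('a, 'r) ring_scheme \<Rightarrow> ('a, 'b, 's) module_scheme \<Rightarrow> 'a list \<Rightarrow> nat \<Rightarrow>
    ('a, 'b cochain set) module"
  where
  "local_cohomology R M fs j =
     subquotient (cech_module R M fs j) (cech_cocycles R M fs j) (cech_coboundaries R M fs j)"

text \<open>The grading. If \<open>gr l\<close> is the degree \<open>l\<close> component of \<open>M\<close> and all \<open>f\<^sub>i\<close> have degree 1,
  then \<open>m / (cech_elem R fs F) ^ k\<close> has degree \<open>l\<close> for \<open>m\<close> of degree \<open>l + k |F|\<close>.\<close>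

definition cech_component ::
  "('a, 'r) ring_scheme \<Rightarrow> ('a, 'b, 's) module_scheme \<Rightarrow> (int \<Rightarrow> 'b set) \<Rightarrow> 'a list \<Rightarrow> nat \<Rightarrow> int \<Rightarrow>
    'b cochain set"
  where
  "cech_component R M gr fs j l =
     {c \<in> carrier (cech_module R M fs j). \<forall>F\<in>cech_faces fs j.
        \<exists>k. \<exists>m\<in>gr (l + int k * int (card F)). c F = fraction R M (cech_elem R fs F) m k}"

definition local_cohomology_component ::
  "('a, 'r) ring_scheme \<Rightarrow> ('a, 'b, 's) module_scheme \<Rightarrow> (int \<Rightarrow> 'b set) \<Rightarrow> 'a list \<Rightarrow> nat \<Rightarrow> int \<Rightarrow>
    'b cochain set set"
  where
  "local_cohomology_component R M gr fs j l =
     (\<lambda>z. cech_coboundaries R M fs j +>\<^bsub>cech_module R M fs j\<^esub> z) `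
       (cech_cocycles R M fs j \<inter> cech_component R M gr fs j l)"

text \<open>The degree \<open>l\<close> component of the local cohomology module \<open>H\<^sup>j(S/I)\<close> with support in the
  maximal homogeneous ideal of \<open>S\<close>, as a vector space over the coefficient field. Here \<open>S\<close> is the
  polynomial ring whose variables are the entries of \<open>xs\<close>; the order of \<open>xs\<close> only enters
  the signs of the Cech differential.\<close>

definition local_cohomology_max ::
  "'x list \<Rightarrow> ('x, 'k::field) mpoly set \<Rightarrow> nat \<Rightarrow> int \<Rightarrow>
    ('k, ('x, 'k) mpoly set cochain set) module"
  where
  "local_cohomology_max xs I j l =
     (let S = mpoly_ring (set xs); M = quot_module S I; fs = map pvar xs;
          H = local_cohomology S M fs j
      in \<lparr>carrier = local_cohomology_component S M (quot_component (set xs) I) fs j l,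
          monoid.mult = undefined, one = undefined, zero = zero H, add = add H,
          module.smult = (\<lambda>c P. pconst c \<odot>\<^bsub>H\<^esub> P)\<rparr>)"


section \<open>Hilbert series in the inverse variable\<close>

text \<open>\<open>H l\<close> is the degree \<open>l\<close> component of a graded vector space over the field \<open>'k\<close>. The Laurent
  variable stands for \<open>t\<^sup>-\<^sup>1\<close>, so the coefficient of \<open>t\<^sup>l\<close> is the one at index \<open>- l\<close>.
  Finite-dimensionality is stated separately because \<open>vectorspace.dim\<close> has no meaningful value
  otherwise.\<close>

definition has_hilbert_series_inv :: "(int \<Rightarrow> ('k::field, 'b) module) \<Rightarrow> rat fls \<Rightarrow> bool" where
  "has_hilbert_series_inv H F \<longleftrightarrow>
     (\<forall>l. vectorspace ring_of_type_algebra (H l) \<and>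
          vectorspace.fin_dim ring_of_type_algebra (H l) \<and>
          fls_nth F (- l) = of_nat (vectorspace.dim ring_of_type_algebra (H l)))"

end

theory Submission
  imports Defs "HOL-Library.Function_Algebras"
begin

text \<open>The edge ideal \<open>I\<close> is the Stanley-Reisner ideal of the complex of independent sets. Hence
  all localizations of \<open>S/I\<close> at products of variables have bases of Laurent monomials, and the Cech
  complex splits according to exponent vectors \<open>a\<close> (\<open>adm_iff\<close>, \<open>mdiff_Cx_and_cech_diff\<close>).

  Each clique together with its new vertex is a clique of the whiskered graph. These \<open>r\<close> cliques, the
  blocks, partition the vertices, so faces have at most \<open>r\<close> elements, and
  \<open>H\<^sup>r\<close> is the quotient of the space of cochains of degree \<open>r\<close> by the coboundaries. In that degree
  the cochains have as basis the pairs \<open>(F, a)\<close> of a facet \<open>F\<close>, with one vertex in each block, and an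
  exponent vector \<open>a\<close> supported on \<open>F\<close>.

  A basis of \<open>H\<^sup>r\<close> is given by those pairs for which \<open>a\<close> is nonpositive and is strictly negative at
  all new vertices of \<open>F\<close>. They span: if some exponent of \<open>a\<close> is positive, \<open>(F, a)\<close> is a coboundary
  up to sign; if a new vertex of \<open>F\<close> has exponent zero, a coboundary trades it for original
  vertices of its block (\<open>reduce_to_hbasis\<close>). They are independent: such an
  \<open>(F, a)\<close> and the facets obtained from \<open>F\<close> by exchanging original vertices of exponent zero for the
  new vertices of their blocks form the boundary of a cross-polytope in the link of the support of
  \<open>a\<close>. Its fundamental cycle is a functional that kills the coboundaries, and these functionals are
  up to sign dual to the proposed basis (\<open>cycle_mdiff\<close>, \<open>hbasis_independent\<close>).

  It remains to count. The facets are the complements of the minimal vertex covers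
  (\<open>bij_betw_facets_covers\<close>). At a facet with \<open>s\<close> original vertices, write
  \<open>y = t\<^sup>-\<^sup>1 / (1 - t\<^sup>-\<^sup>1)\<close>; a new vertex contributes the factor \<open>y\<close> and an original one
  \<open>1 / (1 - t\<^sup>-\<^sup>1) = 1 + y\<close>, and \<open>y ^ (r - s) * (1 + y) ^ s\<close> expands into the inner sum of the
  claim.\<close>

section \<open>Linear algebra of function spaces\<close>

lemma sum_fun_apply: "(\<Sum>i\<in>A. f i) x = (\<Sum>i\<in>A. f i x)"
  for f :: "'i \<Rightarrow> 'x \<Rightarrow> 'b::comm_monoid_add"
  by (induction A rule: infinite_finite_induct) auto

text \<open>A structure whose addition is the image of that of a subgroup of a type-class group is itself an
  abelian group, and its negation and finite sums are computed upstairs. This is how all the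
  localizations below are handled: they are images of groups of functions.\<close>

lemma
  fixes N :: "('b, 'm) ring_scheme" and \<theta> :: "'g::ab_group_add \<Rightarrow> 'b"
  assumes zero: "0 \<in> Y" and add: "\<And>g h. g \<in> Y \<Longrightarrow> h \<in> Y \<Longrightarrow> g + h \<in> Y"
    and minus: "\<And>g. g \<in> Y \<Longrightarrow> - g \<in> Y"
    and carr: "carrier N = \<theta> ` Y" and z: "\<zero>\<^bsub>N\<^esub> = \<theta> 0"
    and hom: "\<And>g h. g \<in> Y \<Longrightarrow> h \<in> Y \<Longrightarrow> \<theta> g \<oplus>\<^bsub>N\<^esub> \<theta> h = \<theta> (g + h)"
  shows abelian_group_hom_image: "abelian_group N"
    and a_inv_hom_image: "\<And>g. g \<in> Y \<Longrightarrow> \<ominus>\<^bsub>N\<^esub> \<theta> g = \<theta> (- g)"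
    and finsum_hom_image:
      "\<And>A f. finite A \<Longrightarrow> (\<And>i. i \<in> A \<Longrightarrow> f i \<in> Y) \<Longrightarrow>
        finsum N (\<lambda>i. \<theta> (f i)) A = \<theta> (\<Sum>i\<in>A. f i)"
proof -
  show ag: "abelian_group N"
  proof (rule abelian_groupI)
    fix x assume "x \<in> carrier N"
    then obtain g where "g \<in> Y" "x = \<theta> g" by (auto simp: carr)
    then show "\<exists>y\<in>carrier N. y \<oplus>\<^bsub>N\<^esub> x = \<zero>\<^bsub>N\<^esub>"
      using minus[of g] hom[of "- g" g] by (auto simp: carr z intro!: bexI[of _ "- g"])
  qed (auto simp: carr z hom zero add algebra_simps)
  then interpret abelian_group N .
  show "\<ominus>\<^bsub>N\<^esub> \<theta> g = \<theta> (- g)" if "g \<in> Y" for g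
    by (rule minus_equality) (use that minus[of g] hom[of "- g" g] in \<open>auto simp: carr z\<close>)
  show "finsum N (\<lambda>i. \<theta> (f i)) A = \<theta> (\<Sum>i\<in>A. f i)"
    if "finite A" and "\<And>i. i \<in> A \<Longrightarrow> f i \<in> Y" for A f
  proof -
    have "finsum N (\<lambda>i. \<theta> (f i)) A = \<theta> (\<Sum>i\<in>A. f i) \<and> (\<Sum>i\<in>A. f i) \<in> Y"
      using that
    proof (induction A rule: finite_induct)
      case (insert i A)
      then show ?case
        by (subst finsum_insert) (auto simp: carr hom add)
    qed (auto simp: z zero)
    then show ?thesis ..
  qed
qed

text \<open>No module axiom of \<open>N\<close> is assumed: all of them are inherited from the space of functions
  supported on \<open>B\<close>.\<close>

lemma vectorspace_dim_of_bij:
  fixes N :: "('k::field, 'b) module" and \<theta> :: "('z \<Rightarrow> 'k) \<Rightarrow> 'b"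
  defines "K \<equiv> (ring_of_type_algebra :: 'k ring)"
  assumes fin: "finite B" and Y: "Y = {g. \<forall>z. z \<notin> B \<longrightarrow> g z = 0}"
    and carr: "carrier N = \<theta> ` Y" and inj: "\<And>g. g \<in> Y \<Longrightarrow> \<theta> g = \<zero>\<^bsub>N\<^esub> \<Longrightarrow> g = 0" and z: "\<zero>\<^bsub>N\<^esub> = \<theta> 0"
    and hom: "\<And>g h. g \<in> Y \<Longrightarrow> h \<in> Y \<Longrightarrow> \<theta> g \<oplus>\<^bsub>N\<^esub> \<theta> h = \<theta> (g + h)"
    and smult: "\<And>c g. g \<in> Y \<Longrightarrow> c \<odot>\<^bsub>N\<^esub> \<theta> g = \<theta> (\<lambda>z. c * g z)"
  shows "vectorspace K N" "vectorspace.fin_dim K N" "vectorspace.dim K N = card B"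
proof -
  have X0: "0 \<in> Y" and Xa: "\<And>g h. g \<in> Y \<Longrightarrow> h \<in> Y \<Longrightarrow> g + h \<in> Y" and Xm: "\<And>g. g \<in> Y \<Longrightarrow> - g \<in> Y"
    and Xs: "\<And>c g. g \<in> Y \<Longrightarrow> (\<lambda>z. c * g z) \<in> Y"
    by (auto simp: Y)
  note hom_image = abelian_group_hom_image a_inv_hom_image finsum_hom_image
  note hom_image = hom_image[where N = N and Y = Y and \<theta> = \<theta>, OF X0 Xa Xm carr z hom, simplified]
  have ag: "abelian_group N" by (rule hom_image(1))
  interpret N: abelian_group N by (rule ag)
  have fld: "Ring.field K" unfolding K_def by (rule field_from_type_algebra)
  interpret K: Ring.field K by (rule fld)
  have Ksimps: "carrier K = UNIV" "x \<oplus>\<^bsub>K\<^esub> y = x + y" "x \<otimes>\<^bsub>K\<^esub> y = x * y" "\<one>\<^bsub>K\<^esub> = 1" "\<zero>\<^bsub>K\<^esub> = 0" for x y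
    by (auto simp: K_def ring_of_type_algebra_def)
  have Mod: "Module.module K N"
  proof (rule Module.module.intro)
    show "cring K" by (rule K.is_cring)
    show "abelian_group N" by (rule ag)
    show "module_axioms K N"
    proof
      fix a b x y assume "x \<in> carrier N" "y \<in> carrier N"
      then obtain g h where g: "g \<in> Y" "x = \<theta> g" and h: "h \<in> Y" "y = \<theta> h" by (auto simp: carr)
      show "a \<odot>\<^bsub>N\<^esub> (x \<oplus>\<^bsub>N\<^esub> y) = a \<odot>\<^bsub>N\<^esub> x \<oplus>\<^bsub>N\<^esub> a \<odot>\<^bsub>N\<^esub> y"
        using g h by (simp add: hom smult Xa Xs) (simp add: algebra_simps plus_fun_def)
    next
      fix a b x assume "x \<in> carrier N"
      then obtain g where g: "g \<in> Y" "x = \<theta> g" by (auto simp: carr)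
      show "a \<odot>\<^bsub>N\<^esub> x \<in> carrier N" using g by (auto simp: carr smult Xs)
      show "(a \<oplus>\<^bsub>K\<^esub> b) \<odot>\<^bsub>N\<^esub> x = a \<odot>\<^bsub>N\<^esub> x \<oplus>\<^bsub>N\<^esub> b \<odot>\<^bsub>N\<^esub> x"
        using g by (simp add: hom smult Xa Xs Ksimps) (simp add: algebra_simps plus_fun_def)
      show "(a \<otimes>\<^bsub>K\<^esub> b) \<odot>\<^bsub>N\<^esub> x = a \<odot>\<^bsub>N\<^esub> (b \<odot>\<^bsub>N\<^esub> x)"
        using g by (simp add: smult Xs Ksimps mult.assoc)
      show "\<one>\<^bsub>K\<^esub> \<odot>\<^bsub>N\<^esub> x = x" using g by (simp add: smult Ksimps)
    qed
  qed
  show vs: "vectorspace K N"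
    using Mod fld by (simp add: vectorspace_def)
  interpret N: vectorspace K N by (rule vs)
  define e :: "'z \<Rightarrow> 'z \<Rightarrow> 'k" where "e = (\<lambda>b z. if z = b then 1 else 0)"
  have eX: "e b \<in> Y" if "b \<in> B" for b using that by (auto simp: e_def Y)
  have inj': "g = h" if "g \<in> Y" "h \<in> Y" "\<theta> g = \<theta> h" for g h
  proof -
    have "\<theta> (g + - h) = \<theta> g \<oplus>\<^bsub>N\<^esub> \<theta> (- h)"
      using hom[OF that(1) Xm[OF that(2)]] by simp
    also have "\<dots> = \<theta> h \<oplus>\<^bsub>N\<^esub> (\<ominus>\<^bsub>N\<^esub> \<theta> h)"
      using that hom_image(2)[of h] by simp
    also have "\<dots> = \<zero>\<^bsub>N\<^esub>" using that carr by (intro N.r_neg) auto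
    finally have "g + - h = 0" using inj[of "g + - h"] that Xa Xm by blast
    then show ?thesis by simp
  qed
  define A where "A = (\<lambda>b. \<theta> (e b)) ` B"
  have inje: "inj_on (\<lambda>b. \<theta> (e b)) B"
  proof (rule inj_onI)
    fix b c assume "b \<in> B" "c \<in> B" "\<theta> (e b) = \<theta> (e c)"
    then have "e b = e c" using inj' eX by blast
    then have "e b b = e c b" by simp
    then show "b = c" by (simp add: e_def split: if_splits)
  qed
  have finA: "finite A" using fin by (simp add: A_def)
  have AC: "A \<subseteq> carrier N" using eX by (auto simp: A_def carr)
  have lc: "N.lincomb a A = \<theta> (\<lambda>z. if z \<in> B then a (\<theta> (e z)) else 0)" for a
  proof -
    have "N.lincomb a A = finsum N (\<lambda>b. \<theta> (\<lambda>z. a (\<theta> (e b)) * e b z)) B"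
      unfolding N.lincomb_def A_def
      by (subst N.finsum_reindex[OF _ inje])
        (use eX Xs in \<open>auto simp: Ksimps smult carr intro!: N.finsum_cong'\<close>)
    also have "\<dots> = \<theta> (\<Sum>b\<in>B. (\<lambda>z. a (\<theta> (e b)) * e b z))"
      by (rule hom_image(3)[OF fin]) (use eX Xs in auto)
    also have "(\<Sum>b\<in>B. (\<lambda>z. a (\<theta> (e b)) * e b z)) = (\<lambda>z. if z \<in> B then a (\<theta> (e z)) else 0)"
      by (rule ext) (simp add: sum_fun_apply e_def fin if_distrib cong: if_cong)
    finally show ?thesis .
  qed
  have gen: "N.gen_set A"
  proof
    show "N.span A \<subseteq> carrier N" using N.span_is_subset2[OF AC] .
    show "carrier N \<subseteq> N.span A"
    proof
      fix x assume "x \<in> carrier N"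
      then obtain g where g: "g \<in> Y" "x = \<theta> g" by (auto simp: carr)
      define a where "a = (\<lambda>y. g (inv_into B (\<lambda>b. \<theta> (e b)) y))"
      have "N.lincomb a A = x"
        unfolding lc g(2) by (rule arg_cong[where f = \<theta>], rule ext)
          (use g(1) in \<open>auto simp: a_def inv_into_f_f[OF inje] Y\<close>)
      then show "x \<in> N.span A"
        unfolding N.span_def using finA by (auto simp: Ksimps)
    qed
  qed
  have li: "N.lin_indpt A"
  proof
    assume "N.lin_dep A"
    then obtain D a v where D: "finite D" "D \<subseteq> A" "a \<in> D \<rightarrow> carrier K" "N.lincomb a D = \<zero>\<^bsub>N\<^esub>" "v \<in> D" "a v \<noteq> \<zero>\<^bsub>K\<^esub>"
      unfolding N.lin_dep_def by blast
    define a' where "a' = (\<lambda>x. if x \<in> D then a x else 0)"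
    have "N.lincomb a' A = N.lincomb a D"
      unfolding N.lincomb_def
    proof (rule N.add.finprod_mono_neutral_cong_right[OF finA D(2), unfolded finsum_def[symmetric]], goal_cases)
      case (1 i)
      then obtain b where b: "b \<in> B" "i = \<theta> (e b)" by (auto simp: A_def)
      then show ?case using 1 eX[of b] smult[of "e b" 0] z by (simp add: a'_def zero_fun_def)
    next
      case (2 x) then show ?case by (simp add: a'_def)
    next
      case 3
      then show ?case using AC by (auto intro!: N.smult_closed simp: Ksimps)
    qed
    then have *: "(\<lambda>z. if z \<in> B then a' (\<theta> (e z)) else 0) = (0::'z \<Rightarrow> 'k)"
      using D(4) by (intro inj) (auto simp: lc Y)
    obtain b where b: "b \<in> B" "v = \<theta> (e b)" using D by (auto simp: A_def)
    then have "a v = 0" using fun_cong[OF *, of b] D(5) by (simp add: a'_def)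
    then show False using D(6) by (simp add: Ksimps)
  qed
  show "vectorspace.fin_dim K N"
    unfolding N.fin_dim_def using finA AC gen by blast
  have "vectorspace.dim K N = card A"
    by (rule N.dim_basis[OF finA]) (use li gen AC in \<open>auto simp: N.basis_def\<close>)
  then show "vectorspace.dim K N = card B"
    unfolding A_def using card_image[OF inje] by simp
qed

section \<open>Top cohomology of a whiskered complex\<close>

text \<open>The support of an exponent vector. Vectors and faces are indexed by positions in the list of variables.\<close>

definition vsupp :: "(nat \<Rightarrow> int) \<Rightarrow> nat set" where
  "vsupp a = {i. a i \<noteq> 0}"

text \<open>A Cech cochain in terms of coefficients: \<open>T F a\<close> is the coefficient at the monomial with
  exponent vector \<open>a\<close> of the entry at the face \<open>F\<close>.\<close>

type_synonym 'k mcochain = "nat set \<Rightarrow> (nat \<Rightarrow> int) \<Rightarrow> 'k"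

text \<open>Multiplication by a scalar.\<close>

definition scl :: "'k \<Rightarrow> 'k mcochain \<Rightarrow> 'k::field mcochain" where
  "scl c T = (\<lambda>F a. c * T F a)"

text \<open>The cochain with the single monomial \<open>a\<close> at the face \<open>F\<close>.\<close>

definition delta :: "nat set \<Rightarrow> (nat \<Rightarrow> int) \<Rightarrow> 'k::field mcochain" where
  "delta F a = (\<lambda>F' a'. if F' = F \<and> a' = a then 1 else 0)"

text \<open>The Cech differential from degree \<open>j\<close> to degree \<open>j + 1\<close>. A monomial with exponent vector \<open>a\<close>
  survives in the localization at \<open>F\<close> precisely if \<open>F \<union> vsupp a\<close> is a face.\<close>

definition mdiff :: "(nat set \<Rightarrow> bool) \<Rightarrow> nat \<Rightarrow> 'k mcochain \<Rightarrow> 'k::field mcochain" where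
  "mdiff face j T = (\<lambda>F a. if card F = Suc j \<and> face (F \<union> vsupp a)
     then \<Sum>i\<in>F. (-1) ^ card {k\<in>F. k < i} * T (F - {i}) a else 0)"

text \<open>Linear subspaces of the space of all cochains.\<close>

definition lin_closed :: "'k::field mcochain set \<Rightarrow> bool" where
  "lin_closed Y \<longleftrightarrow> 0 \<in> Y \<and> (\<forall>f\<in>Y. \<forall>g\<in>Y. f + g \<in> Y) \<and> (\<forall>c. \<forall>f\<in>Y. scl c f \<in> Y)"

lemma lin_closed_sum:
  assumes "lin_closed Y" and "\<And>i. i \<in> A \<Longrightarrow> f i \<in> Y"
  shows "(\<Sum>i\<in>A. f i) \<in> Y"
  using assms by (induction A rule: infinite_finite_induct) (auto simp: lin_closed_def)

lemma lin_closed_diff: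
  assumes "lin_closed Y" "f \<in> Y" "g \<in> Y"
  shows "f - g \<in> Y"
proof -
  have "f - g = f + scl (-1) g" by (auto simp: scl_def fun_eq_iff)
  then show ?thesis using assms by (metis lin_closed_def)
qed

text \<open>The independence complex of a clique-whiskered graph, described without the graph: the vertices are
  split into \<open>r\<close> blocks, a face meets each block at most once, each block \<open>b\<close> has one distinguished
  vertex \<open>wv b\<close> (the whisker), and the whisker of a block that a face misses can be added to it.
  The predicate \<open>wh\<close> singles out the whiskers.\<close>

locale whiskered_complex =
  fixes n r :: nat and face :: "nat set \<Rightarrow> bool"
    and blk wv :: "nat \<Rightarrow> nat" and wh :: "nat \<Rightarrow> bool"
  assumes face_sub: "face F \<Longrightarrow> F \<subseteq> {..<n}"
    and face_mono: "face F \<Longrightarrow> G \<subseteq> F \<Longrightarrow> face G"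
    and face_empty: "face {}"
    and blk_range: "i < n \<Longrightarrow> blk i \<in> {1..r}"
    and face_inj: "face F \<Longrightarrow> inj_on blk F"
    and wv: "b \<in> {1..r} \<Longrightarrow> wv b < n \<and> wh (wv b) \<and> blk (wv b) = b"
    and wv_blk: "i < n \<Longrightarrow> wh i \<Longrightarrow> wv (blk i) = i"
    and face_wv: "face F \<Longrightarrow> b \<in> {1..r} \<Longrightarrow> b \<notin> blk ` F \<Longrightarrow> face (insert (wv b) F)"
begin

lemma face_finite: "face F \<Longrightarrow> finite F"
  using face_sub finite_subset by blast

lemma finite_faces: "finite {F. face F}"
  by (rule finite_subset[of _ "Pow {..<n}"]) (use face_sub in auto)

lemma blk_face_sub: "face F \<Longrightarrow> blk ` F \<subseteq> {1..r}"
  using face_sub blk_range by blast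

lemma face_card_le: "face F \<Longrightarrow> card F \<le> r"
  using card_mono[OF _ blk_face_sub, of F] card_image[OF face_inj, of F] by simp

lemma blk_facet: "face F \<Longrightarrow> card F = r \<Longrightarrow> blk ` F = {1..r}"
  using card_subset_eq[OF _ blk_face_sub, of F] card_image[OF face_inj, of F] by simp

text \<open>The monomials that represent a basis of the top cohomology in degree \<open>l\<close>: a facet \<open>F\<close> and a
  nonpositive exponent vector supported on \<open>F\<close> that is strictly negative at each whisker of \<open>F\<close>.\<close>

definition hbasis :: "int \<Rightarrow> (nat set \<times> (nat \<Rightarrow> int)) set" where
  "hbasis l = {(F, a). face F \<and> card F = r \<and> vsupp a \<subseteq> F \<and> (\<forall>i. a i \<le> 0) \<and>
     (\<forall>i\<in>F. wh i \<longrightarrow> a i < 0) \<and> (\<Sum>i<n. a i) = l}"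

lemma mdiff_delta:
  fixes a :: "nat \<Rightarrow> int"
  assumes "card G = j" "finite G"
  shows "(mdiff face j (delta G a) :: 'k::field mcochain) =
    (\<Sum>u | u \<notin> G \<and> face (insert u G \<union> vsupp a).
       scl ((-1) ^ card {k\<in>G. k < u}) (delta (insert u G) a))"
    (is "_ = (\<Sum>u\<in>?U. ?s u)")
proof (intro ext)
  let ?d = "mdiff face j (delta G a) :: 'k mcochain"
  fix F' :: "nat set" and a' :: "nat \<Rightarrow> int"
  have finU: "finite ?U"
    by (rule finite_subset[of _ "{..<n}"]) (use face_sub in auto)
  have R: "(\<Sum>u\<in>?U. ?s u) F' a' =
      (\<Sum>u\<in>?U. (if F' = insert u G \<and> a' = a then (-1) ^ card {k\<in>G. k < u} else 0))"
    unfolding sum_fun_apply by (rule sum.cong) (auto simp: scl_def delta_def)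
  show "?d F' a' = (\<Sum>u\<in>?U. ?s u) F' a'"
  proof (cases "a' = a \<and> (\<exists>u. u \<in> ?U \<and> F' = insert u G)")
    case True
    then obtain u where u: "a' = a" "u \<in> ?U" "F' = insert u G" by blast
    have F'i: "F' - {i} = G \<longleftrightarrow> i = u" if "i \<in> F'" for i
      using that u by auto
    have sg: "{k\<in>F'. k < u} = {k\<in>G. k < u}" using u by auto
    have "card F' = Suc j" "face (F' \<union> vsupp a')" using u assms by simp_all
    then have "?d F' a' =
        (\<Sum>i\<in>F'. (-1) ^ card {k\<in>F'. k < i} * (if F' - {i} = G \<and> a' = a then 1 else 0))"
      by (simp add: mdiff_def delta_def)
    also have "\<dots> = (\<Sum>i\<in>F'. if i = u then (-1) ^ card {k\<in>G. k < u} else 0)"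
    proof (rule sum.cong[OF refl])
      fix i assume "i \<in> F'"
      from F'i[OF this] show "(-1) ^ card {k\<in>F'. k < i} * (if F' - {i} = G \<and> a' = a then 1 else 0) =
          (if i = u then (-1) ^ card {k\<in>G. k < u} else (0::'k))"
        using u(1) sg by simp
    qed
    also have "\<dots> = (-1) ^ card {k\<in>G. k < u}"
      using u assms by (subst sum.delta) auto
    also have "\<dots> = (\<Sum>v\<in>?U. if v = u then (-1) ^ card {k\<in>G. k < u} else 0)"
      using u finU by (subst sum.delta) auto
    also have "\<dots> = (\<Sum>v\<in>?U. (if F' = insert v G \<and> a' = a then (-1) ^ card {k\<in>G. k < v} else 0))"
      using u by (intro sum.cong) auto
    finally show ?thesis using R by simp
  next
    case False
    have "?d F' a' = 0"
      unfolding mdiff_def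
    proof (auto intro!: sum.neutral simp: delta_def, goal_cases)
      case (1 i)
      then have "i \<notin> F' - {i}" "insert i (F' - {i}) = F'" by auto
      with 1 False show ?case by (metis (mono_tags, lifting) mem_Collect_eq)
    qed
    then show ?thesis using R False by (auto intro!: sum.neutral)
  qed
qed

text \<open>Modulo coboundaries every monomial at a facet is a combination of the elements of \<open>hbasis\<close>. If
  some exponent is positive, the monomial is itself a coboundary up to sign. If a whisker \<open>w\<close> of \<open>F\<close>
  has exponent zero, the coboundary of the same monomial at \<open>F - {w}\<close> replaces \<open>F\<close> by the other facets that
  contain \<open>F - {w}\<close>, which have an original vertex in the block of \<open>w\<close>; the induction is on the number of such whiskers.\<close>

lemma delta_in_span:
  fixes Y :: "'k::field mcochain set"
  assumes Y: "lin_closed Y"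
    and dY: "\<And>j G a. Suc j = r \<Longrightarrow> card G = j \<Longrightarrow> face (G \<union> vsupp a) \<Longrightarrow> (\<And>i. i \<notin> G \<Longrightarrow> 0 \<le> a i) \<Longrightarrow>
        mdiff face j (delta G a) \<in> Y"
    and bY: "\<And>F a. (F, a) \<in> hbasis l \<Longrightarrow> delta F a \<in> Y"
    and F: "face F" "card F = r" "vsupp a \<subseteq> F" "(\<Sum>i<n. a i) = l"
  shows "delta F a \<in> Y"
  using F
proof (induction "card {i\<in>F. wh i \<and> a i = 0}" arbitrary: F rule: less_induct)
  case less
  have finF: "finite F" using less.prems face_finite by blast
  have Ys: "scl c f \<in> Y" if "f \<in> Y" for c f using that Y by (simp add: lin_closed_def)
  have neg1: "(-1::'k) ^ m * (-1) ^ m = 1" for m by (simp flip: power_mult_distrib)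
  have ss: "scl c (scl d f) = scl (c * d) f" "scl 1 f = f" for c d :: 'k and f
    by (auto simp: scl_def mult.assoc)
  consider (pos) v where "v \<in> F" "a v > 0" | (w) w where "\<And>i. a i \<le> 0" "w \<in> F" "wh w" "a w = 0"
    | (bas) "\<And>i. a i \<le> 0" "\<And>i. i \<in> F \<Longrightarrow> wh i \<Longrightarrow> a i < 0"
    using less.prems unfolding vsupp_def
    by (metis (mono_tags, lifting) linorder_not_less mem_Collect_eq order_le_less subset_iff order_less_irrefl)
  then show ?case
  proof cases
    case bas
    then show ?thesis using less.prems by (intro bY) (auto simp: hbasis_def)
  next
    case pos
    define G where "G = F - {v}"
    have G: "finite G" "card G = r - 1" "insert v G = F" "v \<notin> G"
      using pos finF less.prems by (auto simp: G_def)
    have r: "Suc (r - 1) = r" using less.prems pos finF by (cases r) auto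
    have GN: "G \<union> vsupp a = F" using pos less.prems by (auto simp: G_def vsupp_def)
    have U: "{u. u \<notin> G \<and> face (insert u G \<union> vsupp a)} = {v}"
    proof (intro equalityI subsetI; clarify)
      fix u assume u: "u \<notin> G" "face (insert u G \<union> vsupp a)"
      then have "face (insert u F)" using GN by simp
      then have "card (insert u F) \<le> r" by (rule face_card_le)
      then have "u \<in> F" using finF less.prems(2) by (cases "u \<in> F") auto
      then show "u = v" using u by (auto simp: G_def)
    next
      have "insert v G \<union> vsupp a = F" using G GN by auto
      then show "v \<notin> G \<and> face (insert v G \<union> vsupp a)" using G less.prems by simp
    qed
    have "mdiff face (r - 1) (delta G a) \<in> Y"
    proof (rule dY[OF r G(2)])
      fix i assume "i \<notin> G"
      then have "i = v \<or> i \<notin> vsupp a" using less.prems(3) by (auto simp: G_def)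
      then show "0 \<le> a i" using pos by (auto simp: vsupp_def)
    qed (use GN less.prems in simp)
    then have "scl ((-1) ^ card {k\<in>G. k < v}) (delta F a) \<in> Y"
      unfolding mdiff_delta[OF G(2,1)] U using G by simp
    from Ys[OF this, of "(-1) ^ card {k\<in>G. k < v}"] show ?thesis by (simp add: ss neg1)
  next
    case w
    define G where "G = F - {w}"
    have G: "finite G" "card G = r - 1" "insert w G = F" "w \<notin> G"
      using w finF less.prems by (auto simp: G_def)
    have r: "Suc (r - 1) = r" using less.prems w finF by (cases r) auto
    have NG: "vsupp a \<subseteq> G" using w less.prems by (auto simp: G_def vsupp_def)
    define U where "U = {u. u \<notin> G \<and> face (insert u G \<union> vsupp a)}"
    have U: "u \<notin> G" "face (insert u G)" if "u \<in> U" for u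
      using that NG by (auto simp: U_def Un_absorb2 subset_insertI2)
    have wU: "w \<in> U" using G NG less.prems by (simp add: U_def Un_absorb2 subset_insertI2)
    have finU: "finite U"
      by (rule finite_subset[of _ "{..<n}"]) (use U face_sub in auto)
    have other: "delta (insert u G) a \<in> Y" if u: "u \<in> U - {w}" for u
    proof (rule less.hyps)
      have cu: "card (insert u G) = r" using U[of u] u G r by simp
      have nwh: "\<not> wh u"
      proof
        assume "wh u"
        have un: "u < n" "w < n" using U[of u] u face_sub less.prems w by blast+
        have "blk ` insert u G = {1..r}" using blk_facet[OF _ cu] U(2) u by simp
        moreover have "blk ` insert w G = {1..r}" using blk_facet[OF less.prems(1,2)] G(3) by simp
        moreover have "blk u \<notin> blk ` G" using face_inj[OF U(2)[of u]] u U(1)[of u] by (simp add: inj_on_insert)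
        moreover have "blk w \<notin> blk ` G" using face_inj[OF U(2)[OF wU]] G(4) by (simp add: inj_on_insert)
        ultimately have "blk u = blk w" by blast
        then have "u = w" using wv_blk un \<open>wh u\<close> w by metis
        then show False using u by simp
      qed
      have "{i\<in>insert u G. wh i \<and> a i = 0} \<subset> {i\<in>F. wh i \<and> a i = 0}"
      proof (rule psubsetI)
        have "w \<notin> {i\<in>insert u G. wh i \<and> a i = 0}" using nwh w G(4) by auto
        moreover have "w \<in> {i\<in>F. wh i \<and> a i = 0}" using w by simp
        ultimately show "{i\<in>insert u G. wh i \<and> a i = 0} \<noteq> {i\<in>F. wh i \<and> a i = 0}" by metis
      qed (use nwh in \<open>auto simp: G_def\<close>)
      then show "card {i\<in>insert u G. wh i \<and> a i = 0} < card {i\<in>F. wh i \<and> a i = 0}"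
        using finF by (intro psubset_card_mono) auto
      show "face (insert u G)" using U u by simp
      show "card (insert u G) = r" by (rule cu)
      show "vsupp a \<subseteq> insert u G" using NG by auto
      show "(\<Sum>i<n. a i) = l" by (rule less.prems)
    qed
    let ?s = "\<lambda>u. (-1::'k) ^ card {k\<in>G. k < u}"
    have m: "mdiff face (r - 1) (delta G a) \<in> Y"
    proof (rule dY[OF r G(2)])
      fix i assume "i \<notin> G"
      then have "i \<notin> vsupp a" using NG by blast
      then show "0 \<le> a i" by (simp add: vsupp_def)
    next
      show "face (G \<union> vsupp a)" using NG less.prems(1) face_mono by (auto simp: Un_absorb2 G_def)
    qed
    have eq: "mdiff face (r - 1) (delta G a) =
        scl (?s w) (delta F a) + (\<Sum>u\<in>U - {w}. scl (?s u) (delta (insert u G) a))"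
      unfolding mdiff_delta[OF G(2,1)] U_def[symmetric] sum.remove[OF finU wU] using G by simp
    have "(\<Sum>u\<in>U - {w}. scl (?s u) (delta (insert u G) a)) \<in> Y"
      by (rule lin_closed_sum[OF Y]) (use other Ys in blast)
    from lin_closed_diff[OF Y m this] have "scl (?s w) (delta F a) \<in> Y"
      unfolding eq by simp
    from Ys[OF this, of "?s w"] show ?thesis by (simp add: ss neg1)
  qed
qed

lemma reduce_to_hbasis:
  fixes Y :: "'k::field mcochain set"
  assumes Y: "lin_closed Y"
    and dY: "\<And>j G a. Suc j = r \<Longrightarrow> card G = j \<Longrightarrow> face (G \<union> vsupp a) \<Longrightarrow> (\<And>i. i \<notin> G \<Longrightarrow> 0 \<le> a i) \<Longrightarrow>
        mdiff face j (delta G a) \<in> Y"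
    and fin: "finite {(F, a). f F a \<noteq> 0}"
    and f: "\<And>F a. f F a \<noteq> 0 \<Longrightarrow> face F \<and> card F = r \<and> vsupp a \<subseteq> F \<and> (\<Sum>i<n. a i) = l"
  shows "\<exists>g\<in>Y. \<forall>F a. (F, a) \<notin> hbasis l \<longrightarrow> f F a = g F a"
proof -
  define W where "W = {f. \<exists>g\<in>Y. \<forall>F a. (F, a) \<notin> hbasis l \<longrightarrow> f F a = g F a}"
  have WY: "f \<in> W" if "f \<in> Y" for f using that by (auto simp: W_def)
  have W: "lin_closed W"
    unfolding lin_closed_def
  proof (intro conjI ballI allI)
    show "0 \<in> W" using WY Y by (simp add: lin_closed_def)
  next
    fix f g assume "f \<in> W" "g \<in> W"
    then obtain f' g' where "f' \<in> Y" "g' \<in> Y"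
      and "\<forall>F a. (F, a) \<notin> hbasis l \<longrightarrow> f F a = f' F a" "\<forall>F a. (F, a) \<notin> hbasis l \<longrightarrow> g F a = g' F a"
      unfolding W_def by blast
    then show "f + g \<in> W" unfolding W_def using Y
      by (auto intro!: bexI[of _ "f' + g'"] simp: lin_closed_def)
  next
    fix c f assume "f \<in> W"
    then obtain f' where "f' \<in> Y" "\<forall>F a. (F, a) \<notin> hbasis l \<longrightarrow> f F a = f' F a"
      unfolding W_def by blast
    then show "scl c f \<in> W" unfolding W_def using Y
      by (auto intro!: bexI[of _ "scl c f'"] simp: lin_closed_def scl_def)
  qed
  have d: "delta F a \<in> W" if "f F a \<noteq> 0" for F a
  proof (rule delta_in_span[OF W])
    fix F a assume "(F, a) \<in> hbasis l"
    then show "delta F a \<in> W" unfolding W_def using Y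
      by (auto intro!: bexI[of _ 0] simp: lin_closed_def delta_def)
  qed (use WY dY f[OF that] in auto)
  let ?S = "{(F, a). f F a \<noteq> 0}"
  have "f = (\<Sum>(F, a)\<in>?S. scl (f F a) (delta F a))"
  proof (intro ext)
    fix F a
    have "(\<Sum>(F, a)\<in>?S. scl (f F a) (delta F a)) F a =
        (\<Sum>p\<in>?S. if p = (F, a) then f F a else 0)"
      by (auto simp: sum_fun_apply scl_def delta_def split_def intro!: sum.cong)
    also have "\<dots> = f F a" using fin by (subst sum.delta) auto
    finally show "f F a = (\<Sum>(F, a)\<in>?S. scl (f F a) (delta F a)) F a" ..
  qed
  also have "\<dots> \<in> W"
    by (rule lin_closed_sum[OF W]) (use d W in \<open>auto simp: lin_closed_def\<close>)
  finally show ?thesis unfolding W_def by blast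
qed

text \<open>The sign of a facet: it counts the pairs of vertices whose order by block disagrees with their order
  by position, and the whiskers. It orients the cross-polytopes used below.\<close>

definition inv_sign :: "nat \<Rightarrow> nat \<Rightarrow> 'k::field" where
  "inv_sign u v = (if blk u < blk v \<and> v < u then -1 else 1)"

definition orient :: "nat set \<Rightarrow> 'k::field" where
  "orient F = (\<Prod>u\<in>F. \<Prod>v\<in>F. inv_sign u v) * (\<Prod>u\<in>F. if wh u then -1 else 1)"

lemma sign_card: "finite G \<Longrightarrow> (-1::'k::field) ^ card {k\<in>G. P k} = (\<Prod>k\<in>G. if P k then -1 else 1)"
  by (subst prod.If_cases) (auto simp: Int_def)

text \<open>The product of the orientation of \<open>insert u G\<close> with the Cech sign of \<open>u\<close> depends only on the block
  of \<open>u\<close> and on whether \<open>u\<close> is a whisker.\<close>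

lemma orient_insert:
  assumes "finite G" "u \<notin> G" "blk u \<notin> blk ` G"
  shows "orient (insert u G) * (-1) ^ card {k\<in>G. k < u} =
    orient G * (-1::'k::field) ^ card {k\<in>G. blk k < blk u} * (if wh u then -1 else 1)"
proof -
  have "(\<Prod>v\<in>insert u G. \<Prod>w\<in>insert u G. inv_sign v w) =
      (\<Prod>v\<in>G. inv_sign u v) * (\<Prod>v\<in>G. inv_sign v u * (\<Prod>w\<in>G. inv_sign v w :: 'k))"
    using assms by (simp add: inv_sign_def)
  also have "\<dots> = (\<Prod>v\<in>G. \<Prod>w\<in>G. inv_sign v w) * (\<Prod>v\<in>G. inv_sign u v * inv_sign v u)"
    by (simp add: prod.distrib)
  also have "(\<Prod>v\<in>G. inv_sign u v * inv_sign v u :: 'k) =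
      (\<Prod>v\<in>G. (if v < u then -1 else 1) * (if blk v < blk u then -1 else 1))"
  proof (rule prod.cong[OF refl])
    fix v assume "v \<in> G"
    then have "v \<noteq> u" "blk v \<noteq> blk u" using assms by (auto, metis imageI)
    then show "(inv_sign u v * inv_sign v u :: 'k) = (if v < u then -1 else 1) * (if blk v < blk u then -1 else 1)"
      by (auto simp: inv_sign_def)
  qed
  finally have *: "orient (insert u G) = orient G * ((-1::'k) ^ card {k\<in>G. k < u} * (-1) ^ card {k\<in>G. blk k < blk u})
      * (if wh u then -1 else 1)"
    using assms by (simp add: orient_def sign_card prod.distrib)
  have "(-1::'k) ^ card {k\<in>G. k < u} * (-1) ^ card {k\<in>G. k < u} = 1"
    by (simp flip: power_mult_distrib)
  then show ?thesis unfolding * by (simp add: mult.assoc mult.left_commute mult.commute)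
qed

lemma orient_nonzero: "finite F \<Longrightarrow> orient F \<noteq> (0::'k::field)"
  by (auto simp: orient_def inv_sign_def)

lemma face_add_whiskers:
  assumes "finite Z" "face H" "\<And>i. i \<in> Z \<Longrightarrow> i < n \<and> wh i \<and> blk i \<notin> blk ` H" "inj_on blk Z"
  shows "face (H \<union> Z)"
  using assms
proof (induction Z rule: finite_induct)
  case (insert i Z)
  then have f: "face (H \<union> Z)" by auto
  have i: "i < n" "wh i" "wv (blk i) = i" using insert wv_blk by auto
  have "blk i \<notin> blk ` (H \<union> Z)" using insert by (auto simp: inj_on_def)
  from face_wv[OF f blk_range[OF i(1)] this] show ?case using i by simp
qed auto

text \<open>The facets that contain the support of \<open>a\<close> and whose original vertices all lie in \<open>F0\<close>. If
  \<open>(F0, a)\<close> belongs to \<open>hbasis\<close>, they arise from \<open>F0\<close> by replacing vertices of exponent zero by the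
  whiskers of their blocks, so in the link of \<open>vsupp a\<close> they form the boundary of a cross-polytope.\<close>

definition star_facets :: "nat set \<Rightarrow> (nat \<Rightarrow> int) \<Rightarrow> nat set set" where
  "star_facets F0 a = {F. face F \<and> card F = r \<and> vsupp a \<subseteq> F \<and> (\<forall>i\<in>F. \<not> wh i \<longrightarrow> i \<in> F0)}"

text \<open>The functional given by the cycle of that cross-polytope kills coboundaries: a ridge \<open>G\<close> of it, which
  misses the block \<open>mb G\<close>, lies in exactly two of the facets, one obtained by adding the whisker of
  that block and one by adding the vertex \<open>fv (mb G)\<close> of \<open>F0\<close>, and the two signs are opposite.\<close>

lemma cycle_mdiff:
  fixes T :: "'k::field mcochain"
  assumes F0: "(F0, a) \<in> hbasis l" and j: "Suc j = r"
    and T: "\<And>G i. i \<notin> G \<Longrightarrow> a i < 0 \<Longrightarrow> T G a = 0"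
  shows "(\<Sum>F\<in>star_facets F0 a. orient F * mdiff face j T F a) = 0"
proof -
  let ?N = "vsupp a"
  let ?Q = "star_facets F0 a"
  have F0': "face F0" "card F0 = r" "?N \<subseteq> F0" "\<And>i. a i \<le> 0" "\<And>i. i \<in> F0 \<Longrightarrow> wh i \<Longrightarrow> a i < 0"
    using F0 by (auto simp: hbasis_def)
  have finQ: "finite ?Q" by (rule finite_subset[OF _ finite_faces]) (auto simp: star_facets_def)
  have finF: "finite F" if "F \<in> ?Q" for F using that face_finite by (auto simp: star_facets_def)
  define g where "g = (\<lambda>(F, i). orient F * ((-1) ^ card {k\<in>F. k < i} * T (F - {i}) a))"
  have "(\<Sum>F\<in>?Q. orient F * mdiff face j T F a) = (\<Sum>F\<in>?Q. \<Sum>i\<in>F - ?N. g (F, i))"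
  proof (rule sum.cong[OF refl])
    fix F assume F: "F \<in> ?Q"
    then have "mdiff face j T F a = (\<Sum>i\<in>F. (-1) ^ card {k\<in>F. k < i} * T (F - {i}) a)"
      using j by (simp add: mdiff_def star_facets_def Un_absorb2)
    also have "\<dots> = (\<Sum>i\<in>F - ?N. (-1) ^ card {k\<in>F. k < i} * T (F - {i}) a)"
    proof (rule sum.mono_neutral_right)
      show "\<forall>i\<in>F - (F - ?N). (-1) ^ card {k\<in>F. k < i} * T (F - {i}) a = 0"
      proof
        fix i assume "i \<in> F - (F - ?N)"
        then have "a i < 0" using F0'(4)[of i] by (auto simp: vsupp_def)
        then show "(-1) ^ card {k\<in>F. k < i} * T (F - {i}) a = 0" using T[of i "F - {i}"] by simp
      qed
    qed (use finF F in auto)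
    finally show "orient F * mdiff face j T F a = (\<Sum>i\<in>F - ?N. g (F, i))"
      by (simp add: g_def sum_distrib_left)
  qed
  also have "\<dots> = (\<Sum>p\<in>Sigma ?Q (\<lambda>F. F - ?N). g p)"
    using finQ finF by (subst sum.Sigma) auto
  also have "Sigma ?Q (\<lambda>F. F - ?N) =
      {(F, i). F \<in> ?Q \<and> i \<in> F - ?N \<and> wh i} \<union> {(F, i). F \<in> ?Q \<and> i \<in> F - ?N \<and> \<not> wh i}"
    (is "_ = ?Pw \<union> ?Pv") by auto
  also have "(\<Sum>p\<in>?Pw \<union> ?Pv. g p) = (\<Sum>p\<in>?Pw. g p) + (\<Sum>p\<in>?Pv. g p)"
  proof (rule sum.union_disjoint)
    have "finite (Sigma ?Q (\<lambda>F. F - ?N))" using finQ finF by auto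
    then show "finite ?Pw" "finite ?Pv" by (auto elim!: rev_finite_subset)
  qed auto
  also have "\<dots> = 0"
  proof -
    \<comment> \<open>the ridges of the cross-polytope, and the block that a ridge misses\<close>
    define R where "R = {G. face G \<and> card G = j \<and> ?N \<subseteq> G \<and> (\<forall>i\<in>G. \<not> wh i \<longrightarrow> i \<in> F0)}"
    define mb where "mb = (\<lambda>G. SOME b. b \<in> {1..r} - blk ` G)"
    define fv where "fv = inv_into F0 blk"
    have mb: "mb G \<in> {1..r} - blk ` G" and mb': "b \<in> {1..r} - blk ` G \<Longrightarrow> b = mb G"
      if G: "G \<in> R" for G b
    proof -
      have "card (blk ` G) = j" using G card_image face_inj by (fastforce simp: R_def)
      moreover have "blk ` G \<subseteq> {1..r}" using G blk_face_sub by (auto simp: R_def)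
      ultimately have "card ({1..r} - blk ` G) = 1"
        using j by (subst card_Diff_subset) (auto intro: finite_subset)
      then obtain c where c: "{1..r} - blk ` G = {c}" by (auto simp: card_1_singleton_iff)
      then show m: "mb G \<in> {1..r} - blk ` G" unfolding mb_def by (metis someI_ex singletonI)
      show "b = mb G" if "b \<in> {1..r} - blk ` G" using that m unfolding c by auto
    qed
    have fv: "fv b \<in> F0" "blk (fv b) = b" if "b \<in> {1..r}" for b
      using that blk_facet[OF F0'(1,2)] unfolding fv_def
      by (metis inv_into_into, metis f_inv_into_f)
    have down: "F - {i} \<in> R \<and> mb (F - {i}) = blk i" if "F \<in> ?Q" "i \<in> F - ?N" for F i
    proof
      show R: "F - {i} \<in> R" using that j finF[OF that(1)] face_mono
        by (auto simp: R_def star_facets_def intro: face_mono)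
      have "blk i \<in> {1..r} - blk ` (F - {i})"
        using that face_sub[of F] blk_range[of i] face_inj[of F]
        by (auto simp: star_facets_def inj_on_def)
      from mb'[OF R this] show "mb (F - {i}) = blk i" ..
    qed
    have up_w: "insert (wv (mb G)) G \<in> ?Q" "wv (mb G) \<notin> G" "wh (wv (mb G))" if G: "G \<in> R" for G
    proof -
      have b: "mb G \<in> {1..r}" "mb G \<notin> blk ` G" using mb[OF G] by auto
      show nG: "wv (mb G) \<notin> G" and w: "wh (wv (mb G))" using b wv by (metis imageI)+
      show "insert (wv (mb G)) G \<in> ?Q"
        using face_wv[OF _ b] G nG face_finite[of G] j w by (auto simp: R_def star_facets_def)
    qed
    have up_v: "insert (fv (mb G)) G \<in> ?Q" "fv (mb G) \<notin> G" "\<not> wh (fv (mb G))" if G: "G \<in> R" for G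
    proof -
      have b: "mb G \<in> {1..r}" "mb G \<notin> blk ` G" using mb[OF G] by auto
      let ?v = "fv (mb G)"
      have G': "face G" "card G = j" "?N \<subseteq> G" "\<And>i. i \<in> G \<Longrightarrow> \<not> wh i \<Longrightarrow> i \<in> F0" using G by (auto simp: R_def)
      show nG: "?v \<notin> G" using b fv by (metis imageI)
      show nw: "\<not> wh ?v"
      proof
        assume "wh ?v"
        then have "?v \<in> ?N" using F0'(5)[of ?v] fv b by (auto simp: vsupp_def)
        then show False using nG G' by auto
      qed
      \<comment> \<open>the original vertices of the new set lie in \<open>F0\<close>; the whiskers can be added to them\<close>
      define H where "H = insert ?v {i\<in>G. \<not> wh i}"
      define Z where "Z = {i\<in>G. wh i}"
      have "face H" by (rule face_mono[OF F0'(1)]) (use G' fv b in \<open>auto simp: H_def\<close>)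
      moreover have "i < n \<and> wh i \<and> blk i \<notin> blk ` H" if "i \<in> Z" for i
      proof -
        have "blk i \<noteq> mb G" using that b(2) unfolding Z_def by (metis (mono_tags, lifting) imageI mem_Collect_eq)
        moreover have "blk i \<noteq> blk k" if "k \<in> G" "\<not> wh k" for k
          using face_inj[OF G'(1)] \<open>i \<in> Z\<close> that by (auto simp: Z_def inj_on_def)
        ultimately show ?thesis using that face_sub[OF G'(1)] fv b by (auto simp: Z_def H_def)
      qed
      moreover have "inj_on blk Z" using face_inj[OF G'(1)] by (auto simp: Z_def inj_on_def)
      moreover have "finite Z" using face_finite[OF G'(1)] by (auto simp: Z_def)
      ultimately have "face (H \<union> Z)" by (intro face_add_whiskers)
      also have "H \<union> Z = insert ?v G" by (auto simp: H_def Z_def)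
      finally show "insert ?v G \<in> ?Q"
        using G' nG j fv b face_finite[OF G'(1)] by (auto simp: star_facets_def)
    qed
    have NR: "?N \<subseteq> G" if "G \<in> R" for G using that by (auto simp: R_def)
    have Sw: "(\<Sum>p\<in>?Pw. g p) = (\<Sum>G\<in>R. g (insert (wv (mb G)) G, wv (mb G)))"
    proof (rule sum.reindex_bij_witness[where i = "\<lambda>G. (insert (wv (mb G)) G, wv (mb G))" and j = "\<lambda>(F, i). F - {i}"], goal_cases)
      case (1 p)
      then obtain F i where p: "p = (F, i)" "F \<in> ?Q" "i \<in> F - ?N" "wh i" by auto
      then have "wv (mb (F - {i})) = i" using down[of F i] wv_blk[of i] face_sub[of F] by (auto simp: star_facets_def)
      then show ?case using p by auto
    next
      case (2 p)
      then show ?case using down by auto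
    next
      case (3 G)
      then show ?case using up_w by auto
    next
      case (4 G)
      then show ?case using up_w[of G] NR[of G] by auto
    next
      case (5 p)
      then obtain F i where p: "p = (F, i)" "F \<in> ?Q" "i \<in> F - ?N" "wh i" by auto
      then have "wv (mb (F - {i})) = i" using down[of F i] wv_blk[of i] face_sub[of F] by (auto simp: star_facets_def)
      then show ?case using p by (simp add: insert_absorb)
    qed
    have Sv: "(\<Sum>p\<in>?Pv. g p) = (\<Sum>G\<in>R. g (insert (fv (mb G)) G, fv (mb G)))"
    proof (rule sum.reindex_bij_witness[where i = "\<lambda>G. (insert (fv (mb G)) G, fv (mb G))" and j = "\<lambda>(F, i). F - {i}"], goal_cases)
      case (1 p)
      then obtain F i where p: "p = (F, i)" "F \<in> ?Q" "i \<in> F - ?N" "\<not> wh i" by auto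
      then have "fv (mb (F - {i})) = i" using down[of F i] face_inj[OF F0'(1)]
        by (auto simp: star_facets_def fv_def)
      then show ?case using p by auto
    next
      case (2 p)
      then show ?case using down by auto
    next
      case (3 G)
      then show ?case using up_v by auto
    next
      case (4 G)
      then show ?case using up_v[of G] NR[of G] by auto
    next
      case (5 p)
      then obtain F i where p: "p = (F, i)" "F \<in> ?Q" "i \<in> F - ?N" "\<not> wh i" by auto
      then have "fv (mb (F - {i})) = i" using down[of F i] face_inj[OF F0'(1)]
        by (auto simp: star_facets_def fv_def)
      then show ?case using p by (simp add: insert_absorb)
    qed
    have g_eq: "g (insert u G, u) =
        orient G * (-1) ^ card {k\<in>G. blk k < mb G} * (if wh u then -1 else 1) * T G a"
      if "G \<in> R" "u \<notin> G" "blk u = mb G" for G u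
    proof -
      have sg: "{k \<in> insert u G. k < u} = {k\<in>G. k < u}" by auto
      have "g (insert u G, u) = orient (insert u G) * (-1) ^ card {k\<in>G. k < u} * T G a"
        using that by (simp add: g_def sg[simplified] mult.assoc)
      also have "orient (insert u G) * (-1) ^ card {k\<in>G. k < u} =
          orient G * (-1::'k) ^ card {k\<in>G. blk k < blk u} * (if wh u then -1 else 1)"
        by (rule orient_insert) (use that mb[OF that(1)] face_finite in \<open>auto simp: R_def\<close>)
      finally show ?thesis using that by simp
    qed
    have "g (insert (wv (mb G)) G, wv (mb G)) = - g (insert (fv (mb G)) G, fv (mb G))" if "G \<in> R" for G
      using up_w[OF that] up_v[OF that] mb[OF that] wv fv
      by (subst (1 2) g_eq[OF that]) auto
    then show ?thesis unfolding Sw Sv by (simp add: sum_negf)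
  qed
  finally show ?thesis .
qed

text \<open>The only facet of the cross-polytope of \<open>(F0, a)\<close> at which \<open>a\<close> again gives an element of \<open>hbasis\<close>
  is \<open>F0\<close> itself. So the functionals above are, up to sign, dual to \<open>hbasis\<close>.\<close>

lemma hbasis_independent:
  fixes T :: "'k::field mcochain"
  assumes j: "Suc j = r" and T: "\<And>G a i. i \<notin> G \<Longrightarrow> a i < 0 \<Longrightarrow> T G a = 0"
    and supp: "\<And>F a. (F, a) \<notin> hbasis l \<Longrightarrow> mdiff face j T F a = 0"
  shows "mdiff face j T = 0"
proof (intro ext)
  fix F0 a
  show "mdiff face j T F0 a = 0 F0 a"
  proof (cases "(F0, a) \<in> hbasis l")
    case True
    let ?Q = "star_facets F0 a"
    have F0: "F0 \<in> ?Q" "finite F0" using True face_finite by (auto simp: star_facets_def hbasis_def)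
    have finQ: "finite ?Q" by (rule finite_subset[OF _ finite_faces]) (auto simp: star_facets_def)
    have "orient F * mdiff face j T F a = 0" if "F \<in> ?Q - {F0}" for F
    proof (rule ccontr)
      assume *: "orient F * mdiff face j T F a \<noteq> 0"
      then have "(F, a) \<in> hbasis l" using supp by fastforce
      have "i \<in> F0" if "i \<in> F" for i
      proof (cases "wh i")
        case wh: True
        then have "i \<in> vsupp a" using \<open>(F, a) \<in> hbasis l\<close> \<open>i \<in> F\<close> by (auto simp: hbasis_def vsupp_def)
        then show ?thesis using True by (auto simp: hbasis_def)
      next
        case False
        then show ?thesis using \<open>F \<in> ?Q - {F0}\<close> \<open>i \<in> F\<close> by (auto simp: star_facets_def)
      qed
      then have "F \<subseteq> F0" ..
      then have "F = F0" using F0 that card_subset_eq[of F0 F] by (auto simp: star_facets_def)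
      then show False using that by simp
    qed
    then have "(\<Sum>F\<in>?Q - {F0}. orient F * mdiff face j T F a) = 0" by (rule sum.neutral[OF ballI])
    then have "(\<Sum>F\<in>?Q. orient F * mdiff face j T F a) = orient F0 * mdiff face j T F0 a"
      by (simp add: sum.remove[OF finQ F0(1)])
    then show ?thesis using cycle_mdiff[OF True j T] orient_nonzero[OF F0(2), where 'k = 'k] by simp
  qed (simp add: supp)
qed

end

section \<open>Monomial ideals and coefficients of polynomials\<close>

lemma mpoly_ring_simps [simp]:
  "p \<otimes>\<^bsub>mpoly_ring U\<^esub> q = p * q" "p \<oplus>\<^bsub>mpoly_ring U\<^esub> q = p + q"
  "\<one>\<^bsub>mpoly_ring U\<^esub> = 1" "\<zero>\<^bsub>mpoly_ring U\<^esub> = 0"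
  by (simp_all add: mpoly_ring_def ring_of_type_algebra_def)

lemma carrier_mpoly_ring:
  "carrier (mpoly_ring U) = {p. \<forall>m\<in>Poly_Mapping.keys p. Poly_Mapping.keys m \<subseteq> U}"
  by (simp add: mpoly_ring_def)

lemma keys_plus_nat:
  "Poly_Mapping.keys (m + m' :: 'x \<Rightarrow>\<^sub>0 nat) = Poly_Mapping.keys m \<union> Poly_Mapping.keys m'"
  by (auto simp: in_keys_iff lookup_add)

lemma cring_mpoly_ring: "cring (mpoly_ring U :: ('x, 'k::field) mpoly ring)"
proof -
  let ?R = "ring_of_type_algebra :: ('x, 'k) mpoly ring"
  let ?C = "{p. \<forall>m\<in>Poly_Mapping.keys p. Poly_Mapping.keys m \<subseteq> U} :: ('x, 'k) mpoly set"
  interpret R: cring ?R by (rule cring_from_type_algebra)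
  have R: "p \<otimes>\<^bsub>?R\<^esub> q = p * q" "p \<oplus>\<^bsub>?R\<^esub> q = p + q" "\<one>\<^bsub>?R\<^esub> = 1" "\<zero>\<^bsub>?R\<^esub> = 0" "carrier ?R = UNIV"
    for p q by (simp_all add: ring_of_type_algebra_def)
  have neg: "\<ominus>\<^bsub>?R\<^esub> p = - p" for p by (rule R.minus_equality) (simp_all add: R)
  have "subring ?C ?R"
  proof (rule R.subringI)
    fix p q assume pq: "p \<in> ?C" "q \<in> ?C"
    show "p \<otimes>\<^bsub>?R\<^esub> q \<in> ?C"
    proof (clarsimp simp: R)
      fix m x assume m: "m \<in> Poly_Mapping.keys (p * q)" and x: "x \<in> Poly_Mapping.keys m"
      obtain s t where "s \<in> Poly_Mapping.keys p" "t \<in> Poly_Mapping.keys q" "m = s + t"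
        using m keys_mult by blast
      then show "x \<in> U" using pq x by (auto simp: keys_plus_nat)
    qed
    show "p \<oplus>\<^bsub>?R\<^esub> q \<in> ?C" using pq keys_add[of p q] by (auto simp: R)
  next
    fix p assume "p \<in> ?C"
    then show "\<ominus>\<^bsub>?R\<^esub> p \<in> ?C" by (auto simp: neg in_keys_iff)
  qed (auto simp: R)
  from R.subcringI'[OF this] show ?thesis
    unfolding mpoly_ring_def by (subst (asm) R.subcring_iff) (auto simp: R)
qed

lemma a_inv_mpoly_ring [simp]:
  fixes p :: "('x, 'k::field) mpoly"
  assumes "p \<in> carrier (mpoly_ring U)"
  shows "\<ominus>\<^bsub>mpoly_ring U\<^esub> p = - p"
proof -
  interpret cring "mpoly_ring U :: ('x, 'k) mpoly ring" by (rule cring_mpoly_ring)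
  show ?thesis
    by (rule minus_equality) (use assms in \<open>auto simp: carrier_mpoly_ring in_keys_iff\<close>)
qed

lemma nat_pow_mpoly_ring [simp]:
  fixes p :: "('x, 'k::field) mpoly"
  shows "p [^]\<^bsub>mpoly_ring U\<^esub> (k::nat) = p ^ k"
proof -
  interpret cring "mpoly_ring U :: ('x, 'k) mpoly ring" by (rule cring_mpoly_ring)
  show ?thesis by (induction k) (auto simp: mult.commute)
qed

lemma finprod_mpoly_ring:
  fixes f :: "'i \<Rightarrow> ('x, 'k::field) mpoly"
  assumes "\<And>i. i \<in> A \<Longrightarrow> f i \<in> carrier (mpoly_ring U)"
  shows "finprod (mpoly_ring U) f A = (\<Prod>i\<in>A. f i)"
proof -
  interpret cring "mpoly_ring U :: ('x, 'k) mpoly ring" by (rule cring_mpoly_ring)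
  show ?thesis using assms
    by (induction A rule: infinite_finite_induct) (auto simp: Pi_def)
qed

lemma single_power: "Poly_Mapping.single s (c::'k::field) ^ k = Poly_Mapping.single (\<Sum>_<k. s) (c ^ k)"
  for s :: "'x \<Rightarrow>\<^sub>0 nat"
  by (induction k) (auto simp: mult_single add.commute lessThan_Suc)

lemma mpoly_monom_sum: "p = (\<Sum>m\<in>Poly_Mapping.keys p. Poly_Mapping.single m (Poly_Mapping.lookup p m))"
proof (rule poly_mapping_eqI)
  fix k
  have "Poly_Mapping.lookup (\<Sum>m\<in>Poly_Mapping.keys p. Poly_Mapping.single m (Poly_Mapping.lookup p m)) k =
     (\<Sum>m\<in>Poly_Mapping.keys p. if m = k then Poly_Mapping.lookup p k else 0)"
    by (auto simp: lookup_sum lookup_single when_def intro!: sum.cong)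
  also have "\<dots> = Poly_Mapping.lookup p k"
    by (auto simp: in_keys_iff)
  finally show "Poly_Mapping.lookup p k = Poly_Mapping.lookup
      (\<Sum>m\<in>Poly_Mapping.keys p. Poly_Mapping.single m (Poly_Mapping.lookup p m)) k" ..
qed

text \<open>The polynomials all of whose monomials have a support that satisfies \<open>P\<close>.\<close>

definition monomial_ideal :: "'x set \<Rightarrow> ('x set \<Rightarrow> bool) \<Rightarrow> ('x, 'k::field) mpoly set" where
  "monomial_ideal U P =
     {p \<in> carrier (mpoly_ring U). \<forall>m\<in>Poly_Mapping.keys p. P (Poly_Mapping.keys m)}"

lemma ideal_monomial_ideal:
  assumes "\<And>A B. P A \<Longrightarrow> A \<subseteq> B \<Longrightarrow> P B"
  shows "ideal (monomial_ideal U P) (mpoly_ring U :: ('x, 'k::field) mpoly ring)"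
proof -
  let ?S = "mpoly_ring U :: ('x, 'k::field) mpoly ring"
  interpret cring ?S by (rule cring_mpoly_ring)
  have mult: "p * q \<in> monomial_ideal U P" if p: "p \<in> carrier ?S" and q: "q \<in> monomial_ideal U P"
    for p q :: "('x, 'k) mpoly"
  proof -
    have "P (Poly_Mapping.keys m)" if m: "m \<in> Poly_Mapping.keys (p * q)" for m
    proof -
      obtain s t where st: "s \<in> Poly_Mapping.keys p" "t \<in> Poly_Mapping.keys q" "m = s + t"
        using m keys_mult by blast
      then show ?thesis using q assms by (auto simp: monomial_ideal_def keys_plus_nat)
    qed
    moreover have "p * q \<in> carrier ?S"
      using m_closed[OF p, of q] q by (simp add: monomial_ideal_def)
    ultimately show ?thesis by (simp add: monomial_ideal_def)
  qed
  show ?thesis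
  proof (rule idealI)
    show "subgroup (monomial_ideal U P) (add_monoid ?S)"
    proof (rule add.subgroupI)
      show "monomial_ideal U P \<noteq> ({} :: ('x, 'k) mpoly set)"
        by (auto simp: monomial_ideal_def carrier_mpoly_ring intro!: exI[of _ 0])
    next
      fix p q :: "('x, 'k) mpoly" assume "p \<in> monomial_ideal U P" "q \<in> monomial_ideal U P"
      then show "p \<oplus>\<^bsub>?S\<^esub> q \<in> monomial_ideal U P"
        using keys_add[of p q] unfolding monomial_ideal_def carrier_mpoly_ring mpoly_ring_simps by blast
    next
      fix p :: "('x, 'k) mpoly" assume p: "p \<in> monomial_ideal U P"
      then have "\<ominus>\<^bsub>?S\<^esub> p = - p" by (simp add: monomial_ideal_def)
      then show "\<ominus>\<^bsub>?S\<^esub> p \<in> monomial_ideal U P"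
        using p by (auto simp: monomial_ideal_def carrier_mpoly_ring in_keys_iff)
    qed (auto simp: monomial_ideal_def)
  next
    fix a x :: "('x, 'k) mpoly" assume "a \<in> monomial_ideal U P" "x \<in> carrier ?S"
    then show "x \<otimes>\<^bsub>?S\<^esub> a \<in> monomial_ideal U P" "a \<otimes>\<^bsub>?S\<^esub> x \<in> monomial_ideal U P"
      using mult[of x a] by (simp_all add: mult.commute[of a x])
  qed (rule ring_axioms)
qed

lemma pvar_carrier: "x \<in> U \<Longrightarrow> pvar x \<in> carrier (mpoly_ring U)"
  by (auto simp: pvar_def carrier_mpoly_ring)

text \<open>An edge ideal is spanned by the monomials whose support contains an edge.\<close>

lemma edge_ideal_eq_monomial_ideal:
  assumes E: "\<And>e. e \<in> E \<Longrightarrow> e \<subseteq> U \<and> card e = 2"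
  shows "(edge_ideal U E :: ('x, 'k::field) mpoly set) = monomial_ideal U (\<lambda>A. \<exists>e\<in>E. e \<subseteq> A)"
    (is "?I = ?J")
proof
  let ?S = "mpoly_ring U :: ('x, 'k::field) mpoly ring"
  let ?G = "{pvar u * pvar v | u v. {u, v} \<in> E} :: ('x, 'k) mpoly set"
  interpret cring ?S by (rule cring_mpoly_ring)
  have J: "ideal ?J ?S" by (rule ideal_monomial_ideal) blast
  have pp: "pvar u * pvar v =
      (Poly_Mapping.single (Poly_Mapping.single u 1 + Poly_Mapping.single v 1) 1 :: ('x, 'k) mpoly)" for u v
    by (simp add: pvar_def mult_single)
  have "?G \<subseteq> ?J"
  proof clarify
    fix u v assume uv: "{u, v} \<in> E"
    then have "u \<in> U" "v \<in> U" using E by auto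
    then show "pvar u * pvar v \<in> ?J"
      using uv by (auto simp: monomial_ideal_def carrier_mpoly_ring pp keys_plus_nat intro!: bexI[of _ "{u, v}"])
  qed
  then show "?I \<subseteq> ?J" unfolding edge_ideal_def by (rule genideal_minimal[OF J])
  have GS: "?G \<subseteq> carrier ?S" using \<open>?G \<subseteq> ?J\<close> by (auto simp: monomial_ideal_def)
  interpret I: ideal ?I ?S unfolding edge_ideal_def by (rule genideal_ideal[OF GS])
  show "?J \<subseteq> ?I"
  proof
    fix p assume p: "p \<in> ?J"
    have mono: "Poly_Mapping.single m c \<in> ?I" if "m \<in> Poly_Mapping.keys p" for m c
    proof -
      have "\<exists>e\<in>E. e \<subseteq> Poly_Mapping.keys m" using p that by (auto simp: monomial_ideal_def)
      then obtain e where e: "e \<in> E" "e \<subseteq> Poly_Mapping.keys m" by blast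
      obtain u v where uv: "e = {u, v}" "u \<noteq> v" using E[OF e(1)] by (auto simp: card_2_iff)
      define m' where "m' = m - (Poly_Mapping.single u 1 + Poly_Mapping.single v 1)"
      have m: "m = m' + (Poly_Mapping.single u 1 + Poly_Mapping.single v 1)"
        using e(2) uv unfolding m'_def
        by (intro poly_mapping_eqI) (auto simp: lookup_add lookup_minus lookup_single when_def in_keys_iff)
      have "Poly_Mapping.keys m \<subseteq> U" using p that by (auto simp: monomial_ideal_def carrier_mpoly_ring)
      then have "Poly_Mapping.single m' c \<in> carrier ?S"
        by (auto simp: carrier_mpoly_ring m keys_plus_nat)
      moreover have "pvar u * pvar v \<in> ?I"
        using genideal_self[OF GS] e uv unfolding edge_ideal_def by blast
      ultimately have "Poly_Mapping.single m' c * (pvar u * pvar v) \<in> ?I"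
        using I.I_l_closed by fastforce
      then show ?thesis by (simp add: pp mult_single m)
    qed
    have "(\<Sum>m\<in>A. Poly_Mapping.single m (Poly_Mapping.lookup p m)) \<in> ?I"
      if "finite A" "A \<subseteq> Poly_Mapping.keys p" for A
      using that
    proof (induction A rule: finite_induct)
      case empty
      then show ?case using additive_subgroup.zero_closed[OF I.is_additive_subgroup] by simp
    next
      case (insert m A)
      then show ?case using mono[of m] I.a_closed by fastforce
    qed
    then show "p \<in> ?I" by (subst mpoly_monom_sum) auto
  qed
qed

text \<open>The exponent vector of a monomial, indexed by positions in the list of variables.\<close>

definition expo :: "'x list \<Rightarrow> ('x \<Rightarrow>\<^sub>0 nat) \<Rightarrow> nat \<Rightarrow> int" where
  "expo xs m = (\<lambda>i. if i < length xs then int (Poly_Mapping.lookup m (xs ! i)) else 0)"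

text \<open>The coefficient of \<open>p\<close> at an integral exponent vector, which is zero if some exponent is negative.
  For polynomials in other variables than those of \<open>xs\<close> several monomials are added up.\<close>

definition coeff_at :: "'x list \<Rightarrow> ('x, 'k::field) mpoly \<Rightarrow> (nat \<Rightarrow> int) \<Rightarrow> 'k" where
  "coeff_at xs p b = (\<Sum>m\<in>Poly_Mapping.keys p. if expo xs m = b then Poly_Mapping.lookup p m else 0)"

lemma expo_add: "expo xs (m + m') = expo xs m + expo xs m'"
  by (rule ext) (simp add: expo_def lookup_add)

lemma expo_sum: "expo xs (\<Sum>i\<in>A. f i) = (\<Sum>i\<in>A. expo xs (f i))"
proof -
  have "expo xs 0 = 0" by (auto simp: expo_def)
  then show ?thesis by (induction A rule: infinite_finite_induct) (auto simp: expo_add)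
qed

lemma expo_inj:
  assumes "Poly_Mapping.keys m \<subseteq> set xs" "Poly_Mapping.keys m' \<subseteq> set xs" "expo xs m = expo xs m'"
  shows "m = m'"
proof (rule poly_mapping_eqI)
  fix x
  show "Poly_Mapping.lookup m x = Poly_Mapping.lookup m' x"
  proof (cases "x \<in> set xs")
    case True
    then obtain i where "i < length xs" "x = xs ! i" by (auto simp: in_set_conv_nth)
    then show ?thesis using fun_cong[OF assms(3), of i] by (simp add: expo_def)
  next
    case False
    then have "x \<notin> Poly_Mapping.keys m" "x \<notin> Poly_Mapping.keys m'" using assms(1,2) by auto
    then show ?thesis by (simp add: in_keys_iff)
  qed
qed

lemma coeff_at_superset:
  assumes "finite A" "Poly_Mapping.keys p \<subseteq> A"
  shows "coeff_at xs p b = (\<Sum>m\<in>A. if expo xs m = b then Poly_Mapping.lookup p m else 0)"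
  unfolding coeff_at_def
  by (rule sum.mono_neutral_left[OF assms]) (simp add: in_keys_iff)

lemma coeff_at_add [simp]: "coeff_at xs (p + q) = coeff_at xs p + coeff_at xs q"
proof
  fix b
  let ?A = "Poly_Mapping.keys p \<union> Poly_Mapping.keys q"
  have A: "finite ?A" "Poly_Mapping.keys p \<subseteq> ?A" "Poly_Mapping.keys q \<subseteq> ?A" "Poly_Mapping.keys (p + q) \<subseteq> ?A"
    using keys_add[of p q] by simp_all
  have "coeff_at xs (p + q) b = (\<Sum>m\<in>?A. (if expo xs m = b then Poly_Mapping.lookup p m else 0) +
      (if expo xs m = b then Poly_Mapping.lookup q m else 0))"
    unfolding coeff_at_superset[OF A(1,4)] by (rule sum.cong) (simp_all add: lookup_add)
  then show "coeff_at xs (p + q) b = (coeff_at xs p + coeff_at xs q) b"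
    by (simp add: coeff_at_superset[OF A(1,2)] coeff_at_superset[OF A(1,3)] sum.distrib)
qed

lemma coeff_at_zero [simp]: "coeff_at xs 0 = 0"
  by (rule ext) (simp add: coeff_at_def)

lemma coeff_at_uminus [simp]: "coeff_at xs (- p) = - coeff_at xs p"
proof -
  have "coeff_at xs (- p) + coeff_at xs p = 0"
    by (simp flip: coeff_at_add)
  then show ?thesis by (simp only: eq_neg_iff_add_eq_0)
qed

lemma coeff_at_diff [simp]: "coeff_at xs (p - q) = coeff_at xs p - coeff_at xs q"
  using coeff_at_add[of xs p "- q"] by (metis add_uminus_conv_diff coeff_at_uminus)

lemma coeff_at_sum: "coeff_at xs (\<Sum>i\<in>A. f i) = (\<Sum>i\<in>A. coeff_at xs (f i))"
  by (induction A rule: infinite_finite_induct) auto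

lemma coeff_at_single: "coeff_at xs (Poly_Mapping.single m c) b = (if expo xs m = b then c else 0)"
  by (simp add: coeff_at_def)

lemma coeff_at_mult_single:
  "coeff_at xs (Poly_Mapping.single s c * p) b = c * coeff_at xs p (b - expo xs s)"
proof -
  have "Poly_Mapping.single s c * p =
      (\<Sum>m\<in>Poly_Mapping.keys p. Poly_Mapping.single (s + m) (c * Poly_Mapping.lookup p m))"
    by (subst mpoly_monom_sum[of p]) (simp add: sum_distrib_left mult_single)
  then have "coeff_at xs (Poly_Mapping.single s c * p) b =
      (\<Sum>m\<in>Poly_Mapping.keys p. if expo xs s + expo xs m = b then c * Poly_Mapping.lookup p m else 0)"
    by (simp add: coeff_at_sum sum_fun_apply coeff_at_single expo_add)
  also have "\<dots> = c * coeff_at xs p (b - expo xs s)"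
    unfolding coeff_at_def sum_distrib_left
    by (rule sum.cong) (auto simp: algebra_simps)
  finally show ?thesis .
qed

lemma coeff_at_expo:
  assumes "p \<in> carrier (mpoly_ring (set xs))" "Poly_Mapping.keys m \<subseteq> set xs"
  shows "coeff_at xs p (expo xs m) = Poly_Mapping.lookup p m"
proof -
  have "coeff_at xs p (expo xs m) = (\<Sum>m'\<in>Poly_Mapping.keys p. if m' = m then Poly_Mapping.lookup p m' else 0)"
    unfolding coeff_at_def
    by (rule sum.cong) (use assms in \<open>auto simp: carrier_mpoly_ring dest: expo_inj[OF _ assms(2)]\<close>)
  then show ?thesis by (auto simp: in_keys_iff)
qed

lemma coeff_at_nonzero: "coeff_at xs p b \<noteq> 0 \<Longrightarrow> \<exists>m\<in>Poly_Mapping.keys p. b = expo xs m"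
  unfolding coeff_at_def by (elim sum.not_neutral_contains_not_neutral) (auto split: if_splits)

lemma finite_coeff_at: "finite {b. coeff_at xs p b \<noteq> 0}"
proof (rule finite_subset[of _ "expo xs ` Poly_Mapping.keys p"])
  show "{b. coeff_at xs p b \<noteq> 0} \<subseteq> expo xs ` Poly_Mapping.keys p"
    using coeff_at_nonzero[of xs p] by blast
qed simp

lemma vsupp_expo: "vsupp (expo xs m) = {i. i < length xs \<and> xs ! i \<in> Poly_Mapping.keys m}"
  by (auto simp: vsupp_def expo_def in_keys_iff)

lemma sum_expo:
  assumes "distinct xs" "Poly_Mapping.keys m \<subseteq> set xs"
  shows "(\<Sum>i<length xs. expo xs m i) = int (total_degree m)"
proof -
  have "(\<Sum>i<length xs. expo xs m i) = (\<Sum>i<length xs. int (Poly_Mapping.lookup m (xs ! i)))"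
    by (auto simp: expo_def)
  also have "\<dots> = (\<Sum>x\<in>set xs. int (Poly_Mapping.lookup m x))"
    by (rule sum.reindex_bij_betw) (use assms bij_betw_nth in blast)
  also have "\<dots> = (\<Sum>x\<in>Poly_Mapping.keys m. int (Poly_Mapping.lookup m x))"
    by (rule sum.mono_neutral_right) (use assms in \<open>auto simp: in_keys_iff\<close>)
  finally show ?thesis by (simp add: total_degree_def)
qed

text \<open>Every nonnegative exponent vector is the vector of a monomial.\<close>

lemma expo_surj:
  assumes "distinct xs" "\<And>i. 0 \<le> b i" "vsupp b \<subseteq> {..<length xs}"
  obtains m where "Poly_Mapping.keys m \<subseteq> set xs" "expo xs m = b"
proof
  define m where "m = (\<Sum>i<length xs. Poly_Mapping.single (xs ! i) (nat (b i)))"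
  have l: "Poly_Mapping.lookup m (xs ! i) = nat (b i)" if "i < length xs" for i
    using that assms(1)
    by (simp add: m_def lookup_sum lookup_single when_def nth_eq_iff_index_eq flip: if_distrib cong: if_cong)
  show "expo xs m = b"
    using assms(2,3) l by (auto simp: expo_def vsupp_def fun_eq_iff)
  have "Poly_Mapping.keys m \<subseteq> (\<Union>i<length xs. Poly_Mapping.keys (Poly_Mapping.single (xs ! i) (nat (b i))))"
    unfolding m_def by (rule keys_sum)
  then show "Poly_Mapping.keys m \<subseteq> set xs" by (auto split: if_splits)
qed

section \<open>Localizations of a Stanley-Reisner ring\<close>

text \<open>Adding \<open>c\<close> to the exponents at \<open>F\<close>: multiplication by \<open>(x\<^sup>F)\<^sup>c\<close>.\<close>

definition shift :: "nat set \<Rightarrow> int \<Rightarrow> (nat \<Rightarrow> int) \<Rightarrow> nat \<Rightarrow> int" where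
  "shift F c a = (\<lambda>i. a i + (if i \<in> F then c else 0))"

lemma shift_shift [simp]: "shift F c (shift F d a) = shift F (c + d) a"
  by (auto simp: shift_def)

lemma shift_0 [simp]: "shift F 0 a = a"
  by (auto simp: shift_def)

lemma UN_const: "A \<noteq> {} \<Longrightarrow> (\<And>x. x \<in> A \<Longrightarrow> f x = c) \<Longrightarrow> (\<Union>x\<in>A. f x) = c"
  by blast

text \<open>The ideal \<open>I\<close> is spanned by the monomials whose support is not a face of a simplicial complex.\<close>

locale stanley_reisner =
  fixes xs :: "'x list" and face :: "nat set \<Rightarrow> bool" and I :: "('x, 'k::field) mpoly set"
  assumes dist: "distinct xs"
    and face_sub: "face F \<Longrightarrow> F \<subseteq> {..<length xs}"
    and face_mono: "face F \<Longrightarrow> G \<subseteq> F \<Longrightarrow> face G"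
    and I_eq: "I = monomial_ideal (set xs) (\<lambda>A. \<not> face {i. i < length xs \<and> xs ! i \<in> A})"
begin

text \<open>\<open>M\<close> is the quotient of the polynomial ring \<open>S\<close> by \<open>I\<close>, with classes \<open>cl p\<close>, and \<open>fel F\<close> is the
  monomial \<open>x\<^sup>F\<close>, the product of the variables at the positions in \<open>F\<close>.\<close>

abbreviation S :: "('x, 'k) mpoly ring" where "S \<equiv> mpoly_ring (set xs)"
abbreviation M :: "(('x, 'k) mpoly, ('x, 'k) mpoly set) module" where "M \<equiv> quot_module S I"
abbreviation fs :: "('x, 'k) mpoly list" where "fs \<equiv> map pvar xs"
abbreviation fel :: "nat set \<Rightarrow> ('x, 'k) mpoly" where "fel F \<equiv> cech_elem S fs F"
abbreviation cl :: "('x, 'k) mpoly \<Rightarrow> ('x, 'k) mpoly set" where "cl p \<equiv> I +>\<^bsub>S\<^esub> p"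

sublocale S: cring S by (rule cring_mpoly_ring)

lemma ideal_I: "ideal I S"
  unfolding I_eq by (rule ideal_monomial_ideal) (auto intro: face_mono)

sublocale I: ideal I S by (rule ideal_I)

lemma S_add: "p \<in> carrier S \<Longrightarrow> q \<in> carrier S \<Longrightarrow> p + q \<in> carrier S"
  using S.a_closed[of p q] by simp
lemma S_mult: "p \<in> carrier S \<Longrightarrow> q \<in> carrier S \<Longrightarrow> p * q \<in> carrier S"
  using S.m_closed[of p q] by simp
lemma S_zero: "0 \<in> carrier S"
  using S.zero_closed by simp
lemma S_uminus: "p \<in> carrier S \<Longrightarrow> - p \<in> carrier S"
  using S.a_inv_closed[of p] by simp
lemma S_power: "p \<in> carrier S \<Longrightarrow> p ^ k \<in> carrier S"
  using S.nat_pow_closed[of p k] by simp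
lemma S_const: "pconst c \<in> carrier S"
  by (simp add: pconst_def carrier_mpoly_ring)

lemmas S_closed = S_add S_mult S_zero S_uminus S_power S_const

lemma mem_I_iff:
  assumes "p \<in> carrier S"
  shows "p \<in> I \<longleftrightarrow> (\<forall>b. face (vsupp b) \<longrightarrow> coeff_at xs p b = 0)"
proof
  assume p: "p \<in> I"
  show "\<forall>b. face (vsupp b) \<longrightarrow> coeff_at xs p b = 0"
  proof (intro allI impI, rule ccontr)
    fix b assume b: "face (vsupp b)" "coeff_at xs p b \<noteq> 0"
    from coeff_at_nonzero[OF b(2)] obtain m where m: "m \<in> Poly_Mapping.keys p" "b = expo xs m" by blast
    have "\<not> face {i. i < length xs \<and> xs ! i \<in> Poly_Mapping.keys m}"
      using p m(1) unfolding I_eq monomial_ideal_def by blast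
    then show False using b(1) unfolding m(2) vsupp_expo by contradiction
  qed
next
  assume *: "\<forall>b. face (vsupp b) \<longrightarrow> coeff_at xs p b = 0"
  have "\<not> face {i. i < length xs \<and> xs ! i \<in> Poly_Mapping.keys m}" if m: "m \<in> Poly_Mapping.keys p" for m
  proof
    assume "face {i. i < length xs \<and> xs ! i \<in> Poly_Mapping.keys m}"
    then have "coeff_at xs p (expo xs m) = 0" using * by (simp add: vsupp_expo)
    moreover have "Poly_Mapping.keys m \<subseteq> set xs" using m assms by (auto simp: carrier_mpoly_ring)
    ultimately show False using coeff_at_expo[OF assms] m by (auto simp: in_keys_iff)
  qed
  then show "p \<in> I" using assms unfolding I_eq monomial_ideal_def by blast
qed

lemma cl_eq_iff:
  assumes "p \<in> carrier S" "q \<in> carrier S"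
  shows "cl p = cl q \<longleftrightarrow> (\<forall>b. face (vsupp b) \<longrightarrow> coeff_at xs p b = coeff_at xs q b)"
proof -
  have "cl p = cl q \<longleftrightarrow> p - q \<in> I"
    using S.quotient_eq_iff_same_a_r_cos[OF ideal_I assms] assms by (simp add: a_minus_def)
  then show ?thesis
    using mem_I_iff[of "p - q"] S_add[OF assms(1) S_uminus[OF assms(2)]] by simp
qed

lemma M_simps:
  shows "carrier M = cl ` carrier S"
    and "\<zero>\<^bsub>M\<^esub> = cl 0"
    and "p \<in> carrier S \<Longrightarrow> q \<in> carrier S \<Longrightarrow> cl p \<oplus>\<^bsub>M\<^esub> cl q = cl (p + q)"
    and "p \<in> carrier S \<Longrightarrow> q \<in> carrier S \<Longrightarrow> p \<odot>\<^bsub>M\<^esub> cl q = cl (p * q)"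
proof -
  show "carrier M = cl ` carrier S"
    by (auto simp: quot_module_def FactRing_def A_RCOSETS_def')
  show "\<zero>\<^bsub>M\<^esub> = cl 0"
    using S.a_coset_add_zero[OF I.a_subset] by (simp add: quot_module_def FactRing_def)
  show "cl p \<oplus>\<^bsub>M\<^esub> cl q = cl (p + q)" if "p \<in> carrier S" "q \<in> carrier S"
    using I.a_rcos_sum[OF that] by (simp add: quot_module_def FactRing_def)
  show "p \<odot>\<^bsub>M\<^esub> cl q = cl (p * q)" if "p \<in> carrier S" "q \<in> carrier S"
    using I.rcoset_mult_add[OF that] by (simp add: quot_module_def FactRing_def)
qed

lemma fs_carrier: "i < length xs \<Longrightarrow> fs ! i \<in> carrier S"
  by (simp add: pvar_carrier)

lemma fel_eq:
  assumes "F \<subseteq> {..<length xs}"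
  shows "fel F = Poly_Mapping.single (\<Sum>i\<in>F. Poly_Mapping.single (xs ! i) 1) 1"
proof -
  have "fel F = (\<Prod>i\<in>F. fs ! i)"
    unfolding cech_elem_def using assms fs_carrier by (intro finprod_mpoly_ring) auto
  also have "\<dots> = (\<Prod>i\<in>F. pvar (xs ! i))"
    using assms by (intro prod.cong) auto
  also have "\<dots> = Poly_Mapping.single (\<Sum>i\<in>F. Poly_Mapping.single (xs ! i) 1) 1"
    by (induction F rule: infinite_finite_induct) (auto simp: pvar_def mult_single)
  finally show ?thesis .
qed

lemma fel_carrier: "F \<subseteq> {..<length xs} \<Longrightarrow> fel F \<in> carrier S"
  unfolding cech_elem_def using fs_carrier by (intro S.finprod_closed) auto

lemma expo_indicator:
  assumes "F \<subseteq> {..<length xs}"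
  shows "expo xs (\<Sum>i\<in>F. Poly_Mapping.single (xs ! i) 1) = (\<lambda>i. if i \<in> F then 1 else 0)"
proof
  fix k
  have finF: "finite F" using assms finite_subset by blast
  show "expo xs (\<Sum>i\<in>F. Poly_Mapping.single (xs ! i) 1) k = (if k \<in> F then 1 else 0)"
  proof (cases "k < length xs")
    case True
    have "Poly_Mapping.lookup (\<Sum>i\<in>F. Poly_Mapping.single (xs ! i) (1::nat)) (xs ! k) =
        (\<Sum>i\<in>F. if i = k then 1 else 0)"
      unfolding lookup_sum
      by (rule sum.cong) (use True assms dist in \<open>auto simp: lookup_single when_def nth_eq_iff_index_eq\<close>)
    then show ?thesis using True finF by (simp add: expo_def del: One_nat_def)
  next
    case False
    then show ?thesis using assms by (auto simp: expo_def)
  qed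
qed

lemma coeff_at_fel_power:
  assumes "F \<subseteq> {..<length xs}"
  shows "coeff_at xs (fel F ^ k * p) b = coeff_at xs p (shift F (- int k) b)"
proof -
  have "b - expo xs (\<Sum>_<k. \<Sum>i\<in>F. Poly_Mapping.single (xs ! i) 1) = shift F (- int k) b"
    unfolding expo_sum[of _ _ "{..<k}"] expo_indicator[OF assms]
    by (auto simp: shift_def sum_fun_apply)
  then show ?thesis
    unfolding fel_eq[OF assms] single_power coeff_at_mult_single by simp
qed

lemma coeff_at_pvar_power:
  fixes p :: "('x, 'k) mpoly"
  assumes "i < length xs"
  shows "coeff_at xs (pvar (xs ! i) ^ k * p) b = coeff_at xs p (shift {i} (- int k) b)"
  using coeff_at_fel_power[of "{i}" k p b] assms fel_eq[of "{i}"] by (simp add: pvar_def)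

text \<open>The coefficients of the fraction \<open>p / (x\<^sup>F)\<^sup>k\<close> at those exponent vectors that survive
  in the localization.\<close>

definition lcoeff :: "nat set \<Rightarrow> ('x, 'k) mpoly \<Rightarrow> nat \<Rightarrow> (nat \<Rightarrow> int) \<Rightarrow> 'k" where
  "lcoeff F p k = (\<lambda>a. if face (F \<union> vsupp a) then coeff_at xs p (shift F (int k) a) else 0)"

text \<open>Two fractions agree in the localization precisely if their surviving coefficients agree.\<close>

lemma loc_rel_iff:
  assumes F: "F \<subseteq> {..<length xs}" and p: "p \<in> carrier S" and q: "q \<in> carrier S"
  shows "((cl p, i), (cl q, j)) \<in> loc_rel S M (fel F) \<longleftrightarrow> lcoeff F p i = lcoeff F q j"
proof -
  have fc: "fel F \<in> carrier S" by (rule fel_carrier[OF F])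
  have rel: "((cl p, i), (cl q, j)) \<in> loc_rel S M (fel F) \<longleftrightarrow>
      (\<exists>k. cl (fel F ^ (k + j) * p) = cl (fel F ^ (k + i) * q))"
    using p q fc by (auto simp: loc_rel_def M_simps S_power)
  have eq: "cl (fel F ^ (k + j) * p) = cl (fel F ^ (k + i) * q) \<longleftrightarrow>
      (\<forall>b. face (vsupp b) \<longrightarrow>
        coeff_at xs p (shift F (- int (k + j)) b) = coeff_at xs q (shift F (- int (k + i)) b))" for k
    using p q fc by (subst cl_eq_iff) (auto simp: S_closed coeff_at_fel_power[OF F])
  show ?thesis
  proof
    assume "((cl p, i), (cl q, j)) \<in> loc_rel S M (fel F)"
    then obtain k where k: "\<And>b. face (vsupp b) \<Longrightarrow>
        coeff_at xs p (shift F (- int (k + j)) b) = coeff_at xs q (shift F (- int (k + i)) b)"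
      unfolding rel eq by blast
    show "lcoeff F p i = lcoeff F q j"
    proof
      fix a
      show "lcoeff F p i a = lcoeff F q j a"
      proof (cases "face (F \<union> vsupp a)")
        case True
        have "vsupp (shift F (int (k + i + j)) a) \<subseteq> F \<union> vsupp a"
          by (auto simp: vsupp_def shift_def)
        from k[OF face_mono[OF True this]] True show ?thesis
          by (simp add: lcoeff_def)
      qed (simp add: lcoeff_def)
    qed
  next
    assume *: "lcoeff F p i = lcoeff F q j"
    \<comment> \<open>one extra factor of \<open>x\<^sup>F\<close> kills the monomials whose support together with \<open>F\<close> is not a face\<close>
    have "coeff_at xs p (shift F (- int (1 + j)) b) = coeff_at xs q (shift F (- int (1 + i)) b)"
      if b: "face (vsupp b)" for b
    proof -
      define a where "a = shift F (- int (1 + i + j)) b"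
      have pa: "shift F (- int (1 + j)) b = shift F (int i) a" and qa: "shift F (- int (1 + i)) b = shift F (int j) a"
        by (simp_all add: a_def algebra_simps)
      show ?thesis
      proof (cases "face (F \<union> vsupp a)")
        case True
        then show ?thesis unfolding pa qa using fun_cong[OF *, of a] by (simp add: lcoeff_def)
      next
        case False
        have zero: "coeff_at xs p' (shift F (int i') a) = 0" if "i' = i \<or> i' = j" for p' :: "('x, 'k) mpoly" and i'
        proof (rule ccontr)
          assume "coeff_at xs p' (shift F (int i') a) \<noteq> 0"
          then obtain m where m: "shift F (int i') a = expo xs m" using coeff_at_nonzero by blast
          have nn: "a k + (if k \<in> F then int i' else 0) \<ge> 0" for k
            using fun_cong[OF m, of k] by (auto simp: shift_def expo_def)
          have bk: "b k = a k + (if k \<in> F then 1 + int i + int j else 0)" for k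
            by (simp add: a_def shift_def)
          have "F \<union> vsupp a \<subseteq> vsupp b"
          proof
            fix k assume k: "k \<in> F \<union> vsupp a"
            show "k \<in> vsupp b"
              using k nn[of k] bk[of k] that by (auto simp: vsupp_def split: if_splits)
          qed
          then show False using False b face_mono by blast
        qed
        show ?thesis unfolding pa qa using zero[of i p] zero[of j q] by simp
      qed
    qed
    then show "((cl p, i), (cl q, j)) \<in> loc_rel S M (fel F)" unfolding rel eq by blast
  qed
qed

text \<open>The fraction with coefficient function \<open>g\<close>.\<close>

definition lfrac :: "nat set \<Rightarrow> ((nat \<Rightarrow> int) \<Rightarrow> 'k) \<Rightarrow> (('x, 'k) mpoly set \<times> nat) set" where
  "lfrac F g = {(cl q, j) | q j. q \<in> carrier S \<and> lcoeff F q j = g}"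

text \<open>The coefficient functions of the elements of the localization at \<open>x\<^sup>F\<close>.\<close>

definition adm :: "nat set \<Rightarrow> ((nat \<Rightarrow> int) \<Rightarrow> 'k) set" where
  "adm F = {lcoeff F p k | p k. p \<in> carrier S}"

lemma fraction_eq:
  assumes "F \<subseteq> {..<length xs}" "p \<in> carrier S"
  shows "fraction S M (fel F) (cl p) i = lfrac F (lcoeff F p i)"
proof -
  have "fraction S M (fel F) (cl p) i =
      {(cl q, j) | q j. q \<in> carrier S \<and> ((cl p, i), (cl q, j)) \<in> loc_rel S M (fel F)}"
  proof -
    have "n \<in> cl ` carrier S" if "((cl p, i), (n, j)) \<in> loc_rel S M (fel F)" for n j
      using that by (auto simp: loc_rel_def M_simps(1))
    then show ?thesis unfolding fraction_def Image_singleton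
      by (smt (verit) Collect_cong image_iff old.prod.exhaust)
  qed
  also have "\<dots> = lfrac F (lcoeff F p i)"
    unfolding lfrac_def by (intro Collect_cong) (metis loc_rel_iff[OF assms(1) assms(2)])
  finally show ?thesis .
qed

lemma lfrac_inj:
  assumes "g \<in> adm F" "F \<subseteq> {..<length xs}" "lfrac F g = lfrac F h"
  shows "g = h"
proof -
  obtain p k where p: "p \<in> carrier S" "lcoeff F p k = g" using assms(1) by (auto simp: adm_def)
  then have "(cl p, k) \<in> lfrac F g" by (auto simp: lfrac_def)
  then have "(cl p, k) \<in> lfrac F h" by (simp only: assms(3))
  then obtain q where q: "q \<in> carrier S" "lcoeff F q k = h" "cl p = cl q" by (auto simp: lfrac_def)
  have "((cl p, k), (cl p, k)) \<in> loc_rel S M (fel F)"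
    using loc_rel_iff[OF assms(2) p(1) p(1)] by simp
  then have "((cl p, k), (cl q, k)) \<in> loc_rel S M (fel F)" using q(3) by simp
  then show ?thesis using loc_rel_iff[OF assms(2) p(1) q(1)] p(2) q(2) by simp
qed

lemma lfrac_nonempty: "g \<in> adm F \<Longrightarrow> lfrac F g \<noteq> {}"
  by (auto simp: adm_def lfrac_def)

lemma lcoeff_add: "lcoeff F (p + q) k = lcoeff F p k + lcoeff F q k"
  by (auto simp: lcoeff_def)

lemma lcoeff_zero: "lcoeff F 0 k = 0"
  by (auto simp: lcoeff_def)

lemma lcoeff_uminus: "lcoeff F (- p) k = - lcoeff F p k"
  by (auto simp: lcoeff_def)

lemma lcoeff_const: "lcoeff F (pconst c * p) k = (\<lambda>a. c * lcoeff F p k a)"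
proof -
  have "expo xs 0 = 0" by (auto simp: expo_def)
  then show ?thesis by (auto simp: lcoeff_def pconst_def coeff_at_mult_single)
qed

lemma lcoeff_fel_power:
  assumes "F \<subseteq> {..<length xs}"
  shows "lcoeff F (fel F ^ j * p) (i + j) = lcoeff F p i"
  by (auto simp: lcoeff_def coeff_at_fel_power[OF assms])

lemma lcoeff_in_adm: "p \<in> carrier S \<Longrightarrow> lcoeff F p k \<in> adm F"
  by (auto simp: adm_def)

lemma common_denom:
  assumes "F \<subseteq> {..<length xs}" "p \<in> carrier S" "q \<in> carrier S"
  shows "lcoeff F (fel F ^ j * p + fel F ^ i * q) (i + j) = lcoeff F p i + lcoeff F q j"
  using lcoeff_fel_power[OF assms(1), of j p i] lcoeff_fel_power[OF assms(1), of i q j]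
  by (simp add: lcoeff_add add.commute)

context
  fixes F assumes F: "F \<subseteq> {..<length xs}"
begin

lemma adm_zero: "0 \<in> adm F"
  using lcoeff_in_adm[OF S_zero, of F 0] by (simp add: lcoeff_zero)

lemma adm_add:
  assumes "g \<in> adm F" "h \<in> adm F" shows "g + h \<in> adm F"
proof -
  obtain p i q j where "p \<in> carrier S" "g = lcoeff F p i" "q \<in> carrier S" "h = lcoeff F q j"
    using assms by (auto simp: adm_def)
  then show ?thesis using common_denom[OF F, of p q j i, symmetric]
    by (auto intro!: lcoeff_in_adm S_closed fel_carrier F)
qed

lemma adm_scale: "g \<in> adm F \<Longrightarrow> (\<lambda>a. c * g a) \<in> adm F"
proof -
  assume "g \<in> adm F"
  then obtain p k where p: "p \<in> carrier S" "g = lcoeff F p k" by (auto simp: adm_def)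
  then have "lcoeff F (pconst c * p) k \<in> adm F" by (intro lcoeff_in_adm S_closed)
  then show ?thesis by (simp add: lcoeff_const p(2))
qed

lemma adm_uminus: "g \<in> adm F \<Longrightarrow> - g \<in> adm F"
proof -
  assume "g \<in> adm F"
  then obtain p k where p: "p \<in> carrier S" "g = lcoeff F p k" by (auto simp: adm_def)
  then have "lcoeff F (- p) k \<in> adm F" by (intro lcoeff_in_adm S_closed)
  then show ?thesis by (simp add: lcoeff_uminus p(2))
qed

lemma carrier_loc: "carrier (loc_module S M (fel F)) = lfrac F ` adm F"
proof -
  have "carrier (loc_module S M (fel F)) = (\<lambda>(m, i). fraction S M (fel F) m i) ` (carrier M \<times> UNIV)"
    by (auto simp: loc_module_def quotient_def fraction_def)
  also have "\<dots> = lfrac F ` adm F"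
    by (force simp: M_simps adm_def fraction_eq[OF F])
  finally show ?thesis .
qed

lemma zero_loc: "\<zero>\<^bsub>loc_module S M (fel F)\<^esub> = lfrac F 0"
  by (simp add: loc_module_def M_simps fraction_eq[OF F S_zero] lcoeff_zero)

lemma add_loc:
  assumes "g \<in> adm F" "h \<in> adm F"
  shows "lfrac F g \<oplus>\<^bsub>loc_module S M (fel F)\<^esub> lfrac F h = lfrac F (g + h)"
proof -
  have fc: "fel F \<in> carrier S" by (rule fel_carrier[OF F])
  have "(case x of (m, i) \<Rightarrow> \<Union>(n, j)\<in>lfrac F h.
        fraction S M (fel F) (((fel F [^]\<^bsub>S\<^esub> j) \<odot>\<^bsub>M\<^esub> m) \<oplus>\<^bsub>M\<^esub> ((fel F [^]\<^bsub>S\<^esub> i) \<odot>\<^bsub>M\<^esub> n)) (i + j))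
      = lfrac F (g + h)" if x: "x \<in> lfrac F g" for x
  proof -
    obtain p i where p: "x = (cl p, i)" "p \<in> carrier S" "lcoeff F p i = g" using x by (auto simp: lfrac_def)
    have "(case y of (n, j) \<Rightarrow>
        fraction S M (fel F) (((fel F [^]\<^bsub>S\<^esub> j) \<odot>\<^bsub>M\<^esub> cl p) \<oplus>\<^bsub>M\<^esub> ((fel F [^]\<^bsub>S\<^esub> i) \<odot>\<^bsub>M\<^esub> n)) (i + j))
      = lfrac F (g + h)" if y: "y \<in> lfrac F h" for y
    proof -
      obtain q j where q: "y = (cl q, j)" "q \<in> carrier S" "lcoeff F q j = h" using y by (auto simp: lfrac_def)
      have "((fel F [^]\<^bsub>S\<^esub> j) \<odot>\<^bsub>M\<^esub> cl p) \<oplus>\<^bsub>M\<^esub> ((fel F [^]\<^bsub>S\<^esub> i) \<odot>\<^bsub>M\<^esub> cl q) = cl (fel F ^ j * p + fel F ^ i * q)"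
        using p q fc by (simp add: M_simps S_closed)
      then show ?thesis
        using fraction_eq[OF F, of "fel F ^ j * p + fel F ^ i * q" "i + j"] p q fc common_denom[OF F p(2) q(2)]
        by (simp add: S_closed)
    qed
    then show ?thesis using p lfrac_nonempty[OF assms(2)] by (simp add: UN_const)
  qed
  then show ?thesis using lfrac_nonempty[OF assms(1)] by (simp add: loc_module_def UN_const)
qed

lemma smult_loc:
  assumes "g \<in> adm F"
  shows "pconst c \<odot>\<^bsub>loc_module S M (fel F)\<^esub> lfrac F g = lfrac F (\<lambda>a. c * g a)"
proof -
  have "(case x of (m, i) \<Rightarrow> fraction S M (fel F) (pconst c \<odot>\<^bsub>M\<^esub> m) i) = lfrac F (\<lambda>a. c * g a)"
    if x: "x \<in> lfrac F g" for x
  proof -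
    obtain p i where p: "x = (cl p, i)" "p \<in> carrier S" "lcoeff F p i = g" using x by (auto simp: lfrac_def)
    then show ?thesis by (auto simp: M_simps S_closed fraction_eq[OF F] lcoeff_const)
  qed
  then show ?thesis using lfrac_nonempty[OF assms] by (simp add: loc_module_def UN_const)
qed

lemmas loc_hom_facts = adm_zero adm_add adm_uminus carrier_loc zero_loc add_loc

lemma a_inv_loc: "g \<in> adm F \<Longrightarrow> \<ominus>\<^bsub>loc_module S M (fel F)\<^esub> lfrac F g = lfrac F (- g)"
  by (rule a_inv_hom_image[where \<theta> = "lfrac F" and Y = "adm F", OF loc_hom_facts])

lemma finsum_loc:
  assumes "finite A" "\<And>i. i \<in> A \<Longrightarrow> g i \<in> adm F"
  shows "finsum (loc_module S M (fel F)) (\<lambda>i. lfrac F (g i)) A = lfrac F (\<Sum>i\<in>A. g i)"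
  by (rule finsum_hom_image[where \<theta> = "lfrac F" and Y = "adm F" and f = g, OF loc_hom_facts assms])

lemma loc_map_lfrac:
  assumes i: "i \<in> F" and g: "g \<in> adm (F - {i})"
  defines "h \<equiv> (\<lambda>a. if face (F \<union> vsupp a) then g a else 0)"
  shows "loc_map S M (fel F) (fs ! i) (lfrac (F - {i}) g) = lfrac F h" and "h \<in> adm F"
proof -
  have il: "i < length xs" using i F by auto
  have vc: "pvar (xs ! i) \<in> carrier S" using il by (simp add: pvar_carrier)
  have lc: "lcoeff F (pvar (xs ! i) ^ k * p) k = h" if p: "lcoeff (F - {i}) p k = g" for p k
  proof
    fix a
    have "shift {i} (- int k) (shift F (int k) a) = shift (F - {i}) (int k) a"
      using i by (auto simp: shift_def)
    moreover have "face (F - {i} \<union> vsupp a)" if "face (F \<union> vsupp a)"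
      by (rule face_mono[OF that]) auto
    ultimately show "lcoeff F (pvar (xs ! i) ^ k * p) k a = h a"
      using fun_cong[OF p, of a] by (auto simp: lcoeff_def h_def coeff_at_pvar_power[OF il])
  qed
  have "(case x of (m, k) \<Rightarrow> fraction S M (fel F) ((fs ! i [^]\<^bsub>S\<^esub> k) \<odot>\<^bsub>M\<^esub> m) k) = lfrac F h"
    if x: "x \<in> lfrac (F - {i}) g" for x
  proof -
    obtain p k where p: "x = (cl p, k)" "p \<in> carrier S" "lcoeff (F - {i}) p k = g" using x by (auto simp: lfrac_def)
    have "(fs ! i [^]\<^bsub>S\<^esub> k) \<odot>\<^bsub>M\<^esub> cl p = cl (pvar (xs ! i) ^ k * p)"
      using il vc p(2) by (simp add: M_simps S_closed)
    then show ?thesis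
      using p(1) fraction_eq[OF F, of "pvar (xs ! i) ^ k * p" k] vc p(2) lc[OF p(3)] by (simp add: S_closed)
  qed
  then show "loc_map S M (fel F) (fs ! i) (lfrac (F - {i}) g) = lfrac F h"
    using lfrac_nonempty[OF g] by (simp add: loc_map_def UN_const)
  obtain p k where "p \<in> carrier S" "lcoeff (F - {i}) p k = g" using g by (auto simp: adm_def)
  then show "h \<in> adm F" using lc[of p k] vc by (auto simp: S_closed intro!: lcoeff_in_adm)
qed

end

end

section \<open>The Cech complex of a Stanley-Reisner ring\<close>

lemma sum_shift:
  assumes "F \<subseteq> {..<n}"
  shows "(\<Sum>i<n. shift F c a i) = (\<Sum>i<n. a i) + c * int (card F)"
proof -
  have "(\<Sum>i<n. if i \<in> F then c else 0) = (\<Sum>i\<in>F. c)"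
    using assms by (simp add: sum.If_cases Int_absorb1 Int_commute inf.absorb2 inf.absorb1)
  then show ?thesis by (simp add: shift_def sum.distrib mult.commute)
qed

context stanley_reisner
begin

lemma adm_delta:
  assumes F: "F \<subseteq> {..<length xs}" and a: "face (F \<union> vsupp a)" "\<And>i. i \<notin> F \<Longrightarrow> 0 \<le> a i"
  shows "(\<lambda>a'. if a' = a then 1 else 0) \<in> adm F"
proof -
  \<comment> \<open>a denominator that makes all exponents of the numerator nonnegative\<close>
  define k where "k = nat (\<Sum>i\<in>F. \<bar>a i\<bar>)"
  have finF: "finite F" using F finite_subset by blast
  have k: "0 \<le> a i + int k" if "i \<in> F" for i
  proof -
    have "\<bar>a i\<bar> \<le> (\<Sum>i\<in>F. \<bar>a i\<bar>)" by (rule member_le_sum) (use that finF in auto)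
    then show ?thesis by (simp add: k_def)
  qed
  define b where "b = shift F (int k) a"
  have "0 \<le> b i" for i using k a(2) by (auto simp: b_def shift_def)
  moreover have "vsupp b \<subseteq> {..<length xs}"
    using face_sub[OF a(1)] by (auto simp: b_def vsupp_def shift_def split: if_splits)
  ultimately obtain m where m: "Poly_Mapping.keys m \<subseteq> set xs" "expo xs m = b"
    using expo_surj[OF dist] by blast
  have "lcoeff F (Poly_Mapping.single m 1) k = (\<lambda>a'. if a' = a then 1 else 0)"
  proof
    fix a'
    have "shift F (int k) a' = b \<longleftrightarrow> a' = a" by (auto simp: b_def shift_def fun_eq_iff)
    then show "lcoeff F (Poly_Mapping.single m 1) k a' = (if a' = a then 1 else 0)"
      using a(1) by (auto simp: lcoeff_def coeff_at_single m(2))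
  qed
  moreover have "Poly_Mapping.single m 1 \<in> carrier S" using m by (simp add: carrier_mpoly_ring)
  ultimately show ?thesis using lcoeff_in_adm by metis
qed

text \<open>The localization at \<open>x\<^sup>F\<close> has as basis the Laurent monomials that have nonnegative exponents off
  \<open>F\<close> and whose support together with \<open>F\<close> is a face.\<close>

lemma adm_iff:
  assumes F: "F \<subseteq> {..<length xs}"
  shows "g \<in> adm F \<longleftrightarrow>
    finite {a. g a \<noteq> 0} \<and> (\<forall>a. g a \<noteq> 0 \<longrightarrow> face (F \<union> vsupp a) \<and> (\<forall>i. i \<notin> F \<longrightarrow> 0 \<le> a i))"
proof (intro iffI conjI allI impI)
  assume "g \<in> adm F"
  then obtain p k where p: "p \<in> carrier S" "g = lcoeff F p k" by (auto simp: adm_def)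
  have "{a. g a \<noteq> 0} \<subseteq> shift F (- int k) ` {b. coeff_at xs p b \<noteq> 0}"
  proof
    fix a assume "a \<in> {a. g a \<noteq> 0}"
    then have "coeff_at xs p (shift F (int k) a) \<noteq> 0" by (auto simp: p lcoeff_def split: if_splits)
    then show "a \<in> shift F (- int k) ` {b. coeff_at xs p b \<noteq> 0}"
      by (intro image_eqI[of _ _ "shift F (int k) a"]) auto
  qed
  then show "finite {a. g a \<noteq> 0}" using finite_coeff_at finite_subset by blast
next
  fix a assume "g \<in> adm F" and ga: "g a \<noteq> 0"
  then obtain p k where p: "p \<in> carrier S" "g = lcoeff F p k" by (auto simp: adm_def)
  have f: "face (F \<union> vsupp a)" and "coeff_at xs p (shift F (int k) a) \<noteq> 0"
    using ga by (auto simp: p lcoeff_def split: if_splits)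
  from coeff_at_nonzero[OF this(2)] obtain m where m: "shift F (int k) a = expo xs m" by blast
  show "face (F \<union> vsupp a)" by (rule f)
  fix i assume "i \<notin> F"
  then show "0 \<le> a i" using fun_cong[OF m, of i] by (auto simp: shift_def expo_def)
next
  assume g: "finite {a. g a \<noteq> 0} \<and> (\<forall>a. g a \<noteq> 0 \<longrightarrow> face (F \<union> vsupp a) \<and> (\<forall>i. i \<notin> F \<longrightarrow> 0 \<le> a i))"
  have sums: "(\<Sum>a\<in>A. (\<lambda>a'. g a * (if a' = a then 1 else 0))) \<in> adm F"
    if "finite A" "A \<subseteq> {a. g a \<noteq> 0}" for A
    using that
  proof (induction A rule: finite_induct)
    case empty
    then show ?case by (simp only: sum.empty) (rule adm_zero[OF F])
  next
    case (insert a A)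
    have "(\<lambda>a'. if a' = a then 1 else 0) \<in> adm F" using insert g by (intro adm_delta[OF F]) auto
    from adm_scale[OF F this, of "g a"]
    have "(\<lambda>a'. g a * (if a' = a then 1 else 0)) + (\<Sum>a\<in>A. (\<lambda>a'. g a * (if a' = a then 1 else 0))) \<in> adm F"
      by (rule adm_add[OF F]) (use insert in auto)
    then show ?case by (simp only: sum.insert[OF insert.hyps])
  qed
  have eq: "g = (\<Sum>a | g a \<noteq> 0. (\<lambda>a'. g a * (if a' = a then 1 else 0)))"
  proof
    fix a'
    have "(\<Sum>a | g a \<noteq> 0. (\<lambda>a'. g a * (if a' = a then 1 else 0))) a' = (\<Sum>a | g a \<noteq> 0. if a' = a then g a else 0)"
      unfolding sum_fun_apply by (rule sum.cong) auto
    then show "g a' = (\<Sum>a | g a \<noteq> 0. (\<lambda>a'. g a * (if a' = a then 1 else 0))) a'"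
      using g by simp
  qed
  show "g \<in> adm F" by (subst eq) (rule sums[OF conjunct1[OF g] order_refl])
qed

lemma homogeneous_fraction_iff:
  assumes F: "F \<subseteq> {..<length xs}" and g: "g \<in> adm F"
  shows "(\<exists>k. \<exists>m\<in>quot_component (set xs) I (l + int k * int (card F)). lfrac F g = fraction S M (fel F) m k)
    \<longleftrightarrow> (\<forall>a. g a \<noteq> 0 \<longrightarrow> (\<Sum>i<length xs. a i) = l)" (is "?L \<longleftrightarrow> ?R")
proof
  assume ?L
  then obtain k p where p: "p \<in> homogeneous (set xs) (l + int k * int (card F))"
    "lfrac F g = fraction S M (fel F) (cl p) k"
    by (auto simp: quot_component_def)
  have pS: "p \<in> carrier S" using p by (simp add: homogeneous_def)
  have gp: "g = lcoeff F p k" using lfrac_inj[OF g F] p(2) fraction_eq[OF F pS] by simp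
  show ?R
  proof (intro allI impI)
    fix a assume "g a \<noteq> 0"
    then have "coeff_at xs p (shift F (int k) a) \<noteq> 0" by (auto simp: gp lcoeff_def split: if_splits)
    from coeff_at_nonzero[OF this] obtain m where m: "m \<in> Poly_Mapping.keys p" "shift F (int k) a = expo xs m" by blast
    have "int (total_degree m) = l + int k * int (card F)" "Poly_Mapping.keys m \<subseteq> set xs"
      using m p pS by (auto simp: homogeneous_def carrier_mpoly_ring)
    then have "(\<Sum>i<length xs. shift F (int k) a i) = l + int k * int (card F)"
      unfolding m(2) using sum_expo[OF dist] by simp
    then show "(\<Sum>i<length xs. a i) = l" by (simp add: sum_shift[OF F])
  qed
next
  assume R: ?R
  obtain p k where p: "p \<in> carrier S" "g = lcoeff F p k" using g by (auto simp: adm_def)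
  \<comment> \<open>the homogeneous component of the numerator represents the same fraction\<close>
  define d where "d = l + int k * int (card F)"
  define A where "A = {m \<in> Poly_Mapping.keys p. int (total_degree m) = d}"
  define p' where "p' = (\<Sum>m\<in>A. Poly_Mapping.single m (Poly_Mapping.lookup p m))"
  have Ap: "A \<subseteq> Poly_Mapping.keys p" "finite A" by (auto simp: A_def)
  have "Poly_Mapping.keys p' \<subseteq> (\<Union>m\<in>A. Poly_Mapping.keys (Poly_Mapping.single m (Poly_Mapping.lookup p m)))"
    unfolding p'_def by (rule keys_sum)
  then have kA: "Poly_Mapping.keys p' \<subseteq> A" by (auto split: if_splits)
  then have p'S: "p' \<in> carrier S" using p Ap by (auto simp: carrier_mpoly_ring)
  have hom: "p' \<in> homogeneous (set xs) d" using p'S kA by (auto simp: homogeneous_def A_def)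
  have c': "coeff_at xs p' b = (\<Sum>m\<in>A. if expo xs m = b then Poly_Mapping.lookup p m else 0)" for b
    unfolding p'_def coeff_at_sum sum_fun_apply coeff_at_single ..
  have degb: "int (total_degree m) = (\<Sum>i<length xs. b i)" if "m \<in> Poly_Mapping.keys p" "expo xs m = b" for m b
    using that p sum_expo[OF dist, of m] by (auto simp: carrier_mpoly_ring)
  have "lcoeff F p' k = g"
  proof
    fix a
    show "lcoeff F p' k a = g a"
    proof (cases "face (F \<union> vsupp a)")
      case True
      let ?b = "shift F (int k) a"
      have ga: "g a = coeff_at xs p ?b" using True by (simp add: p lcoeff_def)
      show ?thesis
      proof (cases "(\<Sum>i<length xs. a i) = l")
        case True
        then have "(\<Sum>i<length xs. ?b i) = d" by (simp add: sum_shift[OF F] d_def)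
        then have "coeff_at xs p' ?b = coeff_at xs p ?b"
          unfolding c' coeff_at_def[of xs p]
          by (intro sum.mono_neutral_left) (use Ap degb in \<open>auto simp: A_def\<close>)
        then show ?thesis using ga \<open>face (F \<union> vsupp a)\<close> by (simp add: lcoeff_def)
      next
        case False
        then have "g a = 0" using R by blast
        have "(\<Sum>i<length xs. ?b i) \<noteq> d" using False by (simp add: sum_shift[OF F] d_def)
        then have "coeff_at xs p' ?b = 0"
          unfolding c' by (intro sum.neutral) (use degb in \<open>auto simp: A_def\<close>)
        then show ?thesis using \<open>g a = 0\<close> by (simp add: lcoeff_def)
      qed
    qed (simp add: p lcoeff_def)
  qed
  then have "lfrac F g = fraction S M (fel F) (cl p') k" using fraction_eq[OF F p'S] by simp
  moreover have "cl p' \<in> quot_component (set xs) I (l + int k * int (card F))"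
    using hom by (auto simp: quot_component_def d_def)
  ultimately show ?L by blast
qed

abbreviation Cech :: "nat \<Rightarrow> (('x, 'k) mpoly, ('x, 'k) mpoly set cochain) module" where
  "Cech j \<equiv> cech_module S M fs j"

text \<open>The coefficient functions of the Cech cochains of degree \<open>j\<close>, and the passage from coefficients to
  cochains, which is an isomorphism.\<close>

definition Cx :: "nat \<Rightarrow> 'k mcochain set" where
  "Cx j = {G. (\<forall>F\<in>cech_faces fs j. G F \<in> adm F) \<and> (\<forall>F. F \<notin> cech_faces fs j \<longrightarrow> G F = 0)}"

definition cochain :: "nat \<Rightarrow> 'k mcochain \<Rightarrow> ('x, 'k) mpoly set cochain" where
  "cochain j G = (\<lambda>F\<in>cech_faces fs j. lfrac F (G F))"

lemma cech_faces_iff: "F \<in> cech_faces fs j \<longleftrightarrow> F \<subseteq> {..<length xs} \<and> card F = j"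
  by (simp add: cech_faces_def)

lemma lin_closed_Cx: "lin_closed (Cx j)"
  unfolding lin_closed_def
proof (intro conjI ballI allI)
  show "0 \<in> Cx j" unfolding Cx_def using adm_zero by (auto simp: cech_faces_iff)
next
  fix f g assume "f \<in> Cx j" "g \<in> Cx j"
  then show "f + g \<in> Cx j" unfolding Cx_def using adm_add by (auto simp: cech_faces_iff)
next
  fix c f assume "f \<in> Cx j"
  then show "scl c f \<in> Cx j" unfolding Cx_def scl_def using adm_scale by (auto simp: cech_faces_iff)
qed

lemma Cx_iff:
  "G \<in> Cx j \<longleftrightarrow> finite {(F, a). G F a \<noteq> 0} \<and>
    (\<forall>F a. G F a \<noteq> 0 \<longrightarrow> card F = j \<and> face (F \<union> vsupp a) \<and> (\<forall>i. i \<notin> F \<longrightarrow> 0 \<le> a i))"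
  (is "_ \<longleftrightarrow> ?R")
proof
  assume G: "G \<in> Cx j"
  have f: "F \<in> cech_faces fs j" if "G F a \<noteq> 0" for F a
    using G that by (auto simp: Cx_def)
  have "{(F, a). G F a \<noteq> 0} = (SIGMA F:cech_faces fs j. {a. G F a \<noteq> 0})" using f by auto
  moreover have "finite (cech_faces fs j)"
    by (rule finite_subset[of _ "Pow {..<length xs}"]) (auto simp: cech_faces_iff)
  moreover have "finite {a. G F a \<noteq> 0}" if "F \<in> cech_faces fs j" for F
    using G that adm_iff[of F "G F"] by (auto simp: Cx_def cech_faces_iff)
  ultimately have "finite {(F, a). G F a \<noteq> 0}" by auto
  moreover have "card F = j \<and> face (F \<union> vsupp a) \<and> (\<forall>i. i \<notin> F \<longrightarrow> 0 \<le> a i)" if "G F a \<noteq> 0" for F a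
    using f[OF that] G that adm_iff[of F "G F"] by (auto simp: Cx_def cech_faces_iff)
  ultimately show ?R by blast
next
  assume R: ?R
  have "finite {a. G F a \<noteq> 0}" for F
  proof (rule finite_subset)
    show "{a. G F a \<noteq> 0} \<subseteq> snd ` {(F, a). G F a \<noteq> 0}" by force
  qed (use R in auto)
  then have "G F \<in> adm F" if "F \<subseteq> {..<length xs}" for F
    using R adm_iff[OF that, of "G F"] by blast
  moreover have "G F = 0" if "F \<notin> cech_faces fs j" for F
  proof
    fix a
    show "G F a = 0 a" using R that face_sub[of "F \<union> vsupp a"] by (auto simp: cech_faces_iff)
  qed
  ultimately show "G \<in> Cx j" by (auto simp: Cx_def cech_faces_iff)
qed

lemma carrier_Cech: "carrier (Cech j) = cochain j ` Cx j"
proof (intro equalityI subsetI)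
  fix c assume "c \<in> carrier (Cech j)"
  then have c: "c \<in> (\<Pi>\<^sub>E F\<in>cech_faces fs j. carrier (loc_module S M (fel F)))" by (simp add: cech_module_def)
  have "\<exists>g. g \<in> adm F \<and> c F = lfrac F g" if "F \<in> cech_faces fs j" for F
    using PiE_mem[OF c that] that carrier_loc[of F] by (auto simp: cech_faces_iff)
  then obtain g where g: "\<And>F. F \<in> cech_faces fs j \<Longrightarrow> g F \<in> adm F \<and> c F = lfrac F (g F)" by metis
  define G where "G = (\<lambda>F. if F \<in> cech_faces fs j then g F else 0)"
  have "G \<in> Cx j" using g by (auto simp: Cx_def G_def)
  moreover have "c = cochain j G"
    using c g by (auto simp: cochain_def G_def PiE_def extensional_def fun_eq_iff)
  ultimately show "c \<in> cochain j ` Cx j" by blast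
next
  fix c assume "c \<in> cochain j ` Cx j"
  then obtain G where G: "G \<in> Cx j" "c = cochain j G" by blast
  have "lfrac F (G F) \<in> carrier (loc_module S M (fel F))" if "F \<in> cech_faces fs j" for F
    using that G carrier_loc[of F] by (auto simp: Cx_def cech_faces_iff)
  then show "c \<in> carrier (Cech j)"
    by (simp add: G(2) cech_module_def cochain_def restrict_PiE_iff)
qed

lemma cochain_inj:
  assumes "G \<in> Cx j" "H \<in> Cx j" "cochain j G = cochain j H"
  shows "G = H"
proof
  fix F
  show "G F = H F"
  proof (cases "F \<in> cech_faces fs j")
    case True
    then have "lfrac F (G F) = lfrac F (H F)" using fun_cong[OF assms(3), of F] by (simp add: cochain_def)
    then show ?thesis using lfrac_inj[of "G F" F] assms(1) True by (auto simp: Cx_def cech_faces_iff)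
  next
    case False
    then show ?thesis using assms(1,2) by (simp add: Cx_def)
  qed
qed

lemma zero_Cech: "\<zero>\<^bsub>Cech j\<^esub> = cochain j 0"
  by (auto simp: cech_module_def cochain_def cech_faces_iff zero_loc intro!: restrict_ext)

lemma add_Cech:
  assumes "G \<in> Cx j" "H \<in> Cx j"
  shows "cochain j G \<oplus>\<^bsub>Cech j\<^esub> cochain j H = cochain j (G + H)"
proof -
  have "lfrac F (G F) \<oplus>\<^bsub>loc_module S M (fel F)\<^esub> lfrac F (H F) = lfrac F (G F + H F)"
    if "F \<in> cech_faces fs j" for F
    using that assms by (intro add_loc) (auto simp: Cx_def cech_faces_iff)
  then show ?thesis by (auto simp: cech_module_def cochain_def intro!: restrict_ext)
qed

lemma smult_Cech:
  assumes "G \<in> Cx j"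
  shows "pconst c \<odot>\<^bsub>Cech j\<^esub> cochain j G = cochain j (scl c G)"
proof -
  have "pconst c \<odot>\<^bsub>loc_module S M (fel F)\<^esub> lfrac F (G F) = lfrac F (scl c G F)"
    if "F \<in> cech_faces fs j" for F
    unfolding scl_def using that assms by (intro smult_loc) (auto simp: Cx_def cech_faces_iff)
  then show ?thesis by (auto simp: cech_module_def cochain_def intro!: restrict_ext)
qed

lemma mdiff_Cx_and_cech_diff:
  assumes G: "G \<in> Cx j"
  shows "mdiff face j G \<in> Cx (Suc j)"
    and "cech_diff S M fs j (cochain j G) = cochain (Suc j) (mdiff face j G)"
proof -
  define h where "h = (\<lambda>F i a. if face (F \<union> vsupp a) then (-1) ^ card {k\<in>F. k < i} * G (F - {i}) a else 0)"
  let ?s = "\<lambda>F i. let y = loc_map S M (fel F) (fs ! i) (cochain j G (F - {i}))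
    in if even (card {k\<in>F. k < i}) then y else \<ominus>\<^bsub>loc_module S M (fel F)\<^esub> y"
  have main: "finsum (loc_module S M (fel F)) (?s F) F = lfrac F (mdiff face j G F)
      \<and> mdiff face j G F \<in> adm F"
    if F: "F \<in> cech_faces fs (Suc j)" for F
  proof -
    have Fs: "F \<subseteq> {..<length xs}" and cF: "card F = Suc j" using F by (auto simp: cech_faces_iff)
    have finF: "finite F" using Fs finite_subset by blast
    have h: "h F i \<in> adm F \<and> ?s F i = lfrac F (h F i)" if i: "i \<in> F" for i
    proof -
      have Fi: "F - {i} \<in> cech_faces fs j" using i Fs cF by (auto simp: cech_faces_iff)
      then have g: "G (F - {i}) \<in> adm (F - {i})" using G by (auto simp: Cx_def)
      let ?g = "\<lambda>a. if face (F \<union> vsupp a) then G (F - {i}) a else 0"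
      have y: "loc_map S M (fel F) (fs ! i) (cochain j G (F - {i})) = lfrac F ?g" and ga: "?g \<in> adm F"
        using loc_map_lfrac[OF Fs i g] Fi by (simp_all add: cochain_def)
      show ?thesis
      proof (cases "even (card {k\<in>F. k < i})")
        case True
        then have "h F i = ?g" by (auto simp: h_def fun_eq_iff)
        then show ?thesis using True y ga by simp
      next
        case False
        then have "h F i = - ?g" by (auto simp: h_def fun_eq_iff)
        then show ?thesis using False y ga a_inv_loc[OF Fs ga] adm_uminus[OF Fs ga] by simp
      qed
    qed
    have sum: "(\<Sum>i\<in>F. h F i) = mdiff face j G F"
      by (rule ext) (auto simp: sum_fun_apply h_def mdiff_def cF)
    interpret L: abelian_group "loc_module S M (fel F)"
      by (rule abelian_group_hom_image[where \<theta> = "lfrac F" and Y = "adm F", OF loc_hom_facts[OF Fs]])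
    have "finsum (loc_module S M (fel F)) (?s F) F
        = finsum (loc_module S M (fel F)) (\<lambda>i. lfrac F (h F i)) F"
      by (rule L.finsum_cong') (use h carrier_loc[OF Fs] in auto)
    also have "\<dots> = lfrac F (\<Sum>i\<in>F. h F i)" by (rule finsum_loc[OF Fs finF]) (use h in blast)
    finally have fin: "finsum (loc_module S M (fel F)) (?s F) F = lfrac F (mdiff face j G F)"
      unfolding sum .
    have adm_sum: "(\<Sum>i\<in>A. h F i) \<in> adm F" if "finite A" "A \<subseteq> F" for A
      using that
    proof (induction A rule: finite_induct)
      case empty
      then show ?case by (simp only: sum.empty) (rule adm_zero[OF Fs])
    next
      case (insert i A)
      have "h F i + (\<Sum>i\<in>A. h F i) \<in> adm F" by (rule adm_add[OF Fs]) (use h insert in auto)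
      then show ?case by (simp only: sum.insert[OF insert.hyps])
    qed
    have "mdiff face j G F \<in> adm F" using adm_sum[OF finF order_refl] unfolding sum .
    then show ?thesis by (rule conjI[OF fin])
  qed
  have "mdiff face j G F = 0" if "F \<notin> cech_faces fs (Suc j)" for F
    using that face_sub by (auto simp: mdiff_def cech_faces_iff fun_eq_iff)
  then show "mdiff face j G \<in> Cx (Suc j)" using main by (auto simp: Cx_def)
  show "cech_diff S M fs j (cochain j G) = cochain (Suc j) (mdiff face j G)"
    unfolding cech_diff_def cochain_def[of "Suc j"] by (rule restrict_ext) (use main in blast)
qed

text \<open>The coefficient functions of the coboundaries.\<close>

definition Bd :: "nat \<Rightarrow> 'k mcochain set" where
  "Bd j = (case j of 0 \<Rightarrow> {0} | Suc i \<Rightarrow> mdiff face i ` Cx i)"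

lemma mdiff_linear:
  "mdiff face j 0 = 0" "mdiff face j (f + g) = mdiff face j f + mdiff face j g"
  "mdiff face j (scl c f) = scl c (mdiff face j f)"
  by (auto simp: mdiff_def scl_def fun_eq_iff sum.distrib algebra_simps sum_distrib_left)

lemma lin_closed_Bd: "lin_closed (Bd j)"
proof (cases j)
  case 0
  then show ?thesis by (auto simp: lin_closed_def Bd_def scl_def fun_eq_iff)
next
  case (Suc i)
  then show ?thesis using lin_closed_Cx[of i] unfolding lin_closed_def Bd_def
    by (auto simp: mdiff_linear(2,3)[symmetric] intro!: image_eqI[where x = 0] simp: mdiff_linear(1))
qed

lemma Bd_subset: "Bd j \<subseteq> Cx j"
  using lin_closed_Cx[of j] mdiff_Cx_and_cech_diff(1)
  by (auto simp: Bd_def lin_closed_def split: nat.splits)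

lemma coboundaries_eq: "cech_coboundaries S M fs j = cochain j ` Bd j"
  using mdiff_Cx_and_cech_diff(2)
  by (auto simp: cech_coboundaries_def Bd_def zero_Cech carrier_Cech image_image split: nat.splits intro!: image_cong)

lemma cocycles_eq:
  assumes "\<And>F. face F \<Longrightarrow> card F \<noteq> Suc j"
  shows "cech_cocycles S M fs j = cochain j ` Cx j"
proof -
  have "mdiff face j G = 0" for G :: "'k mcochain"
  proof -
    have "\<not> (card F = Suc j \<and> face (F \<union> vsupp a))" for F a
      using assms[of F] face_mono[of "F \<union> vsupp a" F] by auto
    then show ?thesis by (auto simp: mdiff_def fun_eq_iff)
  qed
  then show ?thesis
    unfolding cech_cocycles_def carrier_Cech using mdiff_Cx_and_cech_diff(2) by (auto simp: zero_Cech)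
qed

text \<open>The homogeneous coefficient functions of degree \<open>l\<close>.\<close>

definition Cxl :: "nat \<Rightarrow> int \<Rightarrow> 'k mcochain set" where
  "Cxl j l = {G \<in> Cx j. \<forall>F a. G F a \<noteq> 0 \<longrightarrow> (\<Sum>i<length xs. a i) = l}"

lemma component_eq:
  "cech_component S M (quot_component (set xs) I) fs j l = cochain j ` Cxl j l"
proof -
  have *: "cochain j G \<in> cech_component S M (quot_component (set xs) I) fs j l \<longleftrightarrow> G \<in> Cxl j l"
    if G: "G \<in> Cx j" for G
  proof -
    have "cochain j G \<in> cech_component S M (quot_component (set xs) I) fs j l \<longleftrightarrow>
        (\<forall>F\<in>cech_faces fs j. \<exists>k. \<exists>m\<in>quot_component (set xs) I (l + int k * int (card F)).
          lfrac F (G F) = fraction S M (fel F) m k)"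
      using G by (auto simp: cech_component_def carrier_Cech cochain_def)
    also have "\<dots> \<longleftrightarrow> (\<forall>F\<in>cech_faces fs j. \<forall>a. G F a \<noteq> 0 \<longrightarrow> (\<Sum>i<length xs. a i) = l)"
      by (intro ball_cong refl homogeneous_fraction_iff) (use G in \<open>auto simp: Cx_def cech_faces_iff\<close>)
    also have "\<dots> \<longleftrightarrow> G \<in> Cxl j l"
      using G unfolding Cxl_def by (auto simp: Cx_def)
    finally show ?thesis .
  qed
  have "cech_component S M (quot_component (set xs) I) fs j l \<subseteq> cochain j ` Cx j"
    unfolding carrier_Cech[symmetric] by (auto simp: cech_component_def)
  then show ?thesis using * by (auto simp: Cxl_def)
qed

end

section \<open>Dimension of the top local cohomology\<close>

context stanley_reisner
begin

text \<open>The class of a cochain modulo coboundaries.\<close>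

definition coset :: "nat \<Rightarrow> 'k mcochain \<Rightarrow> ('x, 'k) mpoly set cochain set" where
  "coset j G = (\<lambda>b. cochain j (b + G)) ` Bd j"

lemma coboundaries_coset:
  assumes "G \<in> Cx j"
  shows "cech_coboundaries S M fs j +>\<^bsub>Cech j\<^esub> cochain j G = coset j G"
proof -
  have "cochain j b \<oplus>\<^bsub>Cech j\<^esub> cochain j G = cochain j (b + G)" if "b \<in> Bd j" for b
    using add_Cech[of b j G] that assms Bd_subset by blast
  then show ?thesis unfolding a_r_coset_def' coboundaries_eq coset_def by auto
qed

lemma Bd_closed:
  "0 \<in> Bd j" "f \<in> Bd j \<Longrightarrow> g \<in> Bd j \<Longrightarrow> f + g \<in> Bd j" "f \<in> Bd j \<Longrightarrow> scl c f \<in> Bd j"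
  using lin_closed_Bd[of j] by (auto simp: lin_closed_def)

lemma Cx_closed:
  "0 \<in> Cx j" "f \<in> Cx j \<Longrightarrow> g \<in> Cx j \<Longrightarrow> f + g \<in> Cx j" "f \<in> Cx j \<Longrightarrow> scl c f \<in> Cx j"
  using lin_closed_Cx[of j] by (auto simp: lin_closed_def)

lemma coset_add_Bd:
  assumes "b \<in> Bd j"
  shows "coset j (b + G) = coset j G"
proof (intro equalityI subsetI)
  fix x assume "x \<in> coset j (b + G)"
  then obtain b' where "b' \<in> Bd j" "x = cochain j (b' + (b + G))" by (auto simp: coset_def)
  then show "x \<in> coset j G"
    using Bd_closed(2)[of b' j b] assms by (auto simp: coset_def add.assoc intro!: image_eqI[of _ _ "b' + b"])
next
  fix x assume "x \<in> coset j G"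
  then obtain b' where b': "b' \<in> Bd j" "x = cochain j (b' + G)" by (auto simp: coset_def)
  have "b' - b \<in> Bd j" by (rule lin_closed_diff[OF lin_closed_Bd b'(1) assms])
  then show "x \<in> coset j (b + G)"
    using b' by (auto simp: coset_def intro!: image_eqI[of _ _ "b' - b"])
qed

lemma coset_set_add:
  assumes "G \<in> Cx j" "H \<in> Cx j"
  shows "coset j G <+>\<^bsub>Cech j\<^esub> coset j H = coset j (G + H)"
proof -
  have eq: "cochain j (b + G) \<oplus>\<^bsub>Cech j\<^esub> cochain j (b' + H) = cochain j (b + b' + (G + H))"
    if "b \<in> Bd j" "b' \<in> Bd j" for b b'
  proof -
    have "b \<in> Cx j" "b' \<in> Cx j" using that Bd_subset by auto
    then have "cochain j (b + G) \<oplus>\<^bsub>Cech j\<^esub> cochain j (b' + H) = cochain j ((b + G) + (b' + H))"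
      using assms Cx_closed by (intro add_Cech) auto
    then show ?thesis by (simp add: add_ac)
  qed
  show ?thesis
  proof (intro equalityI subsetI)
    fix x assume "x \<in> coset j G <+>\<^bsub>Cech j\<^esub> coset j H"
    then obtain b b' where "b \<in> Bd j" "b' \<in> Bd j" "x = cochain j (b + G) \<oplus>\<^bsub>Cech j\<^esub> cochain j (b' + H)"
      by (auto simp: set_add_def' coset_def)
    then show "x \<in> coset j (G + H)"
      using eq Bd_closed(2)[of b j b'] by (auto simp: coset_def)
  next
    fix x assume "x \<in> coset j (G + H)"
    then obtain b where b: "b \<in> Bd j" "x = cochain j (b + (G + H))" by (auto simp: coset_def)
    then have "x = cochain j (b + G) \<oplus>\<^bsub>Cech j\<^esub> cochain j (0 + H)"
      using eq[OF b(1) Bd_closed(1)] by simp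
    then show "x \<in> coset j G <+>\<^bsub>Cech j\<^esub> coset j H"
      using b(1) Bd_closed(1)[of j] unfolding set_add_def' coset_def by blast
  qed
qed

lemma coset_smult:
  assumes "G \<in> Cx j"
  shows "(\<Union>x\<in>coset j G. cech_coboundaries S M fs j +>\<^bsub>Cech j\<^esub> (pconst c \<odot>\<^bsub>Cech j\<^esub> x)) = coset j (scl c G)"
proof (rule UN_const)
  show "coset j G \<noteq> {}" using Bd_closed(1) by (auto simp: coset_def)
  fix x assume "x \<in> coset j G"
  then obtain b where b: "b \<in> Bd j" "x = cochain j (b + G)" by (auto simp: coset_def)
  have bG: "b + G \<in> Cx j" using b(1) Bd_subset assms by (auto intro: Cx_closed)
  have "scl c (b + G) = scl c b + scl c G" by (auto simp: scl_def fun_eq_iff algebra_simps)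
  then show "cech_coboundaries S M fs j +>\<^bsub>Cech j\<^esub> (pconst c \<odot>\<^bsub>Cech j\<^esub> x) = coset j (scl c G)"
    unfolding b(2) smult_Cech[OF bG] using coboundaries_coset[OF Cx_closed(3)[OF bG]]
      coset_add_Bd[OF Bd_closed(3)[OF b(1)]] by metis
qed

text \<open>If there are no faces of cardinality \<open>j + 1\<close>, all cochains of degree \<open>j\<close> are cocycles, and the
  dimension in degree \<open>l\<close> is that of a space of cochains complementary to the coboundaries. Here the
  complement is spanned by a finite set \<open>B\<close> of monomials.\<close>

theorem local_cohomology_max_dim:
  fixes j :: nat and l :: int and B :: "(nat set \<times> (nat \<Rightarrow> int)) set"
  defines "N \<equiv> local_cohomology_max xs I j l"
  assumes top: "\<And>F. face F \<Longrightarrow> card F \<noteq> Suc j"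
    and fin: "finite B"
    and B: "\<And>F a. (F, a) \<in> B \<Longrightarrow> card F = j \<and> face (F \<union> vsupp a) \<and> (\<forall>i. i \<notin> F \<longrightarrow> 0 \<le> a i) \<and>
      (\<Sum>i<length xs. a i) = l"
    and reduce: "\<And>f. f \<in> Cxl j l \<Longrightarrow> \<exists>b\<in>Bd j. \<forall>F a. (F, a) \<notin> B \<longrightarrow> f F a = b F a"
    and indep: "\<And>b. b \<in> Bd j \<Longrightarrow> (\<And>F a. (F, a) \<notin> B \<Longrightarrow> b F a = 0) \<Longrightarrow> b = 0"
  shows "vectorspace ring_of_type_algebra N" "vectorspace.fin_dim ring_of_type_algebra N"
    "vectorspace.dim ring_of_type_algebra N = card B"
proof -
  define Y where "Y = {g :: nat set \<times> (nat \<Rightarrow> int) \<Rightarrow> 'k. \<forall>z. z \<notin> B \<longrightarrow> g z = 0}"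
  define \<theta> where "\<theta> = (\<lambda>y :: nat set \<times> (nat \<Rightarrow> int) \<Rightarrow> 'k. coset j (\<lambda>F a. y (F, a)))"
  have Ycx: "(\<lambda>F a. y (F, a)) \<in> Cxl j l" if "y \<in> Y" for y
  proof -
    have *: "(F, a) \<in> B" if "y (F, a) \<noteq> 0" for F a using \<open>y \<in> Y\<close> that by (auto simp: Y_def)
    have "finite {(F, a). y (F, a) \<noteq> 0}" by (rule finite_subset[OF _ fin]) (use * in auto)
    then show ?thesis unfolding Cxl_def Cx_iff using * B by blast
  qed
  have Cxl_Cx: "Cxl j l \<subseteq> Cx j" by (auto simp: Cxl_def)
  have N: "carrier N = local_cohomology_component S M (quot_component (set xs) I) fs j l"
    "\<zero>\<^bsub>N\<^esub> = cech_coboundaries S M fs j"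
    "\<And>P Q. P \<oplus>\<^bsub>N\<^esub> Q = P <+>\<^bsub>Cech j\<^esub> Q"
    "\<And>c P. c \<odot>\<^bsub>N\<^esub> P = (\<Union>x\<in>P. cech_coboundaries S M fs j +>\<^bsub>Cech j\<^esub> (pconst c \<odot>\<^bsub>Cech j\<^esub> x))"
    unfolding N_def local_cohomology_max_def local_cohomology_def subquotient_def Let_def
    by (simp_all only: partial_object.select_convs ring.select_convs module.select_convs)
  have "carrier N = coset j ` Cxl j l"
  proof -
    have "cech_cocycles S M fs j \<inter> cech_component S M (quot_component (set xs) I) fs j l = cochain j ` Cxl j l"
    proof -
      have "cech_cocycles S M fs j = cochain j ` Cx j" by (rule cocycles_eq) (rule top)
      then show ?thesis using component_eq[of j l] Int_absorb1[OF image_mono[OF Cxl_Cx, of "cochain j"]] by simp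
    qed
    then have "carrier N = (\<lambda>G. cech_coboundaries S M fs j +>\<^bsub>Cech j\<^esub> cochain j G) ` Cxl j l"
      unfolding N(1) local_cohomology_component_def by (simp add: image_image)
    also have "\<dots> = coset j ` Cxl j l"
      by (rule image_cong[OF refl]) (use coboundaries_coset Cxl_Cx in blast)
    finally show ?thesis .
  qed
  also have "\<dots> = \<theta> ` Y"
  proof (intro equalityI subsetI)
    fix x assume "x \<in> coset j ` Cxl j l"
    then obtain G where G: "G \<in> Cxl j l" "x = coset j G" by blast
    obtain b where b: "b \<in> Bd j" "\<forall>F a. (F, a) \<notin> B \<longrightarrow> G F a = b F a" using reduce[OF G(1)] by blast
    define y where "y = (\<lambda>(F, a). G F a - b F a)"
    have "y \<in> Y" using b(2) by (auto simp: Y_def y_def)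
    moreover have "x = \<theta> y"
    proof -
      have "G = b + (\<lambda>F a. y (F, a))" by (auto simp: y_def fun_eq_iff)
      then show ?thesis unfolding G(2) \<theta>_def using coset_add_Bd[OF b(1)] by metis
    qed
    ultimately show "x \<in> \<theta> ` Y" by blast
  next
    fix x assume "x \<in> \<theta> ` Y"
    then show "x \<in> coset j ` Cxl j l" using Ycx by (auto simp: \<theta>_def)
  qed
  finally have carr: "carrier N = \<theta> ` Y" .
  have zero: "\<zero>\<^bsub>N\<^esub> = \<theta> 0"
    unfolding N(2) coboundaries_eq \<theta>_def coset_def by (simp add: zero_fun_def[symmetric])
  have inj: "y = 0" if y: "y \<in> Y" "\<theta> y = \<zero>\<^bsub>N\<^esub>" for y
  proof -
    let ?G = "\<lambda>F a. y (F, a)"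
    have G: "?G \<in> Cx j" using Ycx[OF y(1)] Cxl_Cx by blast
    have "cochain j (0 + ?G) \<in> cochain j ` Bd j"
      using y(2) Bd_closed(1)[of j] unfolding N(2) coboundaries_eq \<theta>_def coset_def by blast
    then obtain b where b: "b \<in> Bd j" "cochain j ?G = cochain j b" by auto
    then have "?G = b" using cochain_inj[OF G] Bd_subset by blast
    then have "?G = 0" using indep[OF b(1)] y(1) by (auto simp: Y_def)
    then show ?thesis by (auto simp: fun_eq_iff)
  qed
  have hom: "\<theta> g \<oplus>\<^bsub>N\<^esub> \<theta> h = \<theta> (g + h)" if "g \<in> Y" "h \<in> Y" for g h
  proof -
    have "(\<lambda>F a. g (F, a)) + (\<lambda>F a. h (F, a)) = (\<lambda>F a. (g + h) (F, a))" by (auto simp: fun_eq_iff)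
    then show ?thesis
      unfolding N(3) \<theta>_def using coset_set_add[of "\<lambda>F a. g (F, a)" j "\<lambda>F a. h (F, a)"] Ycx that Cxl_Cx
      by auto
  qed
  have smult: "c \<odot>\<^bsub>N\<^esub> \<theta> g = \<theta> (\<lambda>z. c * g z)" if "g \<in> Y" for c g
    unfolding N(4) \<theta>_def using coset_smult[of "\<lambda>F a. g (F, a)" j c] Ycx[OF that] Cxl_Cx
    by (auto simp: scl_def)
  show "vectorspace ring_of_type_algebra N" "vectorspace.fin_dim ring_of_type_algebra N"
    "vectorspace.dim ring_of_type_algebra N = card B"
    by (rule vectorspace_dim_of_bij[where \<theta> = \<theta> and Y = Y and B = B, OF fin Y_def carr inj zero hom smult];
        assumption)+
qed

end

section \<open>Counting exponent vectors\<close>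

text \<open>The vectors of natural numbers on \<open>A\<close> with sum \<open>m\<close> that are positive wherever \<open>P\<close> holds, and the
  factor that an index contributes to their generating function.\<close>

definition restricted_exponents :: "(nat \<Rightarrow> bool) \<Rightarrow> nat set \<Rightarrow> nat \<Rightarrow> (nat \<Rightarrow> nat) set" where
  "restricted_exponents P A m =
     {b. (\<forall>i. i \<notin> A \<longrightarrow> b i = 0) \<and> (\<forall>i\<in>A. P i \<longrightarrow> 0 < b i) \<and> (\<Sum>i\<in>A. b i) = m}"

definition restricted_series :: "(nat \<Rightarrow> bool) \<Rightarrow> nat \<Rightarrow> rat fps" where
  "restricted_series P i = Abs_fps (\<lambda>k. if P i \<and> k = 0 then 0 else 1)"

lemma card_restricted_exponents:
  assumes "finite A"
  shows "finite (restricted_exponents P A m) \<and>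
    fps_nth (\<Prod>i\<in>A. restricted_series P i) m = of_nat (card (restricted_exponents P A m))"
  using assms
proof (induction A arbitrary: m rule: finite_induct)
  case empty
  have "restricted_exponents P {} m = (if m = 0 then {\<lambda>_. 0} else {})"
    by (auto simp: restricted_exponents_def)
  then show ?case by simp
next
  case (insert x A)
  let ?K = "{k. k \<le> m \<and> (P x \<longrightarrow> 0 < k)}"
  define part where "part = (\<lambda>k. (\<lambda>b. b(x := k)) ` restricted_exponents P A (m - k))"
  have split: "restricted_exponents P (insert x A) m = (\<Union>k\<in>?K. part k)"
  proof (intro equalityI subsetI)
    fix b assume "b \<in> restricted_exponents P (insert x A) m"
    then have b: "\<And>i. i \<notin> insert x A \<Longrightarrow> b i = 0" "\<And>i. i \<in> insert x A \<Longrightarrow> P i \<Longrightarrow> 0 < b i" "b x + (\<Sum>i\<in>A. b i) = m"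
      using insert.hyps by (auto simp: restricted_exponents_def)
    have "(\<Sum>i\<in>A. (b(x := 0)) i) = (\<Sum>i\<in>A. b i)"
      using insert.hyps by (intro sum.cong) auto
    then have "b(x := 0) \<in> restricted_exponents P A (m - b x)"
      using b insert.hyps by (auto simp: restricted_exponents_def)
    moreover have "b = (b(x := 0))(x := b x)" by simp
    ultimately have "b \<in> part (b x)" unfolding part_def by (metis imageI)
    moreover have "b x \<in> ?K" using b by auto
    ultimately show "b \<in> (\<Union>k\<in>?K. part k)" by blast
  next
    fix b assume "b \<in> (\<Union>k\<in>?K. part k)"
    then obtain k c where k: "k \<le> m" "P x \<longrightarrow> 0 < k" "c \<in> restricted_exponents P A (m - k)" "b = c(x := k)"
      by (auto simp: part_def)
    have "(\<Sum>i\<in>A. (c(x := k)) i) = (\<Sum>i\<in>A. c i)"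
      using insert.hyps by (intro sum.cong) auto
    then show "b \<in> restricted_exponents P (insert x A) m"
      using k insert.hyps by (auto simp: restricted_exponents_def)
  qed
  have inj: "inj_on (\<lambda>b. b(x := k)) (restricted_exponents P A q)" for k q
  proof (rule inj_onI)
    fix b c assume "b \<in> restricted_exponents P A q" "c \<in> restricted_exponents P A q" and e: "b(x := k) = c(x := k)"
    then have "b x = c x" using insert.hyps by (auto simp: restricted_exponents_def)
    show "b = c"
    proof
      fix i
      show "b i = c i" using fun_cong[OF e, of i] \<open>b x = c x\<close> by (cases "i = x") auto
    qed
  qed
  have finp: "finite (part k)" for k using insert.IH by (simp add: part_def)
  have fin: "finite (restricted_exponents P (insert x A) m)" unfolding split using finp by auto
  have px: "b x = k" if "b \<in> part k" for b k using that by (auto simp: part_def)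
  have disj: "\<forall>k\<in>?K. \<forall>k'\<in>?K. k \<noteq> k' \<longrightarrow> part k \<inter> part k' = {}"
    using px by blast
  have cardp: "card (part k) = card (restricted_exponents P A (m - k))" for k
    unfolding part_def by (rule card_image[OF inj])
  have "fps_nth (\<Prod>i\<in>insert x A. restricted_series P i) m =
      (\<Sum>k=0..m. fps_nth (restricted_series P x) k * fps_nth (\<Prod>i\<in>A. restricted_series P i) (m - k))"
    using insert.hyps by (simp add: fps_mult_nth)
  also have "\<dots> = (\<Sum>k\<in>{0..m}. if k \<in> ?K then of_nat (card (part k)) else 0)"
    using insert.IH by (intro sum.cong) (auto simp: restricted_series_def cardp)
  also have "\<dots> = (\<Sum>k\<in>?K. of_nat (card (part k)))"
    by (subst sum.inter_filter[symmetric]) (auto intro!: sum.cong)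
  also have "\<dots> = of_nat (card (\<Union>k\<in>?K. part k))"
    using disj finp by (subst card_UN_disjoint) auto
  finally show ?case using fin unfolding split by simp
qed

lemma one_minus_fls_X_nonzero: "(1 - fls_X :: rat fls) \<noteq> 0"
proof
  assume "(1 - fls_X :: rat fls) = 0"
  then have "fls_nth (1 - fls_X :: rat fls) 0 = 0" by simp
  then show False by simp
qed

lemma restricted_series_fls:
  "fps_to_fls (restricted_series P i) = (if P i then fls_X / (1 - fls_X) else 1 / (1 - fls_X))"
proof -
  have X: "(fps_to_fls (1 - fps_X) :: rat fls) = 1 - fls_X"
    by simp
  have "(1 - fps_X) * restricted_series P i = (if P i then fps_X else 1)"
    by (rule fps_ext) (auto simp: restricted_series_def algebra_simps fps_X_nth)
  then have "fps_to_fls ((1 - fps_X) * restricted_series P i) = (if P i then fls_X else 1)"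
    by (auto simp: fps_X_to_fls)
  then have "(1 - fls_X) * fps_to_fls (restricted_series P i) = (if P i then fls_X else 1)"
    by (simp add: fls_times_fps_to_fls X)
  then show ?thesis using one_minus_fls_X_nonzero by (auto simp: field_simps)
qed

lemma prod_restricted_series:
  fixes A :: "nat set" and P :: "nat \<Rightarrow> bool"
  assumes "finite A"
  defines "s \<equiv> card {i\<in>A. \<not> P i}"
  shows "fps_to_fls (\<Prod>i\<in>A. restricted_series P i) =
    (\<Sum>i\<le>card A. of_nat (s choose i) * (fls_X / (1 - fls_X)) ^ (card A - i))"
proof -
  let ?y = "fls_X / (1 - fls_X) :: rat fls"
  have z: "1 / (1 - fls_X) = 1 + ?y" using one_minus_fls_X_nonzero by (simp add: field_simps)
  define w where "w = card {i\<in>A. P i}"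
  have ws: "card A = w + s"
  proof -
    have "A = {i\<in>A. P i} \<union> {i\<in>A. \<not> P i}" by blast
    then have "card A = card ({i\<in>A. P i} \<union> {i\<in>A. \<not> P i})" by simp
    also have "\<dots> = w + s" unfolding w_def s_def using assms(1) by (intro card_Un_disjoint) auto
    finally show ?thesis .
  qed
  have "fps_to_fls (\<Prod>i\<in>A. restricted_series P i) = (\<Prod>i\<in>A. fps_to_fls (restricted_series P i))"
    using assms(1) by (induction A rule: finite_induct) (auto simp: fls_times_fps_to_fls)
  also have "\<dots> = (\<Prod>i\<in>A. if P i then ?y else 1 + ?y)"
    by (simp only: restricted_series_fls z)
  also have "\<dots> = ?y ^ w * (1 + ?y) ^ s"
    using assms(1) unfolding w_def s_def by (simp add: prod.If_cases Int_def Collect_conj_eq[symmetric])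
  also have "(1 + ?y) ^ s = (\<Sum>i\<le>s. of_nat (s choose i) * ?y ^ (s - i))"
    by (subst binomial_ring) simp
  also have "?y ^ w * \<dots> = (\<Sum>i\<le>s. of_nat (s choose i) * ?y ^ (card A - i))"
    unfolding sum_distrib_left
  proof (rule sum.cong[OF refl])
    fix i assume "i \<in> {..s}"
    then have "card A - i = w + (s - i)" using ws by auto
    then show "?y ^ w * (of_nat (s choose i) * ?y ^ (s - i)) = of_nat (s choose i) * ?y ^ (card A - i)"
      by (simp only: power_add mult_ac)
  qed
  also have "\<dots> = (\<Sum>i\<le>card A. of_nat (s choose i) * ?y ^ (card A - i))"
    by (rule sum.mono_neutral_left) (use ws in \<open>auto simp: binomial_eq_0\<close>)
  finally show ?thesis .
qed

section \<open>The independence complex of a clique-whiskered graph\<close>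

text \<open>The clique-whiskered graph, with an enumeration \<open>xs\<close> of its vertices.\<close>

locale clique_whiskered =
  fixes V :: "'v set" and E :: "'v set set" and W :: "nat \<Rightarrow> 'v set" and r :: nat
    and xs :: "('v + nat) list"
  assumes graph: "simple_graph V E"
    and part: "clique_partition V E r W"
    and dist: "distinct xs" and set_xs: "set xs = whisker_verts V r"
begin

abbreviation "edges \<equiv> whisker_edges E r W"
abbreviation "verts \<equiv> whisker_verts V r"

text \<open>The independent sets of the whiskered graph, as sets of positions in \<open>xs\<close>.\<close>

definition face :: "nat set \<Rightarrow> bool" where
  "face F \<longleftrightarrow> F \<subseteq> {..<length xs} \<and> (\<forall>e\<in>edges. \<not> e \<subseteq> (!) xs ` F)"

text \<open>The block of an original vertex is the index of its clique, that of a new vertex is its own index.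
  The block of a vertex that does not belong to the graph is irrelevant.\<close>

definition block :: "'v + nat \<Rightarrow> nat" where
  "block z = (case z of Inl x \<Rightarrow> (THE a. a \<in> {1..r} \<and> x \<in> W a) | Inr a \<Rightarrow> a)"

definition blk :: "nat \<Rightarrow> nat" where "blk i = block (xs ! i)"

definition wh :: "nat \<Rightarrow> bool" where "wh i \<longleftrightarrow> xs ! i \<in> range Inr"

definition wv :: "nat \<Rightarrow> nat" where "wv b = (THE i. i < length xs \<and> xs ! i = Inr b)"

lemma W_unique: "a \<in> {1..r} \<Longrightarrow> b \<in> {1..r} \<Longrightarrow> x \<in> W a \<Longrightarrow> x \<in> W b \<Longrightarrow> a = b"
  using part disjoint_family_onD[of W "{1..r}" a b] unfolding clique_partition_def by blast

lemma W_subset: "a \<in> {1..r} \<Longrightarrow> x \<in> W a \<Longrightarrow> x \<in> V"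
  using part unfolding clique_partition_def by blast

lemma edge_verts: "e \<in> edges \<Longrightarrow> e \<subseteq> verts \<and> card e = 2"
proof -
  assume "e \<in> edges"
  then consider d where "d \<in> E" "e = Inl ` d" | a x where "a \<in> {1..r}" "x \<in> W a" "e = {Inl x, Inr a}"
    by (auto simp: whisker_edges_def)
  then show "e \<subseteq> verts \<and> card e = 2"
  proof cases
    case 1
    then show ?thesis using graph by (auto simp: simple_graph_def whisker_verts_def card_image)
  next
    case 2
    then show ?thesis using W_subset[OF 2(1,2)] by (simp add: whisker_verts_def)
  qed
qed

lemma block_Inl:
  assumes "x \<in> V"
  shows "block (Inl x) \<in> {1..r}" "x \<in> W (block (Inl x))"
proof -
  obtain a where a: "a \<in> {1..r}" "x \<in> W a" using assms part by (auto simp: clique_partition_def)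
  have "b = a" if "b \<in> {1..r} \<and> x \<in> W b" for b
    using that a W_unique by blast
  then have "(THE a. a \<in> {1..r} \<and> x \<in> W a) = a" using a by (intro the_equality) auto
  then show "block (Inl x) \<in> {1..r}" "x \<in> W (block (Inl x))" using a by (simp_all add: block_def)
qed

lemma block_Inr [simp]: "block (Inr a) = a"
  by (simp add: block_def)

lemma block_range: "z \<in> verts \<Longrightarrow> block z \<in> {1..r}"
  using block_Inl by (auto simp: whisker_verts_def)

text \<open>Two distinct vertices of the same block are adjacent.\<close>

lemma block_adjacent:
  assumes "u \<in> verts" "v \<in> verts" "u \<noteq> v" "block u = block v"
  shows "{u, v} \<in> edges"
proof -
  have whisk: "{Inl x, Inr a} \<in> edges" if "x \<in> V" "a \<in> {1..r}" "block (Inl x) = a" for x a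
    using that block_Inl[OF that(1)] by (auto simp: whisker_edges_def)
  consider x y where "u = Inl x" "v = Inl y" | x a where "u = Inl x" "v = Inr a"
    | x a where "v = Inl x" "u = Inr a" | a b where "u = Inr a" "v = Inr b"
    by (cases u; cases v) auto
  then show ?thesis
  proof cases
    case 1
    then have xy: "x \<in> V" "y \<in> V" "x \<noteq> y" using assms by (auto simp: whisker_verts_def)
    then have "{x, y} \<in> E"
      using block_Inl[OF xy(1)] block_Inl[OF xy(2)] assms(4) part 1
      by (auto simp: clique_partition_def clique_def)
    then have "Inl ` {x, y} \<in> edges" by (auto simp: whisker_edges_def simp del: image_insert)
    then show ?thesis using 1 by simp
  next
    case 2
    have "x \<in> V" "a \<in> {1..r}" using assms(1,2) unfolding 2 by (auto simp: whisker_verts_def)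
    moreover have "block (Inl x) = a" using assms(4) unfolding 2 by simp
    ultimately show ?thesis unfolding 2 by (rule whisk)
  next
    case 3
    have "x \<in> V" "a \<in> {1..r}" using assms(1,2) unfolding 3 by (auto simp: whisker_verts_def)
    moreover have "block (Inl x) = a" using assms(4) unfolding 3 by simp
    ultimately have "{v, u} \<in> edges" unfolding 3 by (rule whisk)
    then show ?thesis by (simp add: insert_commute)
  next
    case 4
    then show ?thesis using assms by simp
  qed
qed

lemma nth_verts: "i < length xs \<Longrightarrow> xs ! i \<in> verts"
  using set_xs nth_mem by blast

lemma nth_wv:
  assumes "b \<in> {1..r}"
  shows "wv b < length xs \<and> xs ! wv b = Inr b"
proof -
  have "Inr b \<in> set xs" using assms by (simp add: set_xs whisker_verts_def)
  then obtain i where i: "i < length xs" "xs ! i = Inr b" by (auto simp: in_set_conv_nth)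
  have uniq: "j = i" if "j < length xs \<and> xs ! j = Inr b" for j
    using that i nth_eq_iff_index_eq[OF dist, of j i] by simp
  have "wv b = i" unfolding wv_def by (rule the_equality, rule conjI[OF i], rule uniq)
  then show ?thesis using i by simp
qed

sublocale whiskered_complex "length xs" r face blk wv wh
proof
  show "F \<subseteq> {..<length xs}" if "face F" for F using that by (simp add: face_def)
  show "face G" if "face F" "G \<subseteq> F" for F G using that unfolding face_def by blast
  show "face {}"
  proof -
    have "\<not> e \<subseteq> {}" if "e \<in> edges" for e using edge_verts[OF that] by auto
    then show ?thesis by (auto simp: face_def)
  qed
  show br: "blk i \<in> {1..r}" if "i < length xs" for i
    using block_range[OF nth_verts[OF that]] by (simp add: blk_def)
  show "inj_on blk F" if F: "face F" for F
  proof (rule inj_onI, rule ccontr)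
    fix i j assume ij: "i \<in> F" "j \<in> F" "blk i = blk j" "i \<noteq> j"
    then have l: "i < length xs" "j < length xs" using F by (auto simp: face_def)
    then have "{xs ! i, xs ! j} \<in> edges"
      using ij dist by (intro block_adjacent nth_verts) (auto simp: blk_def nth_eq_iff_index_eq)
    moreover have "{xs ! i, xs ! j} \<subseteq> (!) xs ` F" using ij by auto
    ultimately show False using F unfolding face_def by blast
  qed
  show "wv b < length xs \<and> wh (wv b) \<and> blk (wv b) = b" if "b \<in> {1..r}" for b
    using nth_wv[OF that] by (simp add: wh_def blk_def)
  show "wv (blk i) = i" if i: "i < length xs" "wh i" for i
  proof -
    obtain a where a: "xs ! i = Inr a" using i by (auto simp: wh_def)
    then have "blk i = a" by (simp add: blk_def)
    then have "xs ! wv a = xs ! i" "wv a < length xs" using nth_wv[of a] br[OF i(1)] a by auto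
    then show ?thesis using \<open>blk i = a\<close> i dist by (simp add: nth_eq_iff_index_eq)
  qed
  show "face (insert (wv b) F)" if F: "face F" and b: "b \<in> {1..r}" "b \<notin> blk ` F" for F b
  proof -
    have "\<not> e \<subseteq> (!) xs ` insert (wv b) F" if e: "e \<in> edges" for e
    proof
      assume sub: "e \<subseteq> (!) xs ` insert (wv b) F"
      show False
      proof (cases "Inr b \<in> e")
        case True
        then obtain x where x: "x \<in> W b" "e = {Inl x, Inr b}" using e by (auto simp: whisker_edges_def)
        have "Inl x \<in> (!) xs ` F" using sub x nth_wv[OF b(1)] by auto
        then obtain i where i: "i \<in> F" "xs ! i = Inl x" by auto
        have xV: "x \<in> V" using W_subset[OF b(1) x(1)] .
        have "block (Inl x) = b" using W_unique[OF block_Inl(1)[OF xV] b(1) block_Inl(2)[OF xV] x(1)] .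
        then have "blk i = b" using i by (simp add: blk_def)
        then show False using i b by blast
      next
        case False
        then have "e \<subseteq> (!) xs ` F" using sub nth_wv[OF b(1)] by auto
        then show False using F e by (auto simp: face_def)
      qed
    qed
    then show ?thesis using F nth_wv[OF b(1)] by (auto simp: face_def)
  qed
qed

definition facets :: "nat set set" where
  "facets = {F. face F \<and> card F = r}"

text \<open>Minimal vertex covers are the complements of the facets.\<close>

lemma bij_betw_facets_covers:
  "bij_betw (\<lambda>F. verts - (!) xs ` F) facets (min_vertex_covers verts edges)"
proof (rule bij_betwI[where g = "\<lambda>C. {i. i < length xs \<and> xs ! i \<notin> C}"])
  show "(\<lambda>F. verts - (!) xs ` F) \<in> facets \<rightarrow> min_vertex_covers verts edges"
  proof
    fix F assume "F \<in> facets"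
    then have F: "face F" "card F = r" by (auto simp: facets_def)
    have "vertex_cover verts edges (verts - (!) xs ` F)"
      using F(1) edge_verts unfolding vertex_cover_def face_def by blast
    moreover have "D = verts - (!) xs ` F" if D: "vertex_cover verts edges D" "D \<subseteq> verts - (!) xs ` F" for D
    proof (rule ccontr)
      assume "D \<noteq> verts - (!) xs ` F"
      then obtain v where v: "v \<in> verts" "v \<notin> (!) xs ` F" "v \<notin> D" using D by blast
      then obtain k where k: "k < length xs" "xs ! k = v" using set_xs by (metis in_set_conv_nth)
      have kF: "k \<notin> F" using k v by blast
      have "face (insert k F)"
        unfolding face_def
      proof (intro conjI ballI notI)
        show "insert k F \<subseteq> {..<length xs}" using F k by (auto simp: face_def)
        fix e assume "e \<in> edges" "e \<subseteq> (!) xs ` insert k F"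
        then have "e \<inter> D = {}" using D v k by auto
        then show False using D(1) \<open>e \<in> edges\<close> by (auto simp: vertex_cover_def)
      qed
      from face_card_le[OF this] show False using kF F face_finite[OF F(1)] by simp
    qed
    ultimately show "verts - (!) xs ` F \<in> min_vertex_covers verts edges"
      by (auto simp: min_vertex_covers_def)
  qed
  show "(\<lambda>C. {i. i < length xs \<and> xs ! i \<notin> C}) \<in> min_vertex_covers verts edges \<rightarrow> facets"
  proof
    fix C assume "C \<in> min_vertex_covers verts edges"
    then have C: "vertex_cover verts edges C" "\<And>D. vertex_cover verts edges D \<Longrightarrow> D \<subseteq> C \<Longrightarrow> D = C"
      by (auto simp: min_vertex_covers_def)
    let ?F = "{i. i < length xs \<and> xs ! i \<notin> C}"
    have F: "face ?F"
      unfolding face_def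
    proof (intro conjI ballI notI)
      fix e assume "e \<in> edges" "e \<subseteq> (!) xs ` ?F"
      then show False using C(1) by (auto simp: vertex_cover_def)
    qed auto
    have "card ?F = r"
    proof (rule ccontr)
      assume "card ?F \<noteq> r"
      then have "card (blk ` ?F) \<noteq> card {1..r}" using card_image[OF face_inj[OF F]] by simp
      then have "blk ` ?F \<noteq> {1..r}" by metis
      then obtain b where b: "b \<in> {1..r}" "b \<notin> blk ` ?F" using blk_face_sub[OF F] by blast
      have "wv b \<notin> ?F" using b nth_wv[OF b(1)] by (force simp: blk_def)
      then have bC: "Inr b \<in> C" using nth_wv[OF b(1)] by auto
      have "vertex_cover verts edges (C - {Inr b})"
        unfolding vertex_cover_def
      proof (intro conjI ballI notI)
        show "C - {Inr b} \<subseteq> verts" using C(1) by (auto simp: vertex_cover_def)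
        fix e assume e: "e \<in> edges" "e \<inter> (C - {Inr b}) = {}"
        have "e \<subseteq> (!) xs ` insert (wv b) ?F"
        proof
          fix z assume z: "z \<in> e"
          then have "z \<in> set xs" using edge_verts[OF e(1)] set_xs by blast
          then obtain i where i: "i < length xs" "z = xs ! i" by (auto simp: in_set_conv_nth)
          show "z \<in> (!) xs ` insert (wv b) ?F"
          proof (cases "z = Inr b")
            case True
            then show ?thesis using nth_wv[OF b(1)] by force
          next
            case False
            then show ?thesis using e z i by auto
          qed
        qed
        then show False using face_wv[OF F b] e(1) by (auto simp: face_def)
      qed
      from C(2)[OF this] show False using bC by blast
    qed
    then show "?F \<in> facets" using F by (simp add: facets_def)
  qed
  fix F assume "F \<in> facets"
  then have F: "F \<subseteq> {..<length xs}" by (auto simp: facets_def face_def)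
  show "{i. i < length xs \<and> xs ! i \<notin> verts - (!) xs ` F} = F"
    using F nth_verts dist by (auto simp: nth_eq_iff_index_eq subset_iff)
next
  fix C assume "C \<in> min_vertex_covers verts edges"
  then have "C \<subseteq> verts" by (auto simp: min_vertex_covers_def vertex_cover_def)
  then show "verts - (!) xs ` {i. i < length xs \<and> xs ! i \<notin> C} = C"
    using nth_verts by (auto simp flip: set_xs simp: in_set_conv_nth)
qed

lemma card_old_vertices:
  assumes "F \<subseteq> {..<length xs}"
  shows "card (Inl ` V - (verts - (!) xs ` F)) = card {i\<in>F. \<not> wh i}"
proof -
  have "Inl ` V - (verts - (!) xs ` F) = (!) xs ` {i\<in>F. \<not> wh i}"
  proof (intro equalityI subsetI)
    fix z assume "z \<in> Inl ` V - (verts - (!) xs ` F)"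
    then show "z \<in> (!) xs ` {i\<in>F. \<not> wh i}" by (auto simp: whisker_verts_def wh_def)
  next
    fix z assume "z \<in> (!) xs ` {i\<in>F. \<not> wh i}"
    then obtain i where "i \<in> F" "\<not> wh i" "z = xs ! i" by auto
    then show "z \<in> Inl ` V - (verts - (!) xs ` F)"
      using nth_verts[of i] assms by (auto simp: whisker_verts_def wh_def)
  qed
  then show ?thesis using assms dist
    by (simp, intro card_image inj_onI) (auto simp: nth_eq_iff_index_eq subset_iff)
qed

end

section \<open>The Hilbert series\<close>

context whiskered_complex
begin

text \<open>The part of \<open>hbasis\<close> at a fixed facet.\<close>

definition hexponents :: "nat set \<Rightarrow> int \<Rightarrow> (nat \<Rightarrow> int) set" where
  "hexponents F l = {a. (F, a) \<in> hbasis l}"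

lemma hbasis_Sigma: "hbasis l = Sigma {F. face F \<and> card F = r} (\<lambda>F. hexponents F l)"
  by (auto simp: hexponents_def hbasis_def)

lemma hexponents_bij:
  assumes F: "face F" "card F = r" and l: "l \<le> 0"
  shows "bij_betw (\<lambda>b i. - int (b i)) (restricted_exponents wh F (nat (- l))) (hexponents F l)"
proof (rule bij_betwI[where g = "\<lambda>a i. nat (- a i)"])
  have Fn: "F \<subseteq> {..<n}" by (rule face_sub[OF F(1)])
  have sumF: "(\<Sum>i<n. a i) = (\<Sum>i\<in>F. a i)" if "\<And>i. i \<notin> F \<Longrightarrow> a i = 0" for a :: "nat \<Rightarrow> int"
    by (rule sum.mono_neutral_right) (use Fn that in auto)
  show "(\<lambda>b i. - int (b i)) \<in> restricted_exponents wh F (nat (- l)) \<rightarrow> hexponents F l"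
  proof
    fix b assume b: "b \<in> restricted_exponents wh F (nat (- l))"
    then have z: "\<And>i. i \<notin> F \<Longrightarrow> b i = 0" and "(\<Sum>i\<in>F. b i) = nat (- l)" by (auto simp: restricted_exponents_def)
    then have "int (\<Sum>i\<in>F. b i) = - l" using l by simp
    then have "(\<Sum>i<n. - int (b i)) = l" using sumF[of "\<lambda>i. - int (b i)"] z by (simp add: sum_negf)
    moreover have "vsupp (\<lambda>i. - int (b i)) \<subseteq> F" using z unfolding vsupp_def by force
    ultimately show "(\<lambda>i. - int (b i)) \<in> hexponents F l"
      using b F by (simp add: hexponents_def hbasis_def restricted_exponents_def)
  qed
  show "(\<lambda>a i. nat (- a i)) \<in> hexponents F l \<rightarrow> restricted_exponents wh F (nat (- l))"
  proof
    fix a assume "a \<in> hexponents F l"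
    then have a: "vsupp a \<subseteq> F" "\<And>i. a i \<le> 0" "\<And>i. i \<in> F \<Longrightarrow> wh i \<Longrightarrow> a i < 0" "(\<Sum>i<n. a i) = l"
      by (auto simp: hexponents_def hbasis_def)
    have z: "a i = 0" if "i \<notin> F" for i using a(1) that by (auto simp: vsupp_def)
    have "int (\<Sum>i\<in>F. nat (- a i)) = (\<Sum>i\<in>F. - a i)" using a(2) by simp
    also have "\<dots> = - l" using sumF[of a] z a(4) by (simp add: sum_negf)
    finally have "(\<Sum>i\<in>F. nat (- a i)) = nat (- l)" by linarith
    then show "(\<lambda>i. nat (- a i)) \<in> restricted_exponents wh F (nat (- l))"
      using z a(3) by (auto simp: restricted_exponents_def)
  qed
  show "(\<lambda>i. nat (- (- int (b i)))) = b" for b :: "nat \<Rightarrow> nat" by simp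
  fix a assume "a \<in> hexponents F l"
  then have "\<And>i. a i \<le> 0" by (auto simp: hexponents_def hbasis_def)
  then show "(\<lambda>i. - int (nat (- a i))) = a" by (auto simp: fun_eq_iff)
qed

text \<open>The exponent vectors at a facet with \<open>s\<close> original vertices have the generating function
  \<open>y ^ (r - s) * (1 + y) ^ s\<close> with \<open>y = t\<^sup>-\<^sup>1 / (1 - t\<^sup>-\<^sup>1)\<close>.\<close>

lemma hexponents_series:
  assumes F: "face F" "card F = r"
  shows "finite (hexponents F l) \<and>
    fls_nth (\<Sum>i\<le>r. of_nat (card {i\<in>F. \<not> wh i} choose i) * (fls_X / (1 - fls_X)) ^ (r - i)) (- l)
      = rat_of_nat (card (hexponents F l))"
proof -
  have finF: "finite F" using face_finite[OF F(1)] .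
  have ser: "(\<Sum>i\<le>r. of_nat (card {i\<in>F. \<not> wh i} choose i) * (fls_X / (1 - fls_X)) ^ (r - i)) =
      fps_to_fls (\<Prod>i\<in>F. restricted_series wh i)"
    using prod_restricted_series[OF finF, of wh] F(2) by simp
  show ?thesis
  proof (cases "l \<le> 0")
    case True
    note bij = hexponents_bij[OF F True]
    show ?thesis
      unfolding ser using True card_restricted_exponents[OF finF, of wh "nat (- l)"]
        bij_betw_finite[OF bij] bij_betw_same_card[OF bij] by simp
  next
    case False
    have "hexponents F l = {}"
    proof (rule ccontr)
      assume "hexponents F l \<noteq> {}"
      then obtain a where "\<And>i. a i \<le> 0" "(\<Sum>i<n. a i) = l" by (auto simp: hexponents_def hbasis_def)
      then show False using False sum_nonpos[of "{..<n}" a] by auto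
    qed
    then show ?thesis unfolding ser using False by simp
  qed
qed

lemma card_hbasis:
  "finite (hbasis l)"
  "fls_nth (\<Sum>F | face F \<and> card F = r. \<Sum>i\<le>r.
      of_nat (card {i\<in>F. \<not> wh i} choose i) * (fls_X / (1 - fls_X)) ^ (r - i)) (- l)
    = rat_of_nat (card (hbasis l))"
proof -
  let ?A = "{F. face F \<and> card F = r}"
  have finA: "finite ?A" by (rule finite_subset[OF _ finite_faces]) auto
  have finH: "\<forall>F\<in>?A. finite (hexponents F l)" using hexponents_series by blast
  show "finite (hbasis l)" unfolding hbasis_Sigma using finA finH by blast
  have "card (hbasis l) = (\<Sum>F\<in>?A. card (hexponents F l))"
    unfolding hbasis_Sigma using finA finH by (rule card_SigmaI)
  then show "fls_nth (\<Sum>F\<in>?A. \<Sum>i\<le>r.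
      of_nat (card {i\<in>F. \<not> wh i} choose i) * (fls_X / (1 - fls_X)) ^ (r - i)) (- l)
    = rat_of_nat (card (hbasis l))"
    unfolding fls_nth_sum[of _ ?A] of_nat_sum using hexponents_series by (auto intro!: sum.cong)
qed

end

context clique_whiskered
begin

lemma edge_ideal_faces:
  "(edge_ideal verts edges :: ('v + nat, 'k::field) mpoly set) =
    monomial_ideal (set xs) (\<lambda>A. \<not> face {i. i < length xs \<and> xs ! i \<in> A})"
proof -
  have "(\<exists>e\<in>edges. e \<subseteq> A) \<longleftrightarrow> \<not> face {i. i < length xs \<and> xs ! i \<in> A}" for A
  proof -
    have "(!) xs ` {i. i < length xs \<and> xs ! i \<in> A} = A \<inter> verts"
      unfolding set_xs[symmetric] by (auto simp: in_set_conv_nth)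
    then have "face {i. i < length xs \<and> xs ! i \<in> A} \<longleftrightarrow> (\<forall>e\<in>edges. \<not> e \<subseteq> A \<inter> verts)"
      by (auto simp: face_def)
    then show ?thesis using edge_verts by blast
  qed
  then show ?thesis
    by (subst edge_ideal_eq_monomial_ideal[OF edge_verts]) (simp_all add: set_xs)
qed

lemma stanley_reisner_edge_ideal:
  "stanley_reisner xs face (edge_ideal verts edges :: ('v + nat, 'k::field) mpoly set)"
  by (rule stanley_reisner.intro[OF dist face_sub face_mono edge_ideal_faces])

theorem hilbert_series:
  "has_hilbert_series_inv
     (local_cohomology_max xs (edge_ideal verts edges :: ('v + nat, 'k::field) mpoly set) r)
     (\<Sum>i\<le>r. \<Sum>C\<in>min_vertex_covers verts edges.
        of_nat (card (Inl ` V - C) choose i) * (fls_X / (1 - fls_X)) ^ (r - i))"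
proof -
  let ?I = "edge_ideal verts edges :: ('v + nat, 'k) mpoly set"
  interpret SR: stanley_reisner xs face ?I by (rule stanley_reisner_edge_ideal)
  let ?N = "\<lambda>l. local_cohomology_max xs ?I r l"
  have top: "card F \<noteq> Suc r" if "face F" for F using face_card_le[OF that] by simp
  have dim: "vectorspace ring_of_type_algebra (?N l) \<and> vectorspace.fin_dim ring_of_type_algebra (?N l) \<and>
      vectorspace.dim ring_of_type_algebra (?N l) = card (hbasis l)" for l
  proof -
    have B: "card F = r \<and> face (F \<union> vsupp a) \<and> (\<forall>i. i \<notin> F \<longrightarrow> 0 \<le> a i) \<and> (\<Sum>i<length xs. a i) = l"
      if "(F, a) \<in> hbasis l" for F a
    proof -
      have h: "face F" "card F = r" "vsupp a \<subseteq> F" "(\<Sum>i<length xs. a i) = l"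
        using that by (auto simp: hbasis_def)
      have "a i = 0" if "i \<notin> F" for i using h(3) that by (auto simp: vsupp_def)
      then show ?thesis using h by (simp add: Un_absorb2)
    qed
    have reduce: "\<exists>b\<in>SR.Bd r. \<forall>F a. (F, a) \<notin> hbasis l \<longrightarrow> f F a = b F a" if f: "f \<in> SR.Cxl r l" for f
    proof (rule reduce_to_hbasis)
      show "lin_closed (SR.Bd r)" by (rule SR.lin_closed_Bd)
      show "mdiff face j (delta G a) \<in> SR.Bd r"
        if "Suc j = r" "card G = j" "face (G \<union> vsupp a)" "\<And>i. i \<notin> G \<Longrightarrow> 0 \<le> a i" for j G a
      proof -
        have "{(F, a'). (delta G a :: 'k mcochain) F a' \<noteq> 0} = {(G, a)}" by (auto simp: delta_def)
        then have "(delta G a :: 'k mcochain) \<in> SR.Cx j"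
          unfolding SR.Cx_iff using that by (auto simp: delta_def)
        then show ?thesis using that(1) by (auto simp: SR.Bd_def)
      qed
      have fC: "f \<in> SR.Cx r" and deg: "\<And>F a. f F a \<noteq> 0 \<Longrightarrow> (\<Sum>i<length xs. a i) = l"
        using f by (auto simp: SR.Cxl_def)
      show "finite {(F, a). f F a \<noteq> 0}" using fC unfolding SR.Cx_iff by blast
      fix F a assume nz: "f F a \<noteq> 0"
      have h: "card F = r" "face (F \<union> vsupp a)" using fC nz unfolding SR.Cx_iff by blast+
      \<comment> \<open>a face with \<open>r\<close> elements is a facet\<close>
      have "F = F \<union> vsupp a"
        by (rule card_seteq) (use face_finite[OF h(2)] face_card_le[OF h(2)] h(1) in auto)
      then have "vsupp a \<subseteq> F" by blast
      then show "face F \<and> card F = r \<and> vsupp a \<subseteq> F \<and> (\<Sum>i<length xs. a i) = l"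
        using h face_mono[OF h(2), of F] deg[OF nz] by simp
    qed
    have indep: "b = 0" if b: "b \<in> SR.Bd r" and supp: "\<And>F a. (F, a) \<notin> hbasis l \<Longrightarrow> b F a = 0" for b
    proof (cases r)
      case 0
      have "SR.Bd r = SR.Bd 0" by (rule arg_cong[OF 0])
      also have "SR.Bd 0 = {0}" by (simp add: SR.Bd_def)
      finally show ?thesis using b by blast
    next
      case (Suc j)
      have "SR.Bd r = SR.Bd (Suc j)" by (rule arg_cong[OF Suc])
      also have "SR.Bd (Suc j) = mdiff face j ` SR.Cx j" by (simp add: SR.Bd_def)
      finally obtain T where T: "T \<in> SR.Cx j" "b = mdiff face j T" using b by blast
      have T0: "T G a = 0" if "i \<notin> G" "a i < 0" for G a i
        using T(1) that unfolding SR.Cx_iff by (meson not_le)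
      show ?thesis unfolding T(2)
        by (rule hbasis_independent[OF Suc[symmetric] T0 supp[unfolded T(2)]])
    qed
    show ?thesis
      using SR.local_cohomology_max_dim[OF top card_hbasis(1) B reduce indep] by blast
  qed
  have "(\<Sum>i\<le>r. \<Sum>C\<in>min_vertex_covers verts edges.
        of_nat (card (Inl ` V - C) choose i) * (fls_X / (1 - fls_X)) ^ (r - i) :: rat fls) =
      (\<Sum>C\<in>min_vertex_covers verts edges. \<Sum>i\<le>r.
        of_nat (card (Inl ` V - C) choose i) * (fls_X / (1 - fls_X)) ^ (r - i))"
    by (rule sum.swap)
  also have "\<dots> = (\<Sum>F\<in>facets. \<Sum>i\<le>r.
        of_nat (card (Inl ` V - (verts - (!) xs ` F)) choose i) * (fls_X / (1 - fls_X)) ^ (r - i))"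
    by (rule sum.reindex_bij_betw[OF bij_betw_facets_covers, symmetric])
  also have "\<dots> = (\<Sum>F\<in>facets. \<Sum>i\<le>r.
        of_nat (card {i\<in>F. \<not> wh i} choose i) * (fls_X / (1 - fls_X)) ^ (r - i))"
    by (rule sum.cong[OF refl], subst card_old_vertices) (auto simp: facets_def face_def)
  finally have series: "(\<Sum>i\<le>r. \<Sum>C\<in>min_vertex_covers verts edges.
        of_nat (card (Inl ` V - C) choose i) * (fls_X / (1 - fls_X)) ^ (r - i) :: rat fls) =
      (\<Sum>F | face F \<and> card F = r. \<Sum>i\<le>r.
        of_nat (card {i\<in>F. \<not> wh i} choose i) * (fls_X / (1 - fls_X)) ^ (r - i))"
    unfolding facets_def .
  show ?thesis
    unfolding has_hilbert_series_inv_def series using dim card_hbasis(2) by simp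
qed

end

theorem corollary3p13:
  fixes V :: "'v set" and E :: "'v set set" and W :: "nat \<Rightarrow> 'v set" and r :: nat
    and xs :: "('v + nat) list" and I :: "('v + nat, 'k::field) mpoly set"
  assumes "simple_graph V E"
    and "clique_partition V E r W"
    and "distinct xs" and "set xs = whisker_verts V r"
    and "I = edge_ideal (whisker_verts V r) (whisker_edges E r W)"
  shows "has_hilbert_series_inv (local_cohomology_max xs I r)
    (\<Sum>i\<le>r. \<Sum>C\<in>min_vertex_covers (whisker_verts V r) (whisker_edges E r W).
       of_nat (card (Inl ` V - C) choose i) * (fls_X / (1 - fls_X)) ^ (r - i))"
proof -
  interpret clique_whiskered V E W r xs by (rule clique_whiskered.intro[OF assms(1-4)])
  show ?thesis unfolding assms(5) by (rule hilbert_series)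
qed

end
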